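(* Let $d\ge1$, let $\mathcal{E}$ be an exact category, and let $\mathcal{U}$ be a $d$-rigid subcategory of $\mathcal{E}$ which is $d$-extension closed in $\mathcal{E}$. The following hold. (1) $\mathcal{U}$ is weakly right and weakly left maximal $d$-rigid in $\mathcal{U}_d(\mathcal{U}^d(\mathcal{E}))$. (2) If $\mathcal{U}$ is closed under additive complements in $\mathcal{E}$, then $\mathcal{U}$ is $d$-cluster tilting in $\mathcal{U}_d(\mathcal{U}^d(\mathcal{E}))$.
   Context: Conventions: all categories are additive; subcategories are full, closed under isomorphisms and finite direct sums. Exact categories are in the sense of Quillen, with conflations, inflations and deflations; an exact sequence is one spliced from conflations. An extension-closed subcategory of an exact category carries the induced exact structure (conflations of the ambient category with all terms in the subcategory). $\operatorname{Ext}$ denotes Yoneda Ext in the relevant exact category. $\mathcal{U}$ is closed under additive complements if $W\oplus U\in\mathcal{U}$ and $U\in\mathcal{U}$ imply $W\in\mathcal{U}$. $\mathcal{U}$ is $d$-rigid in $\mathcal{E}$ if $\operatorname{Ext}^i_{\mathcal{E}}(U,U')=0$ for all $0<i<d$ and $U,U'\in\mathcal{U}$. A $d$-rigid $\mathcal{U}$ is $d$-extension closed in $\mathcal{E}$ if any exact sequence $0\to U\to E_1\to\cdots\to E_d\to U'\to0$ in $\mathcal{E}$ with $U,U'\in\mathcal{U}$ is Yoneda equivalent to an exact sequence $0\to U\to U_1\to\cdots\to U_d\to U'\to0$ with all $U_i\in\mathcal{U}$. For a subcategory $\mathcal{U}$ of an exact category $\mathcal{C}$ put $\mathcal{U}^d(\mathcal{C})=\{E\in\mathcal{C}\mid\exists\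 0\to E\to U^1\to\cdots\to U^d\to0\text{ exact in }\mathcal{C},\ U^i\in\mathcal{U}\}$ and $\mathcal{U}_d(\mathcal{C})=\{E\in\mathcal{C}\mid\exists\ 0\to U_d\to\cdots\to U_1\to E\to0\text{ exact in }\mathcal{C},\ U_i\in\mathcal{U}\}$. When $\mathcal{U}$ is $d$-rigid and $d$-extension closed in $\mathcal{E}$, the subcategory $\mathcal{U}^d(\mathcal{E})$ is extension-closed in $\mathcal{E}$, hence an exact category containing $\mathcal{U}$, and $\mathcal{U}_d(\mathcal{U}^d(\mathcal{E}))$ is formed inside it; the latter is again extension-closed in $\mathcal{E}$ and carries the induced exact structure. A $d$-rigid subcategory $\mathcal{U}$ of an exact category $\mathcal{C}$ is weakly right maximal $d$-rigid if $\mathcal{U}^d(\mathcal{C})=\mathcal{C}$, and weakly left maximal $d$-rigid if $\mathcal{U}_d(\mathcal{C})=\mathcal{C}$. It is $d$-cluster tilting in $\mathcal{C}$ if it is generating (every $E\in\mathcal{C}$ admits a deflation $U\to E$ with $U\in\mathcal{U}$), cogenerating (every $E$ admits an inflation $E\to U$ with $U\in\mathcal{U}$), functorially finite, and $\mathcal{U}=\{E\in\mathcal{C}\mid\operatorname{Ext}^i_{\mathcal{C}}(E,\mathcal{U})=0,\ 0<i<d\}=\{E\in\mathcal{C}\mid\operatorname{Ext}^i_{\mathcal{C}}(\mathcal{U},E)=0,\ 0<i<d\}$. *)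

theory Defs
  imports "HOL-Algebra.Group"
begin

section \<open>Additive categories\<close>

record ('o, 'm) cat =
  Ob  :: "'o set"
  Mor :: "'m set"
  Dom :: "'m \<Rightarrow> 'o"
  Cod :: "'m \<Rightarrow> 'o"
  Idm :: "'o \<Rightarrow> 'm"
  Cmp :: "'m \<Rightarrow> 'm \<Rightarrow> 'm"  (infixl "\<cdot>\<index>" 70)
  Add :: "'m \<Rightarrow> 'm \<Rightarrow> 'm"
  Zer :: "'o \<Rightarrow> 'o \<Rightarrow> 'm"

text \<open>Composition is written in function order: \<open>g \<cdot>\<^bsub>C\<^esub> f\<close> is \<open>f\<close> followed by \<open>g\<close>.
  The values of the operations outside the relevant hom-sets are irrelevant.\<close>

definition Hom :: "('o, 'm, 'e) cat_scheme \<Rightarrow> 'o \<Rightarrow> 'o \<Rightarrow> 'm set" where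
  "Hom C A B = {f \<in> Mor C. Dom C f = A \<and> Cod C f = B}"

locale category =
  fixes C :: "('o, 'm, 'e) cat_scheme"
  assumes Dom_in_Ob: "f \<in> Mor C \<Longrightarrow> Dom C f \<in> Ob C"
    and Cod_in_Ob: "f \<in> Mor C \<Longrightarrow> Cod C f \<in> Ob C"
    and Idm_in_Hom: "A \<in> Ob C \<Longrightarrow> Idm C A \<in> Hom C A A"
    and Cmp_in_Hom: "f \<in> Hom C A B \<Longrightarrow> g \<in> Hom C B D \<Longrightarrow> g \<cdot>\<^bsub>C\<^esub> f \<in> Hom C A D"
    and Cmp_Idm: "f \<in> Hom C A B \<Longrightarrow> f \<cdot>\<^bsub>C\<^esub> Idm C A = f"
    and Idm_Cmp: "f \<in> Hom C A B \<Longrightarrow> Idm C B \<cdot>\<^bsub>C\<^esub> f = f"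
    and Cmp_assoc: "f \<in> Hom C A B \<Longrightarrow> g \<in> Hom C B D \<Longrightarrow> h \<in> Hom C D F \<Longrightarrow>
      h \<cdot>\<^bsub>C\<^esub> (g \<cdot>\<^bsub>C\<^esub> f) = (h \<cdot>\<^bsub>C\<^esub> g) \<cdot>\<^bsub>C\<^esub> f"

definition iso_mor :: "('o, 'm, 'e) cat_scheme \<Rightarrow> 'o \<Rightarrow> 'o \<Rightarrow> 'm \<Rightarrow> bool" where
  "iso_mor C A B f \<longleftrightarrow> f \<in> Hom C A B \<and>
     (\<exists>g \<in> Hom C B A. g \<cdot>\<^bsub>C\<^esub> f = Idm C A \<and> f \<cdot>\<^bsub>C\<^esub> g = Idm C B)"

definition isomorphic :: "('o, 'm, 'e) cat_scheme \<Rightarrow> 'o \<Rightarrow> 'o \<Rightarrow> bool" where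
  "isomorphic C A B \<longleftrightarrow> (\<exists>f. iso_mor C A B f)"

definition zero_object :: "('o, 'm, 'e) cat_scheme \<Rightarrow> 'o \<Rightarrow> bool" where
  "zero_object C Z \<longleftrightarrow> Z \<in> Ob C \<and>
     (\<forall>A \<in> Ob C. (\<exists>!f. f \<in> Hom C A Z) \<and> (\<exists>!f. f \<in> Hom C Z A))"

text \<open>The additive group of morphisms, phrased with the (multiplicatively written) groups of
  the library.\<close>

definition Hom_group :: "('o, 'm, 'e) cat_scheme \<Rightarrow> 'o \<Rightarrow> 'o \<Rightarrow> 'm monoid" where
  "Hom_group C A B = \<lparr>carrier = Hom C A B, mult = Add C, one = Zer C A B\<rparr>"

definition biproduct ::
    "('o, 'm, 'e) cat_scheme \<Rightarrow> 'o \<Rightarrow> 'o \<Rightarrow> 'o \<Rightarrow> 'm \<Rightarrow> 'm \<Rightarrow> 'm \<Rightarrow> 'm \<Rightarrow> bool" where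
  "biproduct C A B S iA iB pA pB \<longleftrightarrow>
     iA \<in> Hom C A S \<and> iB \<in> Hom C B S \<and> pA \<in> Hom C S A \<and> pB \<in> Hom C S B \<and>
     pA \<cdot>\<^bsub>C\<^esub> iA = Idm C A \<and> pB \<cdot>\<^bsub>C\<^esub> iB = Idm C B \<and>
     pB \<cdot>\<^bsub>C\<^esub> iA = Zer C A B \<and> pA \<cdot>\<^bsub>C\<^esub> iB = Zer C B A \<and>
     Add C (iA \<cdot>\<^bsub>C\<^esub> pA) (iB \<cdot>\<^bsub>C\<^esub> pB) = Idm C S"

definition direct_sum :: "('o, 'm, 'e) cat_scheme \<Rightarrow> 'o \<Rightarrow> 'o \<Rightarrow> 'o \<Rightarrow> bool" where
  "direct_sum C A B S \<longleftrightarrow> (\<exists>iA iB pA pB. biproduct C A B S iA iB pA pB)"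

locale additive_category = category C
  for C :: "('o, 'm, 'e) cat_scheme" +
  assumes Hom_comm_group: "A \<in> Ob C \<Longrightarrow> B \<in> Ob C \<Longrightarrow> comm_group (Hom_group C A B)"
    and Cmp_Add_left: "f \<in> Hom C A B \<Longrightarrow> g \<in> Hom C B D \<Longrightarrow> g' \<in> Hom C B D \<Longrightarrow>
      Add C g g' \<cdot>\<^bsub>C\<^esub> f = Add C (g \<cdot>\<^bsub>C\<^esub> f) (g' \<cdot>\<^bsub>C\<^esub> f)"
    and Cmp_Add_right: "f \<in> Hom C A B \<Longrightarrow> f' \<in> Hom C A B \<Longrightarrow> g \<in> Hom C B D \<Longrightarrow>
      g \<cdot>\<^bsub>C\<^esub> Add C f f' = Add C (g \<cdot>\<^bsub>C\<^esub> f) (g \<cdot>\<^bsub>C\<^esub> f')"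
    and zero_object_exists: "\<exists>Z. zero_object C Z"
    and direct_sum_exists: "A \<in> Ob C \<Longrightarrow> B \<in> Ob C \<Longrightarrow> \<exists>S. direct_sum C A B S"

text \<open>A full additive subcategory is given by its set of objects.\<close>

definition subcategory :: "('o, 'm, 'e) cat_scheme \<Rightarrow> 'o set \<Rightarrow> bool" where
  "subcategory C U \<longleftrightarrow> U \<subseteq> Ob C \<and>
     (\<forall>A B. A \<in> U \<longrightarrow> isomorphic C A B \<longrightarrow> B \<in> U) \<and>
     (\<forall>Z. zero_object C Z \<longrightarrow> Z \<in> U) \<and>
     (\<forall>A B S. A \<in> U \<longrightarrow> B \<in> U \<longrightarrow> direct_sum C A B S \<longrightarrow> S \<in> U)"

definition closed_under_additive_complements ::
    "('o, 'm, 'e) cat_scheme \<Rightarrow> 'o set \<Rightarrow> bool" where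
  "closed_under_additive_complements C U \<longleftrightarrow>
     (\<forall>W V S. direct_sum C W V S \<longrightarrow> S \<in> U \<longrightarrow> V \<in> U \<longrightarrow> W \<in> U)"


section \<open>Exact categories\<close>

record ('o, 'm) excat = "('o, 'm) cat" +
  Conf :: "('m \<times> 'm) set"

definition inflation :: "('o, 'm, 'e) excat_scheme \<Rightarrow> 'm \<Rightarrow> bool" where
  "inflation C i \<longleftrightarrow> (\<exists>p. (i, p) \<in> Conf C)"

definition deflation :: "('o, 'm, 'e) excat_scheme \<Rightarrow> 'm \<Rightarrow> bool" where
  "deflation C p \<longleftrightarrow> (\<exists>i. (i, p) \<in> Conf C)"

definition is_kernel :: "('o, 'm, 'e) cat_scheme \<Rightarrow> 'm \<Rightarrow> 'm \<Rightarrow> bool" where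
  "is_kernel C i p \<longleftrightarrow> i \<in> Mor C \<and> p \<in> Mor C \<and> Cod C i = Dom C p \<and>
     p \<cdot>\<^bsub>C\<^esub> i = Zer C (Dom C i) (Cod C p) \<and>
     (\<forall>f \<in> Mor C. Cod C f = Dom C p \<longrightarrow> p \<cdot>\<^bsub>C\<^esub> f = Zer C (Dom C f) (Cod C p) \<longrightarrow>
        (\<exists>!g. g \<in> Hom C (Dom C f) (Dom C i) \<and> i \<cdot>\<^bsub>C\<^esub> g = f))"

definition is_cokernel :: "('o, 'm, 'e) cat_scheme \<Rightarrow> 'm \<Rightarrow> 'm \<Rightarrow> bool" where
  "is_cokernel C i p \<longleftrightarrow> i \<in> Mor C \<and> p \<in> Mor C \<and> Cod C i = Dom C p \<and>
     p \<cdot>\<^bsub>C\<^esub> i = Zer C (Dom C i) (Cod C p) \<and>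
     (\<forall>f \<in> Mor C. Dom C f = Cod C i \<longrightarrow> f \<cdot>\<^bsub>C\<^esub> i = Zer C (Dom C i) (Cod C f) \<longrightarrow>
        (\<exists>!g. g \<in> Hom C (Cod C p) (Cod C f) \<and> g \<cdot>\<^bsub>C\<^esub> p = f))"

text \<open>The squares are \<open>i' \<cdot> f = f' \<cdot> i\<close> with \<open>i : A \<rightarrow> B\<close>, \<open>f : A \<rightarrow> A'\<close> (pushout) and
  \<open>p \<cdot> f' = f \<cdot> p'\<close> with \<open>p : B \<rightarrow> D\<close>, \<open>f : D' \<rightarrow> D\<close> (pullback).\<close>

definition is_pushout :: "('o, 'm, 'e) cat_scheme \<Rightarrow> 'm \<Rightarrow> 'm \<Rightarrow> 'm \<Rightarrow> 'm \<Rightarrow> bool" where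
  "is_pushout C i f i' f' \<longleftrightarrow>
     i \<in> Mor C \<and> f \<in> Mor C \<and> Dom C i = Dom C f \<and>
     i' \<in> Mor C \<and> f' \<in> Mor C \<and> Dom C i' = Cod C f \<and> Dom C f' = Cod C i \<and> Cod C i' = Cod C f' \<and>
     i' \<cdot>\<^bsub>C\<^esub> f = f' \<cdot>\<^bsub>C\<^esub> i \<and>
     (\<forall>T. \<forall>u \<in> Hom C (Cod C f) T. \<forall>v \<in> Hom C (Cod C i) T. u \<cdot>\<^bsub>C\<^esub> f = v \<cdot>\<^bsub>C\<^esub> i \<longrightarrow>
        (\<exists>!w. w \<in> Hom C (Cod C i') T \<and> w \<cdot>\<^bsub>C\<^esub> i' = u \<and> w \<cdot>\<^bsub>C\<^esub> f' = v))"

definition is_pullback :: "('o, 'm, 'e) cat_scheme \<Rightarrow> 'm \<Rightarrow> 'm \<Rightarrow> 'm \<Rightarrow> 'm \<Rightarrow> bool" where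
  "is_pullback C p f p' f' \<longleftrightarrow>
     p \<in> Mor C \<and> f \<in> Mor C \<and> Cod C p = Cod C f \<and>
     p' \<in> Mor C \<and> f' \<in> Mor C \<and> Cod C p' = Dom C f \<and> Cod C f' = Dom C p \<and> Dom C p' = Dom C f' \<and>
     p \<cdot>\<^bsub>C\<^esub> f' = f \<cdot>\<^bsub>C\<^esub> p' \<and>
     (\<forall>T. \<forall>u \<in> Hom C T (Dom C f). \<forall>v \<in> Hom C T (Dom C p). f \<cdot>\<^bsub>C\<^esub> u = p \<cdot>\<^bsub>C\<^esub> v \<longrightarrow>
        (\<exists>!w. w \<in> Hom C T (Dom C p') \<and> p' \<cdot>\<^bsub>C\<^esub> w = u \<and> f' \<cdot>\<^bsub>C\<^esub> w = v))"

text \<open>Quillen's axioms in the form of Keller and Buehler (Quillen's remaining axiom, on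
  morphisms having a cokernel, is a consequence of these).\<close>

locale exact_category = additive_category C
  for C :: "('o, 'm, 'e) excat_scheme" +
  assumes Conf_kernel_cokernel: "(i, p) \<in> Conf C \<Longrightarrow> is_kernel C i p \<and> is_cokernel C i p"
    and Conf_iso_closed:
      "(i, p) \<in> Conf C \<Longrightarrow> i' \<in> Mor C \<Longrightarrow> p' \<in> Mor C \<Longrightarrow> Cod C i' = Dom C p' \<Longrightarrow>
       iso_mor C (Dom C i) (Dom C i') a \<Longrightarrow> iso_mor C (Cod C i) (Cod C i') b \<Longrightarrow>
       iso_mor C (Cod C p) (Cod C p') c \<Longrightarrow>
       i' \<cdot>\<^bsub>C\<^esub> a = b \<cdot>\<^bsub>C\<^esub> i \<Longrightarrow> p' \<cdot>\<^bsub>C\<^esub> b = c \<cdot>\<^bsub>C\<^esub> p \<Longrightarrow> (i', p') \<in> Conf C"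
    and inflation_Idm: "A \<in> Ob C \<Longrightarrow> inflation C (Idm C A)"
    and deflation_Idm: "A \<in> Ob C \<Longrightarrow> deflation C (Idm C A)"
    and inflation_Cmp:
      "inflation C i \<Longrightarrow> inflation C j \<Longrightarrow> Cod C i = Dom C j \<Longrightarrow> inflation C (j \<cdot>\<^bsub>C\<^esub> i)"
    and deflation_Cmp:
      "deflation C p \<Longrightarrow> deflation C q \<Longrightarrow> Cod C p = Dom C q \<Longrightarrow> deflation C (q \<cdot>\<^bsub>C\<^esub> p)"
    and inflation_pushout:
      "inflation C i \<Longrightarrow> f \<in> Mor C \<Longrightarrow> Dom C f = Dom C i \<Longrightarrow>
       \<exists>i' f'. is_pushout C i f i' f' \<and> inflation C i'"
    and deflation_pullback:
      "deflation C p \<Longrightarrow> f \<in> Mor C \<Longrightarrow> Cod C f = Cod C p \<Longrightarrow>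
       \<exists>p' f'. is_pullback C p f p' f' \<and> deflation C p'"

text \<open>The full subcategory on the objects \<open>S\<close>, with the induced class of conflations.\<close>

definition full_sub :: "('o, 'm) excat \<Rightarrow> 'o set \<Rightarrow> ('o, 'm) excat" where
  "full_sub C S = C\<lparr>Ob := S,
     Mor := {f \<in> Mor C. Dom C f \<in> S \<and> Cod C f \<in> S},
     Conf := {(i, p) \<in> Conf C. Dom C i \<in> S \<and> Cod C i \<in> S \<and> Cod C p \<in> S}\<rparr>"


section \<open>Exact sequences and Yoneda Ext\<close>

text \<open>A nonempty list \<open>[f\<^sub>0, \<dots>, f\<^sub>m\<^sub>-\<^sub>1]\<close> of morphisms \<open>f\<^sub>j : A\<^sub>j \<rightarrow> A\<^sub>j\<^sub>+\<^sub>1\<close> stands for the sequence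
  \<open>0 \<rightarrow> A\<^sub>0 \<rightarrow> \<dots> \<rightarrow> A\<^sub>m \<rightarrow> 0\<close>. It is exact if there are conflations
  \<open>K\<^sub>j \<rightarrow> A\<^sub>j \<rightarrow> K\<^sub>j\<^sub>+\<^sub>1\<close> (\<open>0 \<le> j \<le> m\<close>), with \<open>K\<^sub>0\<close> and \<open>K\<^sub>m\<^sub>+\<^sub>1\<close> zero objects, such that \<open>f\<^sub>j\<close> is the
  composite \<open>A\<^sub>j \<rightarrow> K\<^sub>j\<^sub>+\<^sub>1 \<rightarrow> A\<^sub>j\<^sub>+\<^sub>1\<close>. For \<open>m = 1\<close> this says that \<open>f\<^sub>0\<close> is an isomorphism,
  and for \<open>m = 2\<close> that \<open>(f\<^sub>0, f\<^sub>1)\<close> is a conflation.\<close>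

definition exact_seq :: "('o, 'm, 'e) excat_scheme \<Rightarrow> 'm list \<Rightarrow> bool" where
  "exact_seq C fs \<longleftrightarrow> fs \<noteq> [] \<and>
     (\<exists>i p. (\<forall>j \<le> length fs. (i j, p j) \<in> Conf C) \<and>
        zero_object C (Dom C (i 0)) \<and> zero_object C (Cod C (p (length fs))) \<and>
        (\<forall>j < length fs. Cod C (p j) = Dom C (i (Suc j)) \<and> fs ! j = i (Suc j) \<cdot>\<^bsub>C\<^esub> p j))"

definition seq_term :: "('o, 'm, 'e) cat_scheme \<Rightarrow> 'm list \<Rightarrow> nat \<Rightarrow> 'o" where
  "seq_term C fs j = (if j < length fs then Dom C (fs ! j) else Cod C (last fs))"

text \<open>The exact sequences \<open>0 \<rightarrow> Y \<rightarrow> E\<^sub>1 \<rightarrow> \<dots> \<rightarrow> E\<^sub>n \<rightarrow> X \<rightarrow> 0\<close>; here \<open>E\<^sub>j\<close> is \<open>seq_term C fs j\<close>.\<close>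

definition extensions :: "('o, 'm, 'e) excat_scheme \<Rightarrow> nat \<Rightarrow> 'o \<Rightarrow> 'o \<Rightarrow> 'm list set" where
  "extensions C n X Y = {fs. length fs = Suc n \<and> exact_seq C fs \<and>
     seq_term C fs 0 = Y \<and> seq_term C fs (Suc n) = X}"

text \<open>Morphisms of exact sequences which are the identity at both ends.\<close>

definition yoneda_step ::
    "('o, 'm, 'e) excat_scheme \<Rightarrow> nat \<Rightarrow> 'o \<Rightarrow> 'o \<Rightarrow> ('m list \<times> 'm list) set" where
  "yoneda_step C n X Y = {(fs, gs). fs \<in> extensions C n X Y \<and> gs \<in> extensions C n X Y \<and>
     (\<exists>h. (\<forall>j \<le> Suc n. h j \<in> Hom C (seq_term C fs j) (seq_term C gs j)) \<and>
          h 0 = Idm C Y \<and> h (Suc n) = Idm C X \<and>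
          (\<forall>j \<le> n. gs ! j \<cdot>\<^bsub>C\<^esub> h j = h (Suc j) \<cdot>\<^bsub>C\<^esub> fs ! j))}"

definition yoneda_equiv ::
    "('o, 'm, 'e) excat_scheme \<Rightarrow> nat \<Rightarrow> 'o \<Rightarrow> 'o \<Rightarrow> ('m list \<times> 'm list) set" where
  "yoneda_equiv C n X Y = (yoneda_step C n X Y \<union> (yoneda_step C n X Y)\<inverse>)\<^sup>*"

text \<open>The underlying set of the Yoneda group \<open>Ext\<^sup>n(X, Y)\<close>, for \<open>n \<ge> 1\<close>.\<close>

definition Ext :: "('o, 'm, 'e) excat_scheme \<Rightarrow> nat \<Rightarrow> 'o \<Rightarrow> 'o \<Rightarrow> 'm list set set" where
  "Ext C n X Y = extensions C n X Y // yoneda_equiv C n X Y"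

text \<open>A group is zero iff its underlying set is a singleton; so the Baer sum is not needed to
  express that \<open>Ext\<^sup>n(X, Y) = 0\<close>.\<close>

definition Ext_zero :: "('o, 'm, 'e) excat_scheme \<Rightarrow> nat \<Rightarrow> 'o \<Rightarrow> 'o \<Rightarrow> bool" where
  "Ext_zero C n X Y \<longleftrightarrow> is_singleton (Ext C n X Y)"


section \<open>Rigid and cluster tilting subcategories\<close>

definition d_rigid :: "nat \<Rightarrow> ('o, 'm) excat \<Rightarrow> 'o set \<Rightarrow> bool" where
  "d_rigid d C U \<longleftrightarrow> subcategory C U \<and>
     (\<forall>i V V'. 0 < i \<longrightarrow> i < d \<longrightarrow> V \<in> U \<longrightarrow> V' \<in> U \<longrightarrow> Ext_zero C i V V')"

definition d_extension_closed :: "nat \<Rightarrow> ('o, 'm) excat \<Rightarrow> 'o set \<Rightarrow> bool" where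
  "d_extension_closed d C U \<longleftrightarrow>
     (\<forall>V \<in> U. \<forall>V' \<in> U. \<forall>fs \<in> extensions C d V' V.
        \<exists>gs \<in> extensions C d V' V. (fs, gs) \<in> yoneda_equiv C d V' V \<and>
          (\<forall>j. 1 \<le> j \<and> j \<le> d \<longrightarrow> seq_term C gs j \<in> U))"

text \<open>\<open>upper_sub d C U\<close> is \<open>U\<^sup>d(C)\<close> and \<open>lower_sub d C U\<close> is \<open>U\<^sub>d(C)\<close>.\<close>

definition upper_sub :: "nat \<Rightarrow> ('o, 'm) excat \<Rightarrow> 'o set \<Rightarrow> 'o set" where
  "upper_sub d C U = {A \<in> Ob C. \<exists>fs. length fs = d \<and> exact_seq C fs \<and> seq_term C fs 0 = A \<and>
     (\<forall>j. 1 \<le> j \<and> j \<le> d \<longrightarrow> seq_term C fs j \<in> U)}"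

definition lower_sub :: "nat \<Rightarrow> ('o, 'm) excat \<Rightarrow> 'o set \<Rightarrow> 'o set" where
  "lower_sub d C U = {A \<in> Ob C. \<exists>fs. length fs = d \<and> exact_seq C fs \<and> seq_term C fs d = A \<and>
     (\<forall>j < d. seq_term C fs j \<in> U)}"

definition weakly_right_maximal_rigid :: "nat \<Rightarrow> ('o, 'm) excat \<Rightarrow> 'o set \<Rightarrow> bool" where
  "weakly_right_maximal_rigid d C U \<longleftrightarrow>
     exact_category C \<and> d_rigid d C U \<and> upper_sub d C U = Ob C"

definition weakly_left_maximal_rigid :: "nat \<Rightarrow> ('o, 'm) excat \<Rightarrow> 'o set \<Rightarrow> bool" where
  "weakly_left_maximal_rigid d C U \<longleftrightarrow>
     exact_category C \<and> d_rigid d C U \<and> lower_sub d C U = Ob C"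

definition generating :: "('o, 'm) excat \<Rightarrow> 'o set \<Rightarrow> bool" where
  "generating C U \<longleftrightarrow> (\<forall>A \<in> Ob C. \<exists>V \<in> U. \<exists>p \<in> Hom C V A. deflation C p)"

definition cogenerating :: "('o, 'm) excat \<Rightarrow> 'o set \<Rightarrow> bool" where
  "cogenerating C U \<longleftrightarrow> (\<forall>A \<in> Ob C. \<exists>V \<in> U. \<exists>i \<in> Hom C A V. inflation C i)"

text \<open>Existence of right, respectively left, \<open>U\<close>-approximations of every object.\<close>

definition contravariantly_finite :: "('o, 'm, 'e) cat_scheme \<Rightarrow> 'o set \<Rightarrow> bool" where
  "contravariantly_finite C U \<longleftrightarrow> (\<forall>A \<in> Ob C. \<exists>V \<in> U. \<exists>f \<in> Hom C V A.
     \<forall>V' \<in> U. \<forall>g \<in> Hom C V' A. \<exists>h \<in> Hom C V' V. f \<cdot>\<^bsub>C\<^esub> h = g)"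

definition covariantly_finite :: "('o, 'm, 'e) cat_scheme \<Rightarrow> 'o set \<Rightarrow> bool" where
  "covariantly_finite C U \<longleftrightarrow> (\<forall>A \<in> Ob C. \<exists>V \<in> U. \<exists>f \<in> Hom C A V.
     \<forall>V' \<in> U. \<forall>g \<in> Hom C A V'. \<exists>h \<in> Hom C V V'. h \<cdot>\<^bsub>C\<^esub> f = g)"

definition functorially_finite :: "('o, 'm, 'e) cat_scheme \<Rightarrow> 'o set \<Rightarrow> bool" where
  "functorially_finite C U \<longleftrightarrow> contravariantly_finite C U \<and> covariantly_finite C U"

definition d_cluster_tilting :: "nat \<Rightarrow> ('o, 'm) excat \<Rightarrow> 'o set \<Rightarrow> bool" where
  "d_cluster_tilting d C U \<longleftrightarrow> exact_category C \<and> d_rigid d C U \<and>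
     generating C U \<and> cogenerating C U \<and> functorially_finite C U \<and>
     U = {A \<in> Ob C. \<forall>i V. 0 < i \<longrightarrow> i < d \<longrightarrow> V \<in> U \<longrightarrow> Ext_zero C i A V} \<and>
     U = {A \<in> Ob C. \<forall>i V. 0 < i \<longrightarrow> i < d \<longrightarrow> V \<in> U \<longrightarrow> Ext_zero C i V A}"

end

theory Submission
  imports Defs
begin

text \<open>An exact sequence is spliced from a chain of conflations, and two of them are Yoneda equivalent
  iff both receive a morphism, with identities at the ends, from a third one. This is shown
  without the group structure of \<open>Ext\<close>, from the fact that chains have weak pullbacks along
  deflations of their left end; it allows to cancel a conflation from two equivalent splices
  when the relevant \<open>Ext\<close> vanishes, and hence to shift dimensions.

  For a \<open>d\<close>-rigid and \<open>d\<close>-extension closed \<open>U\<close> this yields (a) \<open>Ext\<^sup>1(A, U) = 0\<close> for \<open>A\<close> in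
  \<open>U\<^sup>d\<^sup>-\<^sup>1\<close>, and (b) a sequence \<open>0 \<rightarrow> V' \<rightarrow> Y \<rightarrow> V\<^sup>1 \<rightarrow> \<dots> \<rightarrow> V\<^sup>d \<rightarrow> 0\<close> with all terms except
  \<open>Y\<close> in \<open>U\<close> maps, with identities at the ends, to one with all terms in \<open>U\<close>. The mapping cone
  of this map coresolves \<open>Y\<close>, which makes \<open>U\<^sup>d\<close> extension closed. Properties (a), (b) and their duals
  only involve sequences with terms in \<open>U\<close>, so \<open>U\<^sup>d(E)\<close> inherits them, and the dual argument
  applies to \<open>U\<^sub>d(U\<^sup>d(E))\<close>. An object \<open>X\<close> of the latter embeds into some \<open>X'\<close> with a shorter
  resolution and with \<open>X'/X\<close> in \<open>U\<close>; from this one gets a coresolution of \<open>X\<close> by \<open>U\<close> inside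
  \<open>U\<^sub>d(U\<^sup>d(E))\<close>. The remaining claims follow by dimension shifting.\<close>

section \<open>The opposite exact category\<close>

text \<open>Ext depends on the ambient exact category: a subcategory has fewer exact sequences, but
  also fewer equivalences between them. So rigidity of \<open>U\<close> in the final category does
  not follow from rigidity in \<open>E\<close>. What passes to subcategories is the splitting of
  conflations and the existence of morphisms between given sequences; the locale
  \<open>lifting\<close> records only facts of this kind. Rigidity is proved anew in
  \<open>EZ_U\<close>, by resolving the middle terms of an arbitrary extension by \<open>U\<close>.
  A second obstacle is that \<open>d\<close>-extension closedness yields a zigzag of Yoneda steps,
  whereas a mapping cone needs one morphism that starts at the given sequence. Straightening the
  zigzag is the task of \<open>chain_lift\<close>. Without Baer sums there is no long exact Ext
  sequence; the one piece of its exactness that matters is \<open>splice_cancel\<close>, proved with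
  representatives. Left and right versions of a statement are related by \<open>opp\<close>. The
  number \<open>N\<close> in the later locales is \<open>d - 1\<close>, because \<open>U^d\<close>
  asks for \<open>N + 1\<close> terms.\<close>

definition opp :: "('o, 'm) excat \<Rightarrow> ('o, 'm) excat" where
  "opp C = C\<lparr>Dom := Cod C, Cod := Dom C, Cmp := (\<lambda>g f. f \<cdot>\<^bsub>C\<^esub> g), Zer := (\<lambda>A B. Zer C B A),
     Conf := {(p, i). (i, p) \<in> Conf C}\<rparr>"

lemma opp_simps [simp]:
  "Ob (opp C) = Ob C" "Mor (opp C) = Mor C" "Dom (opp C) = Cod C" "Cod (opp C) = Dom C"
  "Idm (opp C) = Idm C" "Cmp (opp C) g f = f \<cdot>\<^bsub>C\<^esub> g" "Add (opp C) = Add C"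
  "Zer (opp C) A B = Zer C B A" "(p, i) \<in> Conf (opp C) \<longleftrightarrow> (i, p) \<in> Conf C"
  by (simp_all add: opp_def)

lemma opp_opp [simp]: "opp (opp C) = C"
  by (cases C) (simp add: opp_def)

lemma Hom_opp [simp]: "Hom (opp C) A B = Hom C B A"
  by (auto simp: Hom_def)

lemma iso_mor_opp [simp]: "iso_mor (opp C) A B f \<longleftrightarrow> iso_mor C B A f"
  by (auto simp: iso_mor_def)

lemma zero_object_opp [simp]: "zero_object (opp C) Z \<longleftrightarrow> zero_object C Z"
  by (auto simp: zero_object_def)

lemma biproduct_opp [simp]: "biproduct (opp C) A B S pA pB iA iB \<longleftrightarrow> biproduct C A B S iA iB pA pB"
  by (auto simp: biproduct_def)

lemma direct_sum_opp [simp]: "direct_sum (opp C) A B S \<longleftrightarrow> direct_sum C A B S"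
  unfolding direct_sum_def biproduct_opp by blast

lemma isomorphic_sym: "isomorphic C A B \<Longrightarrow> isomorphic C B A"
  by (auto simp: isomorphic_def iso_mor_def)

lemma isomorphic_opp [simp]: "isomorphic (opp C) A B \<longleftrightarrow> isomorphic C A B"
  using isomorphic_sym[of C] by (auto simp: isomorphic_def)

lemma subcategory_opp [simp]: "subcategory (opp C) U \<longleftrightarrow> subcategory C U"
  by (auto simp: subcategory_def)

lemma closed_under_additive_complements_opp [simp]:
  "closed_under_additive_complements (opp C) U \<longleftrightarrow> closed_under_additive_complements C U"
  by (simp add: closed_under_additive_complements_def)

lemma inflation_opp [simp]: "inflation (opp C) p \<longleftrightarrow> deflation C p"
  by (simp add: inflation_def deflation_def)

lemma deflation_opp [simp]: "deflation (opp C) i \<longleftrightarrow> inflation C i"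
  by (simp add: inflation_def deflation_def)

lemma is_kernel_opp [simp]: "is_kernel (opp C) p i \<longleftrightarrow> is_cokernel C i p"
  unfolding is_kernel_def is_cokernel_def opp_simps Hom_opp
  by (rule iffI; elim conjE; intro conjI; (assumption | erule sym))

lemma is_cokernel_opp [simp]: "is_cokernel (opp C) p i \<longleftrightarrow> is_kernel C i p"
  using is_kernel_opp[of "opp C" i p] by simp

lemma is_pushout_opp [simp]: "is_pushout (opp C) p f p' f' \<longleftrightarrow> is_pullback C p f p' f'"
  unfolding is_pushout_def is_pullback_def opp_simps Hom_opp
  by (rule iffI; elim conjE; intro conjI; (assumption | erule sym))

lemma is_pullback_opp [simp]: "is_pullback (opp C) p f p' f' \<longleftrightarrow> is_pushout C p f p' f'"
  using is_pushout_opp[of "opp C" p f p' f'] by simp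

text \<open>Passing to the opposite category reverses the vertical isomorphisms in the closure axiom
  for conflations, so they have to be inverted.\<close>

lemma (in category) square_inverse:
  assumes "i \<in> Hom C A B" "i' \<in> Hom C A' B'" "a \<in> Hom C A A'" "a' \<in> Hom C A' A"
    "b \<in> Hom C B B'" "b' \<in> Hom C B' B" "a \<cdot>\<^bsub>C\<^esub> a' = Idm C A'" "b' \<cdot>\<^bsub>C\<^esub> b = Idm C B"
    "b \<cdot>\<^bsub>C\<^esub> i = i' \<cdot>\<^bsub>C\<^esub> a"
  shows "i \<cdot>\<^bsub>C\<^esub> a' = b' \<cdot>\<^bsub>C\<^esub> i'"
proof -
  have "i \<cdot>\<^bsub>C\<^esub> a' = (b' \<cdot>\<^bsub>C\<^esub> b) \<cdot>\<^bsub>C\<^esub> (i \<cdot>\<^bsub>C\<^esub> a')"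
    using Idm_Cmp[OF Cmp_in_Hom[OF assms(4,1)]] assms(8) by simp
  also have "\<dots> = b' \<cdot>\<^bsub>C\<^esub> ((i' \<cdot>\<^bsub>C\<^esub> a) \<cdot>\<^bsub>C\<^esub> a')"
    using Cmp_assoc[OF Cmp_in_Hom[OF assms(4,1)] assms(5,6)] Cmp_assoc[OF assms(4,1,5)] assms(9) by simp
  also have "\<dots> = b' \<cdot>\<^bsub>C\<^esub> i'"
    using Cmp_assoc[OF assms(4,3,2)] assms(7) Cmp_Idm[OF assms(2)] by simp
  finally show ?thesis .
qed

lemma exact_category_opp:
  assumes "exact_category C"
  shows "exact_category (opp C)"
proof -
  interpret exact_category C by fact
  show ?thesis
  proof (intro exact_category.intro additive_category.intro category.intro
      additive_category_axioms.intro exact_category_axioms.intro, goal_cases)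
    case 1 then show ?case by (simp add: Cod_in_Ob)
  next
    case 2 then show ?case by (simp add: Dom_in_Ob)
  next
    case 3 then show ?case by (simp add: Idm_in_Hom)
  next
    case 4 then show ?case by (auto intro: Cmp_in_Hom)
  next
    case 5 then show ?case by (simp add: Idm_Cmp)
  next
    case 6 then show ?case by (simp add: Cmp_Idm)
  next
    case 7 then show ?case by (simp add: Cmp_assoc)
  next
    case (8 A B)
    have "Hom_group (opp C) A B = Hom_group C B A" by (simp add: Hom_group_def)
    then show ?case using Hom_comm_group[of B A] 8 by simp
  next
    case 9 then show ?case by (simp add: Cmp_Add_right)
  next
    case 10 then show ?case by (simp add: Cmp_Add_left)
  next
    case 11 show ?case using zero_object_exists by simp
  next
    case 12 then show ?case using direct_sum_exists by simp
  next
    case 13 then show ?case using Conf_kernel_cokernel by simp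
  next
    case (14 i p i' p' a b c)
    have iso: "a \<in> Hom C (Cod C i') (Cod C i)" "b \<in> Hom C (Dom C i') (Dom C i)"
      "c \<in> Hom C (Dom C p') (Dom C p)"
      using 14(5-7) by (auto simp: iso_mor_def)
    obtain a' where a': "iso_mor C (Cod C i) (Cod C i') a'"
      "a' \<cdot>\<^bsub>C\<^esub> a = Idm C (Cod C i')" "a \<cdot>\<^bsub>C\<^esub> a' = Idm C (Cod C i)"
      using 14(5) by (auto simp: iso_mor_def)
    obtain b' where b': "iso_mor C (Dom C i) (Dom C i') b'"
      "b' \<cdot>\<^bsub>C\<^esub> b = Idm C (Dom C i')" "b \<cdot>\<^bsub>C\<^esub> b' = Idm C (Dom C i)"
      using 14(6) by (auto simp: iso_mor_def)
    obtain c' where c': "iso_mor C (Dom C p) (Dom C p') c'"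
      "c' \<cdot>\<^bsub>C\<^esub> c = Idm C (Dom C p')" "c \<cdot>\<^bsub>C\<^esub> c' = Idm C (Dom C p)"
      using 14(7) by (auto simp: iso_mor_def)
    have iso': "a' \<in> Hom C (Cod C i) (Cod C i')" "b' \<in> Hom C (Dom C i) (Dom C i')"
      "c' \<in> Hom C (Dom C p) (Dom C p')"
      using a' b' c' by (auto simp: iso_mor_def)
    have conf: "(p, i) \<in> Conf C" using 14(1) by simp
    have m: "p \<in> Mor C" "i \<in> Mor C" "Cod C p = Dom C i"
      using Conf_kernel_cokernel[OF conf] by (auto simp: is_kernel_def)
    have m': "i' \<in> Mor C" "p' \<in> Mor C" "Dom C i' = Cod C p'" using 14 by auto
    have hi: "i \<in> Hom C (Dom C i) (Cod C i)" "i' \<in> Hom C (Dom C i') (Cod C i')"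
      "p \<in> Hom C (Dom C p) (Dom C i)" "p' \<in> Hom C (Dom C p') (Dom C i')"
      using m m' by (auto simp: Hom_def)
    have f1: "i' \<cdot>\<^bsub>C\<^esub> b' = a' \<cdot>\<^bsub>C\<^esub> i"
      by (rule square_inverse[OF hi(2,1) iso(2) iso'(2) iso(1) iso'(1) b'(3) a'(2)]) (use 14 in simp)
    have f2: "p' \<cdot>\<^bsub>C\<^esub> c' = b' \<cdot>\<^bsub>C\<^esub> p"
      by (rule square_inverse[OF hi(4,3) iso(3) iso'(3) iso(2) iso'(2) c'(3) b'(2)]) (use 14 in simp)
    have "(p', i') \<in> Conf C"
      by (rule Conf_iso_closed[OF conf, where a = c' and b = b' and c = a'])
        (use m m' a' b' c' f1 f2 in auto)
    then show ?case by simp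
  next
    case 15 then show ?case by (simp add: deflation_Idm)
  next
    case 16 then show ?case by (simp add: inflation_Idm)
  next
    case 17 then show ?case by (simp add: deflation_Cmp)
  next
    case 18 then show ?case by (simp add: inflation_Cmp)
  next
    case (19 i f) then show ?case using deflation_pullback[of i f] by simp
  next
    case (20 i f) then show ?case using inflation_pushout[of i f] by simp
  qed
qed

section \<open>Additive categories\<close>

lemma HomD:
  assumes "f \<in> Hom C A B"
  shows "f \<in> Mor C" "Dom C f = A" "Cod C f = B"
  using assms by (auto simp: Hom_def)

text \<open>Fixes the record type to \<open>excat\<close>, on which \<open>opp\<close> and
  \<open>full_sub\<close> act, and makes \<open>C\<close> an implicit structure.\<close>

locale exc = exact_category C for C :: "('o, 'm) excat" (structure)
begin

lemma opp: "exc (opp C)"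
  by (simp add: exc.intro exact_category_opp exact_category_axioms)

abbreviation add (infixl \<open>\<oplus>\<close> 65) where "f \<oplus> g \<equiv> Add C f g"
abbreviation hom where "hom A B \<equiv> Hom C A B"
abbreviation idm where "idm A \<equiv> Idm C A"
abbreviation zer where "zer A B \<equiv> Zer C A B"

lemma Hom_Ob: assumes "f \<in> hom A B" shows "A \<in> Ob C" "B \<in> Ob C"
  using assms Dom_in_Ob Cod_in_Ob by (auto simp: Hom_def)

text \<open>Typing is kept as facts about \<open>Mor\<close>, \<open>Dom\<close> and
  \<open>Cod\<close>, which the simplifier can chain through composites. This is why proofs declare
  the output of \<open>HomD\<close>, \<open>homD\<close> and \<open>cfD\<close> as simplification
  rules.\<close>

lemma arr [simp]:
  "f \<in> Mor C \<Longrightarrow> Dom C f \<in> Ob C" "f \<in> Mor C \<Longrightarrow> Cod C f \<in> Ob C"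
  "A \<in> Ob C \<Longrightarrow> idm A \<in> Mor C" "A \<in> Ob C \<Longrightarrow> Dom C (idm A) = A" "A \<in> Ob C \<Longrightarrow> Cod C (idm A) = A"
  using Dom_in_Ob Cod_in_Ob Idm_in_Hom by (auto simp: Hom_def)

lemma cmp_arr [simp]:
  assumes "f \<in> Mor C" "g \<in> Mor C" "Cod C f = Dom C g"
  shows "g \<cdot> f \<in> Mor C" "Dom C (g \<cdot> f) = Dom C f" "Cod C (g \<cdot> f) = Cod C g"
  using Cmp_in_Hom[of f "Dom C f" "Dom C g" g "Cod C g"] assms by (auto simp: Hom_def)

lemma cmp_id [simp]:
  "f \<in> Mor C \<Longrightarrow> Dom C f = A \<Longrightarrow> f \<cdot> idm A = f"
  "f \<in> Mor C \<Longrightarrow> Cod C f = B \<Longrightarrow> idm B \<cdot> f = f"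
  using Cmp_Idm[of f A "Cod C f"] Idm_Cmp[of f "Dom C f" B] by (auto simp: Hom_def)

lemma cmp_assoc [simp]:
  "f \<in> Mor C \<Longrightarrow> g \<in> Mor C \<Longrightarrow> h \<in> Mor C \<Longrightarrow> Cod C f = Dom C g \<Longrightarrow> Cod C g = Dom C h \<Longrightarrow>
   (h \<cdot> g) \<cdot> f = h \<cdot> (g \<cdot> f)"
  using Cmp_assoc[of f "Dom C f" "Dom C g" g "Dom C h" h "Cod C h"] by (simp add: Hom_def)

text \<open>As \<open>cmp_assoc\<close> brackets to the right, an equation for
  \<open>g \<cdot> f\<close> no longer matches inside a longer composite; this is its form for such
  places.\<close>

lemma cmp_reduce:
  "g \<cdot> f = h \<Longrightarrow> f \<in> Mor C \<Longrightarrow> g \<in> Mor C \<Longrightarrow> x \<in> Mor C \<Longrightarrow> Cod C x = Dom C f \<Longrightarrow>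
   Cod C f = Dom C g \<Longrightarrow> g \<cdot> (f \<cdot> x) = h \<cdot> x"
  using cmp_assoc[of x f g] by simp

context
  fixes A B assumes ob: "A \<in> Ob C" "B \<in> Ob C"
begin

interpretation G: comm_group "Hom_group C A B" by (rule Hom_comm_group[OF ob])

lemma zer_in_hom: "zer A B \<in> hom A B"
  using G.one_closed by (simp add: Hom_group_def)

lemma add_in_hom: "f \<in> hom A B \<Longrightarrow> g \<in> hom A B \<Longrightarrow> f \<oplus> g \<in> hom A B"
  using G.m_closed[of f g] by (simp add: Hom_group_def)

lemma hom_add_assoc:
  "f \<in> hom A B \<Longrightarrow> g \<in> hom A B \<Longrightarrow> h \<in> hom A B \<Longrightarrow> (f \<oplus> g) \<oplus> h = f \<oplus> (g \<oplus> h)"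
  using G.m_assoc[of f g h] by (simp add: Hom_group_def)

lemma hom_add_comm: "f \<in> hom A B \<Longrightarrow> g \<in> hom A B \<Longrightarrow> f \<oplus> g = g \<oplus> f"
  using G.m_comm[of f g] by (simp add: Hom_group_def)

lemma hom_add_zer: "f \<in> hom A B \<Longrightarrow> zer A B \<oplus> f = f"
  using G.l_one[of f] by (simp add: Hom_group_def)

lemma hom_neg_ex: "f \<in> hom A B \<Longrightarrow> \<exists>g \<in> hom A B. f \<oplus> g = zer A B"
  using G.r_inv[of f] G.inv_closed[of f] by (auto simp: Hom_group_def)

lemma hom_add_cancel:
  "f \<in> hom A B \<Longrightarrow> g \<in> hom A B \<Longrightarrow> h \<in> hom A B \<Longrightarrow> f \<oplus> g = f \<oplus> h \<Longrightarrow> g = h"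
  using G.Units_l_cancel[of f g h] by (simp add: Hom_group_def G.Units_eq[unfolded Hom_group_def])

end

text \<open>Built from \<open>Hom\<close>, \<open>Add\<close> and \<open>Zer\<close> alone, which
  the opposite category shares up to the order of the objects; so both categories have literally the
  same \<open>neg\<close>, as \<open>neg_opp\<close> states.\<close>

definition neg where "neg f = (SOME g. g \<in> hom (Dom C f) (Cod C f) \<and> f \<oplus> g = zer (Dom C f) (Cod C f))"

lemma neg_arr [simp]:
  assumes "f \<in> Mor C"
  shows "neg f \<in> Mor C" "Dom C (neg f) = Dom C f" "Cod C (neg f) = Cod C f"
    "f \<oplus> neg f = zer (Dom C f) (Cod C f)"
proof -
  have "\<exists>g. g \<in> hom (Dom C f) (Cod C f) \<and> f \<oplus> g = zer (Dom C f) (Cod C f)"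
    using hom_neg_ex[of "Dom C f" "Cod C f" f] assms by (auto simp: Hom_def)
  from someI_ex[OF this] show "neg f \<in> Mor C" "Dom C (neg f) = Dom C f" "Cod C (neg f) = Cod C f"
    "f \<oplus> neg f = zer (Dom C f) (Cod C f)"
    unfolding neg_def by (auto simp: Hom_def)
qed

lemma zer_arr [simp]:
  assumes "A \<in> Ob C" "B \<in> Ob C"
  shows "zer A B \<in> Mor C" "Dom C (zer A B) = A" "Cod C (zer A B) = B"
  using zer_in_hom[OF assms] by (auto simp: Hom_def)

lemma add_arr [simp]:
  assumes "f \<in> Mor C" "g \<in> Mor C" "Dom C f = Dom C g" "Cod C f = Cod C g"
  shows "f \<oplus> g \<in> Mor C" "Dom C (f \<oplus> g) = Dom C g" "Cod C (f \<oplus> g) = Cod C g"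
  using add_in_hom[of "Dom C g" "Cod C g" f g] assms by (auto simp: Hom_def)

lemma add_assoc [simp]:
  assumes "f \<in> Mor C" "g \<in> Mor C" "h \<in> Mor C"
    "Dom C f = Dom C g" "Cod C f = Cod C g" "Dom C g = Dom C h" "Cod C g = Cod C h"
  shows "(f \<oplus> g) \<oplus> h = f \<oplus> (g \<oplus> h)"
  using hom_add_assoc[of "Dom C h" "Cod C h" f g h] assms by (auto simp: Hom_def)

lemma add_comm:
  assumes "f \<in> Mor C" "g \<in> Mor C" "Dom C f = Dom C g" "Cod C f = Cod C g"
  shows "f \<oplus> g = g \<oplus> f"
  using hom_add_comm[of "Dom C g" "Cod C g" f g] assms by (auto simp: Hom_def)

lemma add_zer [simp]:
  assumes "f \<in> Mor C" "Dom C f = A" "Cod C f = B"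
  shows "zer A B \<oplus> f = f" "f \<oplus> zer A B = f"
proof -
  show a: "zer A B \<oplus> f = f"
    using hom_add_zer[of A B f] assms by (auto simp: Hom_def)
  show "f \<oplus> zer A B = f" using a add_comm[of f "zer A B"] assms by auto
qed

lemma neg_add [simp]:
  assumes "f \<in> Mor C"
  shows "neg f \<oplus> f = zer (Dom C f) (Cod C f)"
  using assms add_comm[of f "neg f"] by simp

lemma add_cancel:
  assumes "f \<oplus> g = f \<oplus> h" "f \<in> Mor C" "g \<in> Mor C" "h \<in> Mor C"
    "Dom C f = Dom C g" "Cod C f = Cod C g" "Dom C g = Dom C h" "Cod C g = Cod C h"
  shows "g = h"
  using hom_add_cancel[of "Dom C h" "Cod C h" f g h] assms by (auto simp: Hom_def)

lemma add_neg_cancel [simp]: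
  assumes "f \<in> Mor C" "g \<in> Mor C" "Dom C f = Dom C g" "Cod C f = Cod C g"
  shows "f \<oplus> (neg f \<oplus> g) = g" "neg f \<oplus> (f \<oplus> g) = g"
  using assms add_assoc[of f "neg f" g] add_assoc[of "neg f" f g] by auto

lemma cmp_add [simp]:
  "f \<in> Mor C \<Longrightarrow> g \<in> Mor C \<Longrightarrow> g' \<in> Mor C \<Longrightarrow> Cod C f = Dom C g \<Longrightarrow> Dom C g = Dom C g' \<Longrightarrow>
   Cod C g = Cod C g' \<Longrightarrow> (g \<oplus> g') \<cdot> f = g \<cdot> f \<oplus> g' \<cdot> f"
  "f \<in> Mor C \<Longrightarrow> f' \<in> Mor C \<Longrightarrow> g \<in> Mor C \<Longrightarrow> Cod C f = Dom C g \<Longrightarrow> Dom C f = Dom C f' \<Longrightarrow>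
   Cod C f = Cod C f' \<Longrightarrow> g \<cdot> (f \<oplus> f') = g \<cdot> f \<oplus> g \<cdot> f'"
  using Cmp_Add_left[of f "Dom C f" "Dom C g" g "Cod C g" g']
    Cmp_Add_right[of f "Dom C f" "Dom C g" f' g "Cod C g"] by (auto simp: Hom_def)

text \<open>The source of the rules that composing with zero gives zero, which are not among the
  axioms.\<close>

lemma add_idem_zer:
  assumes "f \<oplus> f = f" "f \<in> Mor C"
  shows "f = zer (Dom C f) (Cod C f)"
  using add_cancel[of f f "zer (Dom C f) (Cod C f)"] assms by simp

lemma cmp_zer [simp]:
  assumes "f \<in> Mor C" "B \<in> Ob C" "A = Cod C f"
  shows "zer A B \<cdot> f = zer (Dom C f) B"
proof -
  have "zer A B \<oplus> zer A B = zer A B" using assms by simp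
  then have "zer A B \<cdot> f \<oplus> zer A B \<cdot> f = zer A B \<cdot> f"
    using assms by (subst cmp_add(1)[symmetric]) auto
  then show ?thesis using add_idem_zer[of "zer A B \<cdot> f"] assms by simp
qed

lemma zer_cmp [simp]:
  assumes "f \<in> Mor C" "A \<in> Ob C" "B = Dom C f"
  shows "f \<cdot> zer A B = zer A (Cod C f)"
proof -
  have "zer A B \<oplus> zer A B = zer A B" using assms by simp
  then have "f \<cdot> zer A B \<oplus> f \<cdot> zer A B = f \<cdot> zer A B"
    using assms by (subst cmp_add(2)[symmetric]) auto
  then show ?thesis using add_idem_zer[of "f \<cdot> zer A B"] assms by simp
qed

lemma cmp_neg [simp]:
  assumes "f \<in> Mor C" "g \<in> Mor C" "Cod C f = Dom C g"
  shows "neg g \<cdot> f = neg (g \<cdot> f)" "g \<cdot> neg f = neg (g \<cdot> f)"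
proof -
  have "g \<cdot> f \<oplus> neg g \<cdot> f = g \<cdot> f \<oplus> neg (g \<cdot> f)"
    using assms by (subst cmp_add(1)[symmetric]) auto
  from add_cancel[OF this] show "neg g \<cdot> f = neg (g \<cdot> f)" using assms by simp
  have "g \<cdot> f \<oplus> g \<cdot> neg f = g \<cdot> f \<oplus> neg (g \<cdot> f)" using assms cmp_add(2)[of f "neg f" g] by simp
  from add_cancel[OF this] show "g \<cdot> neg f = neg (g \<cdot> f)" using assms by simp
qed

lemma neg_neg [simp]: assumes "f \<in> Mor C" shows "neg (neg f) = f"
  using add_cancel[of "neg f" "neg (neg f)" f] assms by simp

lemma neg_zer [simp]: assumes "A \<in> Ob C" "B \<in> Ob C" shows "neg (zer A B) = zer A B"
proof -
  have "zer A B \<oplus> neg (zer A B) = zer A B" using neg_arr(4)[of "zer A B"] assms by simp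
  moreover have "zer A B \<oplus> neg (zer A B) = neg (zer A B)" using assms by (intro add_zer) auto
  ultimately show ?thesis by simp
qed

lemma sub_zer_iff:
  assumes "f \<in> Mor C" "g \<in> Mor C" "Dom C f = Dom C g" "Cod C f = Cod C g"
  shows "f \<oplus> neg g = zer (Dom C g) (Cod C g) \<longleftrightarrow> f = g"
proof
  assume "f \<oplus> neg g = zer (Dom C g) (Cod C g)"
  then have "neg g \<oplus> f = neg g \<oplus> g" using assms add_comm[of f "neg g"] by simp
  from add_cancel[OF this] show "f = g" using assms by simp
qed (use assms in simp)

lemma add_left_comm:
  assumes "f \<in> Mor C" "g \<in> Mor C" "h \<in> Mor C"
    "Dom C f = Dom C g" "Cod C f = Cod C g" "Dom C g = Dom C h" "Cod C g = Cod C h"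
  shows "f \<oplus> (g \<oplus> h) = g \<oplus> (f \<oplus> h)"
  using assms add_assoc[of f g h] add_assoc[of g f h] add_comm[of f g] by simp

lemma biprodE:
  assumes "A \<in> Ob C" "B \<in> Ob C"
  obtains S iA iB pA pB where "biproduct C A B S iA iB pA pB"
  using direct_sum_exists[OF assms] by (auto simp: direct_sum_def)

lemma biproductD:
  assumes "biproduct C A B S iA iB pA pB"
  shows "iA \<in> Mor C" "iB \<in> Mor C" "pA \<in> Mor C" "pB \<in> Mor C"
    "Dom C iA = A" "Cod C iA = S" "Dom C iB = B" "Cod C iB = S"
    "Dom C pA = S" "Cod C pA = A" "Dom C pB = S" "Cod C pB = B"
    "pA \<cdot> iA = idm A" "pB \<cdot> iB = idm B" "pB \<cdot> iA = zer A B" "pA \<cdot> iB = zer B A"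
    "iA \<cdot> pA \<oplus> iB \<cdot> pB = idm S" "A \<in> Ob C" "B \<in> Ob C" "S \<in> Ob C"
  using assms Dom_in_Ob Cod_in_Ob unfolding biproduct_def Hom_def by auto

lemma biproduct_reduce:
  assumes "biproduct C A B S iA iB pA pB" "x \<in> Mor C"
  shows "Cod C x = A \<Longrightarrow> pA \<cdot> (iA \<cdot> x) = x" "Cod C x = B \<Longrightarrow> pB \<cdot> (iB \<cdot> x) = x"
    "Cod C x = A \<Longrightarrow> pB \<cdot> (iA \<cdot> x) = zer (Dom C x) B"
    "Cod C x = B \<Longrightarrow> pA \<cdot> (iB \<cdot> x) = zer (Dom C x) A"
proof -
  note B = biproductD[OF assms(1)]
  note [simp] = B assms(2)
  show "Cod C x = A \<Longrightarrow> pA \<cdot> (iA \<cdot> x) = x" "Cod C x = B \<Longrightarrow> pB \<cdot> (iB \<cdot> x) = x"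
    "Cod C x = A \<Longrightarrow> pB \<cdot> (iA \<cdot> x) = zer (Dom C x) B"
    "Cod C x = B \<Longrightarrow> pA \<cdot> (iB \<cdot> x) = zer (Dom C x) A"
    using cmp_reduce[OF B(13), of x] cmp_reduce[OF B(14), of x] cmp_reduce[OF B(15), of x]
      cmp_reduce[OF B(16), of x] by auto
qed

lemma biproduct_decompose:
  assumes "biproduct C A B S iA iB pA pB" "x \<in> hom T S"
  shows "x = iA \<cdot> (pA \<cdot> x) \<oplus> iB \<cdot> (pB \<cdot> x)"
proof -
  note [simp] = biproductD[OF assms(1)] HomD[OF assms(2)]
  have "x = (iA \<cdot> pA \<oplus> iB \<cdot> pB) \<cdot> x" by simp
  also have "\<dots> = iA \<cdot> (pA \<cdot> x) \<oplus> iB \<cdot> (pB \<cdot> x)" by (simp del: biproductD(17)[OF assms(1)])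
  finally show ?thesis .
qed

lemma biproduct_swap:
  assumes "biproduct C A B S iA iB pA pB"
  shows "biproduct C B A S iB iA pB pA"
  using assms biproductD[OF assms] add_comm[of "iA \<cdot> pA" "iB \<cdot> pB"] by (auto simp: biproduct_def)

lemma zero_objectE: obtains Z where "zero_object C Z" "Z \<in> Ob C"
  using zero_object_exists by (auto simp: zero_object_def)

lemma zero_object_hom:
  assumes "zero_object C Z"
  shows "f \<in> hom A Z \<Longrightarrow> f = zer A Z" "g \<in> hom Z A \<Longrightarrow> g = zer Z A"
proof -
  have *: "\<And>A. A \<in> Ob C \<Longrightarrow> (\<exists>!f. f \<in> hom A Z) \<and> (\<exists>!f. f \<in> hom Z A)" "Z \<in> Ob C"
    using assms by (auto simp: zero_object_def)
  show "f \<in> hom A Z \<Longrightarrow> f = zer A Z" using *(1)[of A] *(2) Hom_Ob[of f A Z] zer_in_hom[of A Z] by blast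
  show "g \<in> hom Z A \<Longrightarrow> g = zer Z A" using *(1)[of A] *(2) Hom_Ob[of g Z A] zer_in_hom[of Z A] by blast
qed

lemma iso_morE:
  assumes "iso_mor C A B f"
  obtains g where "f \<in> hom A B" "g \<in> hom B A" "g \<cdot> f = idm A" "f \<cdot> g = idm B" "iso_mor C B A g"
  using assms by (auto simp: iso_mor_def)

lemma iso_morI:
  assumes "f \<in> hom A B" "g \<in> hom B A" "g \<cdot> f = idm A" "f \<cdot> g = idm B"
  shows "iso_mor C A B f"
  using assms by (auto simp: iso_mor_def)

lemma iso_idm: "A \<in> Ob C \<Longrightarrow> iso_mor C A A (idm A)"
  by (rule iso_morI[of _ _ _ "idm A"]) (auto simp: Hom_def)

end

section \<open>Conflations\<close>

definition cf :: "('o, 'm) excat \<Rightarrow> 'o \<Rightarrow> 'o \<Rightarrow> 'o \<Rightarrow> 'm \<Rightarrow> 'm \<Rightarrow> bool" where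
  "cf C A B D i p \<longleftrightarrow> (i, p) \<in> Conf C \<and> i \<in> Hom C A B \<and> p \<in> Hom C B D"

lemma cf_opp [simp]: "cf (opp C) D B A p i \<longleftrightarrow> cf C A B D i p"
  by (auto simp: cf_def)

text \<open>Unique existence is split into existence and joint cancellation, since proofs supply and
  use the two halves separately.\<close>

definition pb :: "('o, 'm) excat \<Rightarrow> 'o \<Rightarrow> 'o \<Rightarrow> 'o \<Rightarrow> 'o \<Rightarrow> 'm \<Rightarrow> 'm \<Rightarrow> 'm \<Rightarrow> 'm \<Rightarrow> bool" where
  "pb C B' B D' D f' p' p f \<longleftrightarrow>
     f' \<in> Hom C B' B \<and> p' \<in> Hom C B' D' \<and> p \<in> Hom C B D \<and> f \<in> Hom C D' D \<and>
     p \<cdot>\<^bsub>C\<^esub> f' = f \<cdot>\<^bsub>C\<^esub> p' \<and>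
     (\<forall>T. \<forall>u \<in> Hom C T D'. \<forall>v \<in> Hom C T B. f \<cdot>\<^bsub>C\<^esub> u = p \<cdot>\<^bsub>C\<^esub> v \<longrightarrow>
        (\<exists>w \<in> Hom C T B'. p' \<cdot>\<^bsub>C\<^esub> w = u \<and> f' \<cdot>\<^bsub>C\<^esub> w = v)) \<and>
     (\<forall>T. \<forall>w \<in> Hom C T B'. \<forall>w' \<in> Hom C T B'. p' \<cdot>\<^bsub>C\<^esub> w = p' \<cdot>\<^bsub>C\<^esub> w' \<longrightarrow> f' \<cdot>\<^bsub>C\<^esub> w = f' \<cdot>\<^bsub>C\<^esub> w' \<longrightarrow> w = w')"

text \<open>Defined through \<open>opp\<close>, so that facts about \<open>pb\<close> dualize by
  mere instantiation.\<close>

definition po :: "('o, 'm) excat \<Rightarrow> 'o \<Rightarrow> 'o \<Rightarrow> 'o \<Rightarrow> 'o \<Rightarrow> 'm \<Rightarrow> 'm \<Rightarrow> 'm \<Rightarrow> 'm \<Rightarrow> bool" where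
  "po C A B A' B' i f i' f' \<longleftrightarrow> pb (opp C) B' B A' A f' i' i f"

lemma poD:
  assumes "po C A B A' B' i f i' f'"
  shows "i \<in> Hom C A B" "f \<in> Hom C A A'" "i' \<in> Hom C A' B'" "f' \<in> Hom C B B'"
    "i' \<cdot>\<^bsub>C\<^esub> f = f' \<cdot>\<^bsub>C\<^esub> i"
    "u \<in> Hom C A' T \<Longrightarrow> v \<in> Hom C B T \<Longrightarrow> u \<cdot>\<^bsub>C\<^esub> f = v \<cdot>\<^bsub>C\<^esub> i \<Longrightarrow>
      \<exists>w \<in> Hom C B' T. w \<cdot>\<^bsub>C\<^esub> i' = u \<and> w \<cdot>\<^bsub>C\<^esub> f' = v"
    "w \<in> Hom C B' T \<Longrightarrow> w' \<in> Hom C B' T \<Longrightarrow> w \<cdot>\<^bsub>C\<^esub> i' = w' \<cdot>\<^bsub>C\<^esub> i' \<Longrightarrow>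
      w \<cdot>\<^bsub>C\<^esub> f' = w' \<cdot>\<^bsub>C\<^esub> f' \<Longrightarrow> w = w'"
  using assms unfolding po_def pb_def opp_simps Hom_opp by (blast | metis)+

lemma pbD:
  assumes "pb C B' B D' D f' p' p f"
  shows "f' \<in> Hom C B' B" "p' \<in> Hom C B' D'" "p \<in> Hom C B D" "f \<in> Hom C D' D"
    "p \<cdot>\<^bsub>C\<^esub> f' = f \<cdot>\<^bsub>C\<^esub> p'"
    "u \<in> Hom C T D' \<Longrightarrow> v \<in> Hom C T B \<Longrightarrow> f \<cdot>\<^bsub>C\<^esub> u = p \<cdot>\<^bsub>C\<^esub> v \<Longrightarrow>
      \<exists>w \<in> Hom C T B'. p' \<cdot>\<^bsub>C\<^esub> w = u \<and> f' \<cdot>\<^bsub>C\<^esub> w = v"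
    "w \<in> Hom C T B' \<Longrightarrow> w' \<in> Hom C T B' \<Longrightarrow> p' \<cdot>\<^bsub>C\<^esub> w = p' \<cdot>\<^bsub>C\<^esub> w' \<Longrightarrow>
      f' \<cdot>\<^bsub>C\<^esub> w = f' \<cdot>\<^bsub>C\<^esub> w' \<Longrightarrow> w = w'"
  using assms unfolding pb_def by blast+

lemma pb_opp: "pb (opp C) B' B A' A f' i' i f \<longleftrightarrow> po C A B A' B' i f i' f'"
  by (simp add: po_def)

lemma po_transpose: "po C A B A' B' i f i' f' \<longleftrightarrow> po C A A' B B' f i f' i'"
  unfolding po_def pb_def opp_simps Hom_opp
  by (rule iffI; elim conjE; intro conjI; (assumption | erule sym | metis))

context exc
begin

lemma homI [simp]: "f \<in> Mor C \<Longrightarrow> Dom C f = A \<Longrightarrow> Cod C f = B \<Longrightarrow> f \<in> hom A B"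
  by (simp add: Hom_def)

lemma homD:
  assumes "f \<in> hom A B"
  shows "f \<in> Mor C" "Dom C f = A" "Cod C f = B" "A \<in> Ob C" "B \<in> Ob C"
  using assms Hom_Ob[OF assms] by (auto simp: Hom_def)

lemma cfD:
  assumes "cf C A B D i p"
  shows "i \<in> Mor C" "p \<in> Mor C" "Dom C i = A" "Cod C i = B" "Dom C p = B" "Cod C p = D"
    "p \<cdot> i = zer A D" "A \<in> Ob C" "B \<in> Ob C" "D \<in> Ob C"
  using assms Conf_kernel_cokernel[of i p] Hom_Ob[of i] Hom_Ob[of p] unfolding cf_def
  by (auto simp: Hom_def is_kernel_def)

lemma cf_hom: assumes "cf C A B D i p" shows "i \<in> hom A B" "p \<in> hom B D"
  using assms by (auto simp: cf_def)

lemma cfI: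
  assumes "(i, p) \<in> Conf C"
  shows "cf C (Dom C i) (Cod C i) (Cod C p) i p"
  using assms Conf_kernel_cokernel[of i p] by (auto simp: cf_def is_kernel_def Hom_def)

lemma cf_kernel:
  assumes "cf C A B D i p" "f \<in> hom T B" "p \<cdot> f = zer T D"
  shows "\<exists>g \<in> hom T A. i \<cdot> g = f"
proof -
  note [simp] = cfD[OF assms(1)] homD[OF assms(2)]
  have "is_kernel C i p" using assms(1) Conf_kernel_cokernel by (auto simp: cf_def)
  then have "f \<in> Mor C \<longrightarrow> Cod C f = Dom C p \<longrightarrow> p \<cdot> f = zer (Dom C f) (Cod C p) \<longrightarrow>
      (\<exists>!g. g \<in> hom (Dom C f) (Dom C i) \<and> i \<cdot> g = f)"
    unfolding is_kernel_def by blast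
  then have "\<exists>!g. g \<in> hom T A \<and> i \<cdot> g = f" using assms(3) by simp
  then show ?thesis by blast
qed

lemma cf_mono:
  assumes "cf C A B D i p" "g \<in> hom T A" "g' \<in> hom T A" "i \<cdot> g = i \<cdot> g'"
  shows "g = g'"
proof -
  note [simp] = cfD[OF assms(1)] homD[OF assms(2)]
  have T: "T \<in> Ob C" using Hom_Ob assms(2) by blast
  have "is_kernel C i p" using assms(1) Conf_kernel_cokernel by (auto simp: cf_def)
  moreover have "p \<cdot> (i \<cdot> g) = zer T D" using cmp_reduce[OF cfD(7)[OF assms(1)], of g] T by simp
  moreover have "i \<cdot> g \<in> Mor C \<longrightarrow> Cod C (i \<cdot> g) = Dom C p \<longrightarrow>
      p \<cdot> (i \<cdot> g) = zer (Dom C (i \<cdot> g)) (Cod C p) \<longrightarrow>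
      (\<exists>!h. h \<in> hom (Dom C (i \<cdot> g)) (Dom C i) \<and> i \<cdot> h = i \<cdot> g)"
    using calculation unfolding is_kernel_def by blast
  ultimately have "\<exists>!h. h \<in> hom T A \<and> i \<cdot> h = i \<cdot> g" by simp
  then show ?thesis using assms by metis
qed

lemma cf_cokernel:
  assumes "cf C A B D i p" "f \<in> hom B T" "f \<cdot> i = zer A T"
  shows "\<exists>g \<in> hom D T. g \<cdot> p = f"
  using exc.cf_kernel[OF opp, of D B A p i f T] assms by simp

lemma cf_epi:
  assumes "cf C A B D i p" "g \<in> hom D T" "g' \<in> hom D T" "g \<cdot> p = g' \<cdot> p"
  shows "g = g'"
  using exc.cf_mono[OF opp, of D B A p i g T g'] assms by simp

lemma cf_transfer:
  assumes "cf C A B D i p" "iso_mor C A A' a" "iso_mor C B B' b" "iso_mor C D D' c"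
    "i' \<in> hom A' B'" "p' \<in> hom B' D'" "i' \<cdot> a = b \<cdot> i" "p' \<cdot> b = c \<cdot> p"
  shows "cf C A' B' D' i' p'"
proof -
  note [simp] = cfD[OF assms(1)] homD[OF assms(5)] homD[OF assms(6)]
  show ?thesis
    using Conf_iso_closed[of i p i' p' a b c] assms by (simp add: cf_def)
qed

text \<open>Two kernels of \<open>p\<close> differ by a unique isomorphism, and conflations are
  closed under isomorphism.\<close>

lemma deflation_kernel:
  assumes "cf C A0 B D i0 p" "i \<in> hom A B" "p \<cdot> i = zer A D"
    and ex: "\<And>T f. f \<in> hom T B \<Longrightarrow> p \<cdot> f = zer T D \<Longrightarrow> \<exists>g \<in> hom T A. i \<cdot> g = f"
    and mono: "\<And>T g g'. g \<in> hom T A \<Longrightarrow> g' \<in> hom T A \<Longrightarrow> i \<cdot> g = i \<cdot> g' \<Longrightarrow> g = g'"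
  shows "cf C A B D i p"
proof -
  note [simp] = cfD[OF assms(1)] homD[OF assms(2)]
  have A: "A \<in> Ob C" using Hom_Ob assms(2) by blast
  obtain a where a: "a \<in> hom A0 A" "i \<cdot> a = i0"
    using ex[of i0 A0] cf_hom[OF assms(1)] by auto
  obtain b where b: "b \<in> hom A A0" "i0 \<cdot> b = i"
    using cf_kernel[OF assms(1,2,3)] by blast
  note [simp] = homD[OF a(1)] homD[OF b(1)]
  have "a \<cdot> b = idm A"
    by (rule mono[where T = A]) (use a b A cmp_reduce[OF a(2), of b] in auto)
  moreover have "b \<cdot> a = idm A0"
    by (rule cf_mono[OF assms(1), where T = A0]) (use a b A cmp_reduce[OF b(2), of a] in auto)
  ultimately have "iso_mor C A0 A a" using a b iso_morI by blast
  then show ?thesis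
    by (rule cf_transfer[OF assms(1) _ iso_idm iso_idm]) (use a assms in auto)
qed

lemma inflation_cokernel:
  assumes "cf C A B D0 i p0" "p \<in> hom B D" "p \<cdot> i = zer A D"
    and "\<And>T f. f \<in> hom B T \<Longrightarrow> f \<cdot> i = zer A T \<Longrightarrow> \<exists>g \<in> hom D T. g \<cdot> p = f"
    and "\<And>T g g'. g \<in> hom D T \<Longrightarrow> g' \<in> hom D T \<Longrightarrow> g \<cdot> p = g' \<cdot> p \<Longrightarrow> g = g'"
  shows "cf C A B D i p"
  using exc.deflation_kernel[OF opp, of D0 B A p0 i p D] assms by simp

text \<open>The axiom only says that \<open>p'\<close> is a deflation; its kernel is recognized as
  \<open>A\<close> with the inclusion induced by \<open>0\<close> and \<open>i\<close>.\<close>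

lemma pullback:
  assumes "cf C A B D i p" "f \<in> hom D' D"
  shows "\<exists>B' i' p' f'. cf C A B' D' i' p' \<and> f' \<cdot> i' = i \<and> pb C B' B D' D f' p' p f"
proof -
  note [simp] = cfD[OF assms(1)] homD[OF assms(2)]
  have D': "D' \<in> Ob C" using Hom_Ob assms(2) by blast
  obtain p' f' where pp: "is_pullback C p f p' f'" "deflation C p'"
    using deflation_pullback[of p f] assms(1) by (auto simp: cf_def deflation_def)
  define B' where "B' = Dom C p'"
  have [simp]: "p' \<in> Mor C" "f' \<in> Mor C" "Cod C p' = D'" "Cod C f' = B" "Dom C p' = B'" "Dom C f' = B'"
    using pp(1) by (auto simp: is_pullback_def B'_def)
  have ob: "B' \<in> Ob C" using arr(1)[of p'] by simp
  have pbp: "pb C B' B D' D f' p' p f"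
    unfolding pb_def
  proof (intro conjI allI ballI impI)
    show "p \<cdot> f' = f \<cdot> p'" using pp(1) by (simp add: is_pullback_def)
  next
    fix T u v assume "u \<in> hom T D'" "v \<in> hom T B" "f \<cdot> u = p \<cdot> v"
    then show "\<exists>w \<in> hom T B'. p' \<cdot> w = u \<and> f' \<cdot> w = v"
      using pp(1) unfolding is_pullback_def by simp blast
  next
    fix T w w' assume w: "w \<in> hom T B'" "w' \<in> hom T B'" "p' \<cdot> w = p' \<cdot> w'" "f' \<cdot> w = f' \<cdot> w'"
    note [simp] = homD[OF w(1)]
    have "p \<cdot> f' = f \<cdot> p'" using pp(1) by (simp add: is_pullback_def)
    then have "f \<cdot> (p' \<cdot> w) = p \<cdot> (f' \<cdot> w)" using cmp_assoc[of w f' p] cmp_assoc[of w p' f] by simp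
    moreover have "p' \<cdot> w \<in> hom T D'" "f' \<cdot> w \<in> hom T B" by auto
    ultimately have "\<exists>!x. x \<in> hom T B' \<and> p' \<cdot> x = p' \<cdot> w \<and> f' \<cdot> x = f' \<cdot> w"
      using pp(1) unfolding is_pullback_def by simp
    then show "w = w'" using w by metis
  qed auto
  note pbp' = pbD[OF pbp]
  obtain i0 where i0: "(i0, p') \<in> Conf C" using pp(2) by (auto simp: deflation_def)
  have cf0: "cf C (Dom C i0) B' D' i0 p'" using cfI[OF i0] cf_def[of C "Dom C i0" "Cod C i0"]
    by (simp add: Hom_def)
  obtain i' where i': "i' \<in> hom A B'" "p' \<cdot> i' = zer A D'" "f' \<cdot> i' = i"
    using pbp'(6)[OF zer_in_hom[OF cfD(8)[OF assms(1)] D'] cf_hom(1)[OF assms(1)]] D' by auto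
  note [simp] = homD[OF i'(1)]
  have "cf C A B' D' i' p'"
  proof (rule deflation_kernel[OF cf0 i'(1,2)])
    fix T x assume x: "x \<in> hom T B'" "p' \<cdot> x = zer T D'"
    note [simp] = homD[OF x(1)]
    have T: "T \<in> Ob C" using Hom_Ob x(1) by blast
    have "p \<cdot> (f' \<cdot> x) = zer T D" using cmp_reduce[OF pbp'(5), of x] x T D' by simp
    then obtain g where g: "g \<in> hom T A" "i \<cdot> g = f' \<cdot> x"
      using cf_kernel[OF assms(1), of "f' \<cdot> x" T] by auto
    note [simp] = homD[OF g(1)]
    have "i' \<cdot> g = x"
      by (rule pbp'(7)[where T = T]) (use g x i' T D' cmp_reduce[OF i'(3), of g] cmp_reduce[OF i'(2), of g] in auto)
    then show "\<exists>g \<in> hom T A. i' \<cdot> g = x" using g by blast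
  next
    fix T g g' assume g: "g \<in> hom T A" "g' \<in> hom T A" "i' \<cdot> g = i' \<cdot> g'"
    note [simp] = homD[OF g(1)] homD[OF g(2)]
    have "i \<cdot> g = i \<cdot> g'" using g(3) cmp_reduce[OF i'(3), of g] cmp_reduce[OF i'(3), of g'] by simp
    then show "g = g'" using cf_mono[OF assms(1)] g by blast
  qed
  then show ?thesis using pbp i' by blast
qed

lemma pb_iso:
  assumes "pb C B1 B D' D f1 p1 p f" "pb C B2 B D' D f2 p2 p f"
  shows "\<exists>w. iso_mor C B1 B2 w \<and> p2 \<cdot> w = p1 \<and> f2 \<cdot> w = f1"
proof -
  note P = pbD[OF assms(1)] and Q = pbD[OF assms(2)]
  note [simp] = homD[OF P(1)] homD[OF P(2)] homD[OF Q(1)] homD[OF Q(2)]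
  obtain w where w: "w \<in> hom B1 B2" "p2 \<cdot> w = p1" "f2 \<cdot> w = f1" using Q(6)[OF P(2,1)] P(5) by auto
  obtain x where x: "x \<in> hom B2 B1" "p1 \<cdot> x = p2" "f1 \<cdot> x = f2" using P(6)[OF Q(2,1)] Q(5) by auto
  note [simp] = homD[OF w(1)] homD[OF x(1)]
  have "x \<cdot> w = idm B1"
    by (rule P(7)[where T = B1]) (use w x cmp_reduce[OF x(2), of w] cmp_reduce[OF x(3), of w] in auto)
  moreover have "w \<cdot> x = idm B2"
    by (rule Q(7)[where T = B2]) (use w x cmp_reduce[OF w(2), of x] cmp_reduce[OF w(3), of x] in auto)
  ultimately show ?thesis using w x iso_morI by blast
qed

text \<open>Carries \<open>pullback\<close> over to a pullback square that was constructed by other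
  means.\<close>

lemma pb_deflation:
  assumes "cf C A B D i p" "pb C B' B D' D f' p' p f"
  shows "\<exists>i'. cf C A B' D' i' p' \<and> f' \<cdot> i' = i"
proof -
  note P = pbD[OF assms(2)]
  note [simp] = cfD[OF assms(1)] homD[OF P(1)] homD[OF P(2)]
  obtain B0 i0 p0 f0 where 0: "cf C A B0 D' i0 p0" "f0 \<cdot> i0 = i" "pb C B0 B D' D f0 p0 p f"
    using pullback[OF assms(1) P(4)] by blast
  note [simp] = cfD[OF 0(1)]
  obtain w where w: "iso_mor C B0 B' w" "p' \<cdot> w = p0" "f' \<cdot> w = f0"
    using pb_iso[OF 0(3) assms(2)] by blast
  have [simp]: "w \<in> Mor C" "Dom C w = B0" "Cod C w = B'" using w(1) by (auto simp: iso_mor_def Hom_def)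
  have "cf C A B' D' (w \<cdot> i0) p'"
    by (rule cf_transfer[OF 0(1) iso_idm w(1) iso_idm]) (use w in auto)
  moreover have "f' \<cdot> (w \<cdot> i0) = i" using 0 w(3) cmp_reduce[OF w(3), of i0] by simp
  ultimately show ?thesis by blast
qed

lemma pushout:
  assumes "cf C A B D i p" "f \<in> hom A A'"
  shows "\<exists>B' i' p' f'. cf C A' B' D i' p' \<and> p' \<cdot> f' = p \<and> po C A B A' B' i f i' f'"
  using exc.pullback[OF opp, of D B A p i f A'] assms by (simp add: pb_opp) blast

lemma po_inflation:
  assumes "cf C A B D i p" "po C A B A' B' i f i' f'"
  shows "\<exists>p'. cf C A' B' D i' p' \<and> p' \<cdot> f' = p"
  using exc.pb_deflation[OF opp, of D B A p i B' A' f' i' f] assms by (simp add: pb_opp)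

text \<open>On the pullback \<open>P\<close> of \<open>p\<close> and \<open>p'\<close> the
  difference of \<open>q'\<close> and \<open>b \<cdot> q\<close> factors through \<open>i'\<close>.
  Correcting \<open>q\<close> by it gives \<open>s\<close> with \<open>b \<cdot> s = q'\<close>, and
  \<open>s\<close> descends along \<open>q'\<close> to a right inverse of \<open>b\<close>. Since
  \<open>b\<close> has trivial kernel, this inverse is two-sided.\<close>

lemma short_five:
  assumes "cf C A B D i p" "cf C A B' D i' p'" "b \<in> hom B B'" "b \<cdot> i = i'" "p' \<cdot> b = p"
  shows "iso_mor C B B' b"
proof -
  note [simp] = cfD[OF assms(1)] cfD[OF assms(2)] homD[OF assms(3)]
  obtain P k q' q where 0: "cf C A P B' k q'" "q \<cdot> k = i" "pb C P B B' D q q' p p'"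
    using pullback[OF assms(1) cf_hom(2)[OF assms(2)]] by blast
  note P = pbD[OF 0(3)]
  note [simp] = cfD[OF 0(1)] homD[OF P(1)] homD[OF P(2)]
  have "p' \<cdot> (q' \<oplus> neg (b \<cdot> q)) = zer P D"
    using P(5) cmp_reduce[OF assms(5), of q] by simp
  then obtain t where t: "t \<in> hom P A" "i' \<cdot> t = q' \<oplus> neg (b \<cdot> q)"
    using cf_kernel[OF assms(2), of "q' \<oplus> neg (b \<cdot> q)" P] by auto
  note [simp] = homD[OF t(1)]
  define s where "s = q \<oplus> i \<cdot> t"
  have [simp]: "s \<in> Mor C" "Dom C s = P" "Cod C s = B" by (auto simp: s_def)
  have bs: "b \<cdot> s = q'"
    using t(2) cmp_reduce[OF assms(4), of t] add_left_comm[of "b \<cdot> q" q' "neg (b \<cdot> q)"]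
    by (simp add: s_def)
  have "i' \<cdot> (t \<cdot> k) = i' \<cdot> neg (idm A)"
    using cmp_reduce[OF t(2), of k] 0(2) assms(4) by simp
  then have tk: "t \<cdot> k = neg (idm A)"
    using cf_mono[OF assms(2), of "t \<cdot> k" A "neg (idm A)"] by auto
  have "s \<cdot> k = zer A B" using 0(2) tk by (simp add: s_def)
  then obtain \<sigma> where \<sigma>: "\<sigma> \<in> hom B' B" "\<sigma> \<cdot> q' = s"
    using cf_cokernel[OF 0(1), of s B] by auto
  note [simp] = homD[OF \<sigma>(1)]
  have b\<sigma>: "b \<cdot> \<sigma> = idm B'"
    by (rule cf_epi[OF 0(1), where T = B']) (use \<sigma>(2) bs in auto)
  have "\<sigma> \<cdot> b = idm B"
  proof -
    have mono: "x = zer B B" if x: "x \<in> hom B B" "b \<cdot> x = zer B B'" for x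
    proof -
      note [simp] = homD[OF x(1)]
      have "p \<cdot> x = zer B D" using cmp_reduce[OF assms(5), of x] x(2) by simp
      then obtain y where y: "y \<in> hom B A" "i \<cdot> y = x" using cf_kernel[OF assms(1) x(1)] by blast
      note [simp] = homD[OF y(1)]
      have "i' \<cdot> y = i' \<cdot> zer B A" using cmp_reduce[OF assms(4), of y] y(2) x(2) by simp
      then have "y = zer B A" using cf_mono[OF assms(2) y(1)] by auto
      then show ?thesis using y(2) by simp
    qed
    have "b \<cdot> (\<sigma> \<cdot> b \<oplus> neg (idm B)) = zer B B'" using cmp_reduce[OF b\<sigma>, of b] by simp
    then have "\<sigma> \<cdot> b \<oplus> neg (idm B) = zer B B" by (intro mono) auto
    then show ?thesis using sub_zer_iff[of "\<sigma> \<cdot> b" "idm B"] by simp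
  qed
  then show ?thesis using b\<sigma> assms(3) \<sigma>(1) iso_morI by blast
qed

text \<open>The comparison map from \<open>B\<close> to the actual pullback is an isomorphism by
  \<open>short_five\<close>.\<close>

lemma pb_of_mor:
  assumes "cf C A B D i p" "cf C A B' D' i' p'" "m \<in> hom B B'" "f \<in> hom D D'"
    "m \<cdot> i = i'" "p' \<cdot> m = f \<cdot> p"
  shows "pb C B B' D D' m p p' f"
proof -
  note [simp] = cfD[OF assms(1)] cfD[OF assms(2)] homD[OF assms(3)] homD[OF assms(4)]
  obtain B0 i0 p0 f0 where 0: "cf C A B0 D i0 p0" "f0 \<cdot> i0 = i'" "pb C B0 B' D D' f0 p0 p' f"
    using pullback[OF assms(2) assms(4)] by blast
  note P = pbD[OF 0(3)]
  note [simp] = cfD[OF 0(1)] homD[OF P(1)]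
  obtain w where w: "w \<in> hom B B0" "p0 \<cdot> w = p" "f0 \<cdot> w = m"
    using P(6)[of p B m] assms by auto
  note [simp] = homD[OF w(1)]
  have "w \<cdot> i = i0"
    by (rule P(7)[where T = A])
      (use w 0 assms cmp_reduce[OF w(2), of i] cmp_reduce[OF w(3), of i] in auto)
  then have "iso_mor C B B0 w" using short_five[OF assms(1) 0(1) w(1)] w by auto
  then obtain w' where w': "w' \<in> hom B0 B" "w' \<cdot> w = idm B" "w \<cdot> w' = idm B0" by (rule iso_morE)
  note [simp] = homD[OF w'(1)]
  have pw: "p \<cdot> w' = p0" "m \<cdot> w' = f0"
    using cmp_reduce[OF w(2), of w'] cmp_reduce[OF w(3), of w'] w'(3) by auto
  show ?thesis unfolding pb_def
  proof (intro conjI allI ballI impI)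
    fix T u v assume "u \<in> hom T D" "v \<in> hom T B'" "f \<cdot> u = p' \<cdot> v"
    then obtain x where x: "x \<in> hom T B0" "p0 \<cdot> x = u" "f0 \<cdot> x = v" using P(6) by blast
    note [simp] = homD[OF x(1)]
    have "w' \<cdot> x \<in> hom T B \<and> p \<cdot> (w' \<cdot> x) = u \<and> m \<cdot> (w' \<cdot> x) = v"
      using cmp_reduce[OF pw(1), of x] cmp_reduce[OF pw(2), of x] x by auto
    then show "\<exists>w \<in> hom T B. p \<cdot> w = u \<and> m \<cdot> w = v" by blast
  next
    fix T y y' assume y: "y \<in> hom T B" "y' \<in> hom T B" "p \<cdot> y = p \<cdot> y'" "m \<cdot> y = m \<cdot> y'"
    note [simp] = homD[OF y(1)] homD[OF y(2)]
    have "w \<cdot> y = w \<cdot> y'"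
      by (rule P(7)[where T = T]) (use y cmp_reduce[OF w(2), of y] cmp_reduce[OF w(3), of y]
          cmp_reduce[OF w(2), of y'] cmp_reduce[OF w(3), of y'] in auto)
    moreover have "w' \<cdot> (w \<cdot> y) = y" "w' \<cdot> (w \<cdot> y') = y'"
      using cmp_reduce[OF w'(2), of y] cmp_reduce[OF w'(2), of y'] by simp_all
    ultimately show "y = y'" by metis
  qed (use assms in auto)
qed

lemma po_of_mor:
  assumes "cf C A B D i p" "cf C A' B' D i' p'" "m \<in> hom B B'" "f \<in> hom A A'"
    "m \<cdot> i = i' \<cdot> f" "p' \<cdot> m = p"
  shows "po C A B A' B' i f i' m"
  using exc.pb_of_mor[OF opp, of D B' A' p' i' B A p i m f] assms by (simp add: pb_opp)

lemma cf_zero_idm: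
  assumes "zero_object C Z" "A \<in> Ob C"
  shows "cf C Z A A (zer Z A) (idm A)"
proof -
  have Z: "Z \<in> Ob C" using assms by (simp add: zero_object_def)
  note [simp] = assms(2) Z
  obtain i where i: "(i, idm A) \<in> Conf C"
    using deflation_Idm[OF assms(2)] by (auto simp: deflation_def)
  have c: "cf C (Dom C i) A A i (idm A)"
    using cfI[OF i] cfD(5)[OF cfI[OF i]] by simp
  show ?thesis
  proof (rule deflation_kernel[OF c])
    fix T f assume f: "f \<in> hom T A" "idm A \<cdot> f = zer T A"
    note [simp] = homD[OF f(1)]
    show "\<exists>g \<in> hom T Z. zer Z A \<cdot> g = f" using f by (intro bexI[of _ "zer T Z"]) auto
  next
    fix T g g' assume "g \<in> hom T Z" "g' \<in> hom T Z"
    then show "g = g'" using zero_object_hom(1)[OF assms(1)] by metis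
  qed auto
qed

lemma cf_idm_zero:
  assumes "zero_object C Z" "A \<in> Ob C"
  shows "cf C A A Z (idm A) (zer A Z)"
  using exc.cf_zero_idm[OF opp, of Z A] assms by simp

text \<open>The projection \<open>pB\<close> is the pullback of the deflation \<open>A -> 0\<close>
  along \<open>B -> 0\<close>.\<close>

lemma cf_biproduct:
  assumes "biproduct C A B S iA iB pA pB"
  shows "cf C A S B iA pB"
proof -
  note [simp] = biproductD[OF assms]
  obtain Z where Z: "zero_object C Z" "Z \<in> Ob C" by (rule zero_objectE)
  note [simp] = Z(2)
  have "pb C S A B Z pA pB (zer A Z) (zer B Z)"
    unfolding pb_def
  proof (intro conjI allI ballI impI)
    fix T u v assume uv: "u \<in> hom T B" "v \<in> hom T A"
    note [simp] = homD[OF uv(1)] homD[OF uv(2)]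
    show "\<exists>w \<in> hom T S. pB \<cdot> w = u \<and> pA \<cdot> w = v"
      by (intro bexI[of _ "iA \<cdot> v \<oplus> iB \<cdot> u"])
        (auto simp: biproduct_reduce[OF assms])
  next
    fix T w w' assume "w \<in> hom T S" "w' \<in> hom T S" "pB \<cdot> w = pB \<cdot> w'" "pA \<cdot> w = pA \<cdot> w'"
    then show "w = w'" using biproduct_decompose[OF assms] by metis
  qed auto
  from pb_deflation[OF cf_idm_zero[OF Z(1)] this] obtain i where
    i: "cf C A S B i pB" "pA \<cdot> i = idm A" by auto
  have "i = iA \<cdot> (pA \<cdot> i) \<oplus> iB \<cdot> (pB \<cdot> i)"
    using biproduct_decompose[OF assms cf_hom(1)[OF i(1)]] .
  then have "i = iA" using i(2) cfD[OF i(1)] by simp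
  then show ?thesis using i by simp
qed

text \<open>The map is a composite of two deflations: first the identity of \<open>B\<close> plus
  \<open>q\<close>, a pullback of \<open>q\<close>, then the map from \<open>B\<close> plus
  \<open>N\<close> to \<open>N\<close> with components \<open>u\<close> and the identity.\<close>

lemma copair_deflation:
  assumes "cf C A M N i q" "u \<in> hom B N" "biproduct C B M S iB iM pB pM"
  shows "\<exists>R r. cf C R S N r (u \<cdot> pB \<oplus> q \<cdot> pM)"
proof -
  note [simp] = cfD[OF assms(1)] homD[OF assms(2)] biproductD[OF assms(3)]
  obtain S' jB jN rB rN where S': "biproduct C B N S' jB jN rB rN"
    using biprodE[OF homD(4,5)[OF assms(2)]] by blast
  note [simp] = biproductD[OF S']
  note red = biproduct_reduce[OF S']
    biproduct_reduce[OF assms(3)]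
  define h where "h = jB \<cdot> pB \<oplus> jN \<cdot> (q \<cdot> pM)"
  have h [simp]: "h \<in> Mor C" "Dom C h = S" "Cod C h = S'" by (auto simp: h_def)
  have hp: "rB \<cdot> h = pB" "rN \<cdot> h = q \<cdot> pM" by (auto simp: h_def red)
  have "pb C S M S' N pM h q rN"
    unfolding pb_def
  proof (intro conjI allI ballI impI)
    fix T s v assume sv: "s \<in> hom T S'" "v \<in> hom T M" "rN \<cdot> s = q \<cdot> v"
    note [simp] = homD[OF sv(1)] homD[OF sv(2)]
    have "h \<cdot> (iB \<cdot> (rB \<cdot> s) \<oplus> iM \<cdot> v) = jB \<cdot> (rB \<cdot> s) \<oplus> jN \<cdot> (rN \<cdot> s)"
      by (simp add: h_def red sv(3))
    then have "h \<cdot> (iB \<cdot> (rB \<cdot> s) \<oplus> iM \<cdot> v) = s" using biproduct_decompose[OF S' sv(1)] by simp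
    moreover have "pM \<cdot> (iB \<cdot> (rB \<cdot> s) \<oplus> iM \<cdot> v) = v" by (simp add: red)
    moreover have "iB \<cdot> (rB \<cdot> s) \<oplus> iM \<cdot> v \<in> hom T S" by simp
    ultimately show "\<exists>w \<in> hom T S. h \<cdot> w = s \<and> pM \<cdot> w = v" by blast
  next
    fix T w w' assume w: "w \<in> hom T S" "w' \<in> hom T S" "h \<cdot> w = h \<cdot> w'" "pM \<cdot> w = pM \<cdot> w'"
    note [simp] = homD[OF w(1)] homD[OF w(2)]
    have "pB \<cdot> w = pB \<cdot> w'"
      using w(3) cmp_reduce[OF hp(1), of w] cmp_reduce[OF hp(1), of w'] by simp
    then show "w = w'" using biproduct_decompose[OF assms(3)] w by metis
  qed (use hp in auto)
  from pb_deflation[OF assms(1) this] obtain r1 where r1: "cf C A S S' r1 h" by blast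
  \<comment> \<open>The second factor is the projection of a sheared biproduct structure on
    \<open>S'\<close>, in which \<open>B\<close> is embedded as the graph of minus
    \<open>u\<close>.\<close>
  define y where "y = u \<cdot> rB \<oplus> rN"
  define jB' where "jB' = jB \<oplus> neg (jN \<cdot> u)"
  have [simp]: "y \<in> Mor C" "Dom C y = S'" "Cod C y = N" "jB' \<in> Mor C" "Dom C jB' = B" "Cod C jB' = S'"
    by (auto simp: y_def jB'_def)
  have "jB' \<cdot> rB \<oplus> jN \<cdot> y = idm S'"
    using add_left_comm[of "jB \<cdot> rB" "neg (jN \<cdot> (u \<cdot> rB))" "jN \<cdot> (u \<cdot> rB) \<oplus> jN \<cdot> rN"]
    by (simp add: y_def jB'_def)
  then have "biproduct C B N S' jB' jN rB y"
    unfolding biproduct_def by (auto simp: y_def jB'_def red)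
  then have "cf C B S' N jB' y" by (rule cf_biproduct)
  then have "deflation C (y \<cdot> h)"
    using deflation_Cmp[of h y] r1 by (auto simp: cf_def deflation_def)
  moreover have "y \<cdot> h = u \<cdot> pB \<oplus> q \<cdot> pM" by (simp add: y_def hp)
  ultimately obtain r where "(r, u \<cdot> pB \<oplus> q \<cdot> pM) \<in> Conf C" by (auto simp: deflation_def)
  from cfI[OF this] cfD(5)[OF cfI[OF this]] show ?thesis by auto
qed

text \<open>The pullback property makes \<open>B\<close> the kernel of the copairing of
  \<open>f\<close> and \<open>p'\<close>, which is a deflation by \<open>copair_deflation\<close>.
  The sign makes the composite vanish.\<close>

lemma cf_of_pb:
  assumes "cf C A B' D' i' p'" "pb C B B' D D' m p p' f" "biproduct C D B' S iD iB pD pB"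
  shows "cf C B S D' (iD \<cdot> p \<oplus> neg (iB \<cdot> m)) (f \<cdot> pD \<oplus> p' \<cdot> pB)"
proof -
  note P = pbD[OF assms(2)]
  note [simp] = cfD[OF assms(1)] biproductD[OF assms(3)] homD[OF P(1)] homD[OF P(2)] homD[OF P(3)]
    homD[OF P(4)]
  note red = biproduct_reduce[OF assms(3)]
  obtain R r where R: "cf C R S D' r (f \<cdot> pD \<oplus> p' \<cdot> pB)"
    using copair_deflation[OF assms(1) P(4) assms(3)] by blast
  define k where "k = iD \<cdot> p \<oplus> neg (iB \<cdot> m)"
  have kp: "pD \<cdot> k = p" "pB \<cdot> k = neg m" by (auto simp: red k_def)
  have [simp]: "k \<in> Mor C" "Dom C k = B" "Cod C k = S" by (auto simp: k_def)
  show ?thesis unfolding k_def[symmetric]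
  proof (rule deflation_kernel[OF R])
    show "(f \<cdot> pD \<oplus> p' \<cdot> pB) \<cdot> k = zer B D'" by (simp add: red P(5) k_def)
  next
    fix T x assume x: "x \<in> hom T S" "(f \<cdot> pD \<oplus> p' \<cdot> pB) \<cdot> x = zer T D'"
    note [simp] = homD[OF x(1)]
    have "f \<cdot> (pD \<cdot> x) \<oplus> neg (neg (p' \<cdot> (pB \<cdot> x))) = zer T D'" using x(2) by simp
    then have "f \<cdot> (pD \<cdot> x) = p' \<cdot> neg (pB \<cdot> x)"
      using sub_zer_iff[of "f \<cdot> (pD \<cdot> x)" "neg (p' \<cdot> (pB \<cdot> x))"] by simp
    then obtain w where w: "w \<in> hom T B" "p \<cdot> w = pD \<cdot> x" "m \<cdot> w = neg (pB \<cdot> x)"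
      using P(6)[of "pD \<cdot> x" T "neg (pB \<cdot> x)"] by auto
    note [simp] = homD[OF w(1)]
    have "k \<cdot> w = iD \<cdot> (pD \<cdot> x) \<oplus> iB \<cdot> (pB \<cdot> x)" by (simp add: w(2,3) k_def)
    then have "k \<cdot> w = x" using biproduct_decompose[OF assms(3) x(1)] by simp
    then show "\<exists>g \<in> hom T B. k \<cdot> g = x" using w by blast
  next
    fix T g g' assume g: "g \<in> hom T B" "g' \<in> hom T B" "k \<cdot> g = k \<cdot> g'"
    note [simp] = homD[OF g(1)] homD[OF g(2)]
    have "p \<cdot> g = p \<cdot> g'"
      using cmp_reduce[OF kp(1), of g] cmp_reduce[OF kp(1), of g'] g(3) by simp
    moreover have "neg (m \<cdot> g) = neg (m \<cdot> g')"
      using cmp_reduce[OF kp(2), of g] cmp_reduce[OF kp(2), of g'] g(3) by simp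
    then have "neg (neg (m \<cdot> g)) = neg (neg (m \<cdot> g'))" by (rule arg_cong)
    then have "m \<cdot> g = m \<cdot> g'" by simp
    ultimately show "g = g'" using P(7) g by blast
  qed simp
qed

lemma neg_opp: "exc.neg (opp C) f = neg f"
  by (simp add: exc.neg_def[OF opp] neg_def)

lemma cf_of_po:
  assumes "cf C A B D i p" "po C A B A' B' i f i' f'" "biproduct C A' B S iA iB pA pB"
  shows "cf C A S B' (iA \<cdot> f \<oplus> iB \<cdot> i) (i' \<cdot> pA \<oplus> neg (f' \<cdot> pB))"
proof -
  note P = poD[OF assms(2)]
  note [simp] = cfD[OF assms(1)] biproductD[OF assms(3)] homD[OF P(1)] homD[OF P(2)] homD[OF P(3)]
    homD[OF P(4)]
  show ?thesis
    using exc.cf_of_pb[OF opp, of D B A p i B' A' f' i' f S pA pB iA iB] assms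
    by (simp add: pb_opp neg_opp)
qed

text \<open>With \<open>P = X/A\<close> and \<open>Q = Y/X\<close>, the quotient
  \<open>R = Y/A\<close> is constructed as the pushout of \<open>j\<close> along \<open>p\<close>.
  It is a cokernel of the composite, which is an inflation by the axioms.\<close>

lemma noether:
  assumes "cf C A X P i p" "cf C X Y Q j q"
  shows "\<exists>R r u v. cf C A Y R (j \<cdot> i) r \<and> cf C P R Q u v \<and> u \<cdot> p = r \<cdot> j \<and> v \<cdot> r = q"
proof -
  note [simp] = cfD[OF assms(1)] cfD[OF assms(2)]
  obtain R u v r where R: "cf C P R Q u v" "v \<cdot> r = q" "po C X Y P R j p u r"
    using pushout[OF assms(2) cf_hom(2)[OF assms(1)]] by blast
  note P = poD[OF R(3)]
  note [simp] = cfD[OF R(1)] homD[OF P(4)]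
  have "inflation C (j \<cdot> i)"
    using inflation_Cmp[of i j] assms by (auto simp: cf_def inflation_def)
  then obtain x where x: "(j \<cdot> i, x) \<in> Conf C" by (auto simp: inflation_def)
  have cx: "cf C A Y (Cod C x) (j \<cdot> i) x" using cfI[OF x] by simp
  have "cf C A Y R (j \<cdot> i) r"
  proof (rule inflation_cokernel[OF cx])
    show "r \<cdot> (j \<cdot> i) = zer A R" using cmp_reduce[OF P(5)[symmetric], of i] by simp
  next
    fix T f assume f: "f \<in> hom Y T" "f \<cdot> (j \<cdot> i) = zer A T"
    note [simp] = homD[OF f(1)]
    obtain g where g: "g \<in> hom P T" "g \<cdot> p = f \<cdot> j"
      using cf_cokernel[OF assms(1), of "f \<cdot> j" T] f(2) by auto
    then show "\<exists>g \<in> hom R T. g \<cdot> r = f" using P(6)[OF g(1) f(1)] by blast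
  next
    fix T w w' assume w: "w \<in> hom R T" "w' \<in> hom R T" "w \<cdot> r = w' \<cdot> r"
    note [simp] = homD[OF w(1)] homD[OF w(2)]
    have "(w \<cdot> u) \<cdot> p = (w' \<cdot> u) \<cdot> p"
      using w(3) cmp_assoc[of j r w] cmp_assoc[of j r w'] by (simp add: P(5))
    then have "w \<cdot> u = w' \<cdot> u" using cf_epi[OF assms(1), of "w \<cdot> u" T "w' \<cdot> u"] by simp
    then show "w = w'" using P(7) w by blast
  qed simp
  then show ?thesis using R P(5) by blast
qed

lemma noether_dual:
  assumes "cf C K Y X k q" "cf C L X Q l p"
  shows "\<exists>R r u v. cf C R Y Q r (p \<cdot> q) \<and> cf C K R L u v \<and> r \<cdot> u = k \<and> q \<cdot> r = l \<cdot> v"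
  using exc.noether[OF opp, of Q X L p l Y K q k] assms by simp metis

text \<open>The pushout of two inflations is an extension in two ways. Horseshoe arguments below
  read off information from both.\<close>

lemma pushout_two:
  assumes "cf C X Y Z i p" "cf C X V W j q"
  shows "\<exists>P i' p' j' q'. cf C V P Z i' p' \<and> cf C Y P W j' q' \<and> i' \<cdot> j = j' \<cdot> i \<and> p' \<cdot> j' = p \<and>
    q' \<cdot> i' = q \<and> po C X Y V P i j i' j'"
proof -
  obtain P i' p' j' where P: "cf C V P Z i' p'" "p' \<cdot> j' = p" "po C X Y V P i j i' j'"
    using pushout[OF assms(1) cf_hom(1)[OF assms(2)]] by blast
  have "po C X V Y P j i j' i'" using P(3) po_transpose by metis
  from po_inflation[OF assms(2) this] obtain q' where "cf C Y P W j' q'" "q' \<cdot> i' = q" by blast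
  then show ?thesis using P poD(5)[OF P(3)] by blast
qed

lemma cf_iso_ends:
  assumes "cf C A B D i p" "iso_mor C A' A a" "iso_mor C D D' c"
  shows "cf C A' B D' (i \<cdot> a) (c \<cdot> p)"
proof -
  note [simp] = cfD[OF assms(1)]
  obtain a' where a': "a \<in> hom A' A" "a' \<in> hom A A'" "a' \<cdot> a = idm A'" "a \<cdot> a' = idm A" "iso_mor C A A' a'"
    using assms(2) by (rule iso_morE)
  note [simp] = homD[OF a'(1)] homD[OF a'(2)]
  have [simp]: "c \<in> Mor C" "Dom C c = D" "Cod C c = D'" using assms(3) by (auto simp: iso_mor_def Hom_def)
  show ?thesis
    by (rule cf_transfer[OF assms(1) a'(5) iso_idm assms(3)]) (auto simp: a'(4))
qed

lemma iso_of_zero_kernel: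
  assumes "cf C Z B D i p" "zero_object C Z"
  shows "iso_mor C B D p"
proof -
  note [simp] = cfD[OF assms(1)]
  have "i = zer Z B" using zero_object_hom(2)[OF assms(2) cf_hom(1)[OF assms(1)]] .
  then obtain g where g: "g \<in> hom D B" "g \<cdot> p = idm B"
    using cf_cokernel[OF assms(1), of "idm B" B] by auto
  note [simp] = homD[OF g(1)]
  have "p \<cdot> g = idm D"
    by (rule cf_epi[OF assms(1), where T = D]) (use g(2) in auto)
  then show ?thesis using g cf_hom(2)[OF assms(1)] iso_morI by blast
qed

lemma iso_of_zero_cokernel:
  assumes "cf C A B Z i p" "zero_object C Z"
  shows "iso_mor C A B i"
  using exc.iso_of_zero_kernel[OF opp, of Z B A p i] assms by simp

lemma split_retraction:
  assumes "cf C A B D i p" "r \<in> hom B A" "r \<cdot> i = idm A"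
  shows "\<exists>s. biproduct C A D B i s r p"
proof -
  note [simp] = cfD[OF assms(1)] homD[OF assms(2)]
  have "(idm B \<oplus> neg (i \<cdot> r)) \<cdot> i = zer A B" using assms(3) by simp
  then obtain s where s: "s \<in> hom D B" "s \<cdot> p = idm B \<oplus> neg (i \<cdot> r)"
    using cf_cokernel[OF assms(1), of "idm B \<oplus> neg (i \<cdot> r)" B] by auto
  note [simp] = homD[OF s(1)]
  have "p \<cdot> s = idm D"
  proof (rule cf_epi[OF assms(1), where T = D])
    show "(p \<cdot> s) \<cdot> p = idm D \<cdot> p" using s(2) cmp_reduce[OF cfD(7)[OF assms(1)], of r] by simp
  qed auto
  moreover have "r \<cdot> s = zer D A"
  proof (rule cf_epi[OF assms(1), where T = A])
    show "(r \<cdot> s) \<cdot> p = zer D A \<cdot> p" using s(2) cmp_reduce[OF assms(3), of r] by simp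
  qed auto
  moreover have "i \<cdot> r \<oplus> s \<cdot> p = idm B"
    using s(2) add_left_comm[of "i \<cdot> r" "idm B" "neg (i \<cdot> r)"] by simp
  ultimately have "biproduct C A D B i s r p" using assms by (auto simp: biproduct_def)
  then show ?thesis by blast
qed

text \<open>Adds \<open>W\<close> to the first two terms of the conflation. It is done by a pushout
  along \<open>iZ\<close>, because the universal property of the new middle term is used
  later.\<close>

lemma cf_add_summand:
  assumes "cf C Z V Q j q" "biproduct C Z W S iZ iW pZ pW"
  shows "\<exists>S' j2 q2 l s r t. cf C S S' Q j2 q2 \<and> biproduct C V W S' l s r t \<and> j2 \<cdot> iZ = l \<cdot> j \<and>
    q2 \<cdot> l = q \<and> po C Z V S S' j iZ j2 l"
proof -
  obtain S' j2 q2 l lq where T: "cf C S S' Q j2 q2" "cf C V S' W l lq" "j2 \<cdot> iZ = l \<cdot> j" "q2 \<cdot> l = q"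
    "po C Z V S S' j iZ j2 l"
    using pushout_two[OF assms(1) cf_biproduct[OF assms(2)]] by metis
  note [simp] = biproductD[OF assms(2)] cfD[OF T(1)] cfD[OF T(2)] cfD[OF assms(1)]
  \<comment> \<open>The retraction induced by \<open>j \<cdot> pZ\<close> and the identity shows
    that \<open>S'\<close> is the sum of \<open>V\<close> and \<open>W\<close>.\<close>
  obtain r where r: "r \<in> hom S' V" "r \<cdot> j2 = j \<cdot> pZ" "r \<cdot> l = idm V"
    using poD(6)[OF T(5), of "j \<cdot> pZ" V "idm V"] by auto
  from split_retraction[OF T(2) r(1,3)] show ?thesis using T by blast
qed

text \<open>By Noether's isomorphism, the cokernel of \<open>J \<rightarrow> A\<close> is another pushout of \<open>i\<close> along \<open>f\<close>.\<close>

lemma mor_deflation: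
  assumes "cf C K A X i p" "cf C L M X i' p'" "\<alpha> \<in> hom A M" "\<alpha> \<cdot> i = i' \<cdot> f" "p' \<cdot> \<alpha> = p"
    "cf C J K L j f"
  shows "cf C J A M (i \<cdot> j) \<alpha>"
proof -
  note [simp] = cfD[OF assms(1)] cfD[OF assms(2)] homD[OF assms(3)] cfD[OF assms(6)]
  obtain R r u v where R: "cf C J A R (i \<cdot> j) r" "cf C L R X u v" "u \<cdot> f = r \<cdot> i" "v \<cdot> r = p"
    using noether[OF assms(6,1)] by blast
  note [simp] = cfD[OF R(1)] cfD[OF R(2)]
  have po: "po C K A L R i f u r"
    by (rule po_of_mor[OF assms(1) R(2)]) (use R cf_hom assms in auto)
  note P = poD[OF po]
  obtain w where w: "w \<in> hom R M" "w \<cdot> u = i'" "w \<cdot> r = \<alpha>"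
    using P(6)[OF cf_hom(1)[OF assms(2)] assms(3)] assms(4) by auto
  note [simp] = homD[OF w(1)]
  have "p' \<cdot> w = v"
    by (rule P(7)[where T = X])
      (use w R assms(5) cmp_assoc[of u w p'] cmp_assoc[of r w p'] in \<open>auto simp del: cmp_assoc\<close>)
  then have "iso_mor C R M w" using short_five[OF R(2) assms(2) w(1,2)] by blast
  from cf_iso_ends[OF R(1) iso_idm this] show ?thesis using w(3) by simp
qed

end

section \<open>Chains of conflations\<close>

text \<open>The list \<open>[(i\<^sub>1, p\<^sub>1), \<dots>, (i\<^sub>n, p\<^sub>n)]\<close> of conflations \<open>K\<^sub>j\<^sub>-\<^sub>1 \<rightarrow> A\<^sub>j \<rightarrow> K\<^sub>j\<close> with \<open>K\<^sub>0 = Y\<close> and \<open>K\<^sub>n = X\<close>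
  encodes an \<open>n\<close>-extension \<open>0 \<rightarrow> Y \<rightarrow> A\<^sub>1 \<rightarrow> \<dots> \<rightarrow> A\<^sub>n \<rightarrow> X \<rightarrow> 0\<close>.\<close>

fun chain :: "('o, 'm) excat \<Rightarrow> 'o \<Rightarrow> 'o \<Rightarrow> ('m \<times> 'm) list \<Rightarrow> bool" where
  "chain C X Y [] \<longleftrightarrow> X = Y \<and> X \<in> Ob C"
| "chain C X Y (c # cs) \<longleftrightarrow> (\<exists>A K. cf C Y A K (fst c) (snd c) \<and> chain C X K cs)"

text \<open>The maps \<open>k\<close> between the objects \<open>K_j\<close> at which the
  conflations are spliced are part of the data, so that the recursion can hand \<open>k\<close> on
  as the left end of the rest.\<close>

fun cmor :: "('o, 'm) excat \<Rightarrow> 'm \<Rightarrow> 'm \<Rightarrow> ('m \<times> 'm) list \<Rightarrow> ('m \<times> 'm) list \<Rightarrow> bool" where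
  "cmor C a b [] [] \<longleftrightarrow> a = b"
| "cmor C a b (c # cs) (d # ds) \<longleftrightarrow>
     (\<exists>m \<in> Hom C (Cod C (fst c)) (Cod C (fst d)). \<exists>k \<in> Hom C (Cod C (snd c)) (Cod C (snd d)).
        m \<cdot>\<^bsub>C\<^esub> fst c = fst d \<cdot>\<^bsub>C\<^esub> a \<and> snd d \<cdot>\<^bsub>C\<^esub> m = k \<cdot>\<^bsub>C\<^esub> snd c \<and> cmor C k b cs ds)"
| "cmor C a b cs ds \<longleftrightarrow> False"

text \<open>Yoneda equivalence of chains turns out to be \<open>rr\<close> (existence of a right roof), so that
  \<open>EZ C n X Y\<close> says \<open>Ext\<^sup>n(X, Y) = 0\<close>.\<close>

definition rr :: "('o, 'm) excat \<Rightarrow> 'o \<Rightarrow> 'o \<Rightarrow> ('m \<times> 'm) list \<Rightarrow> ('m \<times> 'm) list \<Rightarrow> bool" where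
  "rr C X Y cs ds \<longleftrightarrow>
     (\<exists>es. chain C X Y es \<and> cmor C (Idm C Y) (Idm C X) es cs \<and> cmor C (Idm C Y) (Idm C X) es ds)"

definition EZ :: "('o, 'm) excat \<Rightarrow> nat \<Rightarrow> 'o \<Rightarrow> 'o \<Rightarrow> bool" where
  "EZ C n X Y \<longleftrightarrow> (\<forall>cs ds. chain C X Y cs \<longrightarrow> chain C X Y ds \<longrightarrow> length cs = n \<longrightarrow> length ds = n \<longrightarrow>
     rr C X Y cs ds)"

lemma cmor_length: "cmor C a b cs ds \<Longrightarrow> length cs = length ds"
  by (induction C a b cs ds rule: cmor.induct) auto

lemma cmor_append:
  assumes "length cs = length ds"
  shows "cmor C a b (cs @ cs') (ds @ ds') \<longleftrightarrow> (\<exists>k. cmor C a k cs ds \<and> cmor C k b cs' ds')"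
  using assms
proof (induction cs ds arbitrary: a rule: list_induct2)
  case (Cons c cs d ds)
  then show ?case by simp blast
qed simp

context exc
begin

lemma chain_Cons:
  "chain C X Y ((i, p) # cs) \<longleftrightarrow> cf C Y (Cod C i) (Cod C p) i p \<and> chain C X (Cod C p) cs"
  using cfD by auto

lemma chain_Ob: "chain C X Y cs \<Longrightarrow> X \<in> Ob C \<and> Y \<in> Ob C"
  by (induction cs arbitrary: Y) (auto dest: cfD)

lemma chain_append: "chain C X Y (cs @ ds) \<longleftrightarrow> (\<exists>K. chain C K Y cs \<and> chain C X K ds)"
proof (induction cs arbitrary: Y)
  case Nil
  then show ?case using chain_Ob by auto
next
  case (Cons c cs)
  then show ?case by auto
qed

lemma chain_single: "chain C X Y [c] \<longleftrightarrow> (\<exists>A. cf C Y A X (fst c) (snd c))"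
  using cfD by auto

lemma cmor_ConsI:
  assumes "cf C Y A K i p" "cf C Y' A' K' i' p'" "m \<in> hom A A'" "k \<in> hom K K'"
    "m \<cdot> i = i' \<cdot> a" "p' \<cdot> m = k \<cdot> p" "cmor C k b cs ds"
  shows "cmor C a b ((i, p) # cs) ((i', p') # ds)"
proof -
  note [simp] = cfD[OF assms(1)] cfD[OF assms(2)]
  show ?thesis using assms by auto
qed

lemma cmor_ConsE:
  assumes "cmor C a b ((i, p) # cs) es" "cf C Y A K i p" "chain C X Y' es"
  obtains i' p' ds A' K' m k where "es = (i', p') # ds" "cf C Y' A' K' i' p'" "chain C X K' ds"
    "m \<in> hom A A'" "k \<in> hom K K'" "m \<cdot> i = i' \<cdot> a" "p' \<cdot> m = k \<cdot> p" "cmor C k b cs ds"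
proof (cases es)
  case (Cons e ds)
  obtain i' p' where [simp]: "e = (i', p')" by (cases e)
  obtain A' K' where c: "cf C Y' A' K' i' p'" "chain C X K' ds" using assms(3) Cons by auto
  show ?thesis using that[of i' p' ds A' K'] c assms(1) Cons cfD(4,6)[OF c(1)] cfD(4,6)[OF assms(2)] by auto
qed (use assms in simp)

lemma cmor_ConsE':
  assumes "cmor C a b cs ((i', p') # ds)" "cf C Y' A' K' i' p'" "chain C X Y cs"
  obtains i p es A K m k where "cs = (i, p) # es" "cf C Y A K i p" "chain C X K es"
    "m \<in> hom A A'" "k \<in> hom K K'" "m \<cdot> i = i' \<cdot> a" "p' \<cdot> m = k \<cdot> p" "cmor C k b es ds"
proof (cases cs)
  case (Cons e es)
  obtain i p where [simp]: "e = (i, p)" by (cases e)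
  obtain A K where c: "cf C Y A K i p" "chain C X K es" using assms(3) Cons by auto
  show ?thesis using that[of i p es A K] c assms(1) Cons cfD(4,6)[OF c(1)] cfD(4,6)[OF assms(2)] by auto
qed (use assms in simp)

lemma cmor_hom:
  "cmor C a b cs ds \<Longrightarrow> chain C X Y cs \<Longrightarrow> chain C X' Y' ds \<Longrightarrow> a \<in> hom Y Y' \<Longrightarrow> b \<in> hom X X'"
proof (induction C a b cs ds arbitrary: Y Y' rule: cmor.induct)
  case (2 C a b c cs d ds)
  obtain i p where [simp]: "c = (i, p)" by (cases c)
  obtain i' p' where [simp]: "d = (i', p')" by (cases d)
  show ?case using 2 by auto (metis cf_def HomD(3))
qed auto

lemma cmor_refl: "chain C X Y cs \<Longrightarrow> cmor C (idm Y) (idm X) cs cs"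
proof (induction cs arbitrary: Y)
  case (Cons c cs)
  obtain i p where [simp]: "c = (i, p)" by (cases c)
  obtain A K where c: "cf C Y A K i p" "chain C X K cs" using Cons.prems by auto
  note [simp] = cfD[OF c(1)]
  show ?case unfolding \<open>c = (i, p)\<close>
    by (rule cmor_ConsI[OF c(1) c(1), of "idm A" "idm K"]) (auto simp: Cons.IH[OF c(2)])
qed simp

lemma cmor_comp:
  assumes "chain C X Y cs" "chain C X' Y' ds" "chain C X'' Y'' es" "a \<in> hom Y Y'" "a' \<in> hom Y' Y''"
    "cmor C a b cs ds" "cmor C a' b' ds es"
  shows "cmor C (a' \<cdot> a) (b' \<cdot> b) cs es"
  using assms
proof (induction cs arbitrary: Y Y' Y'' ds es a a')
  case Nil
  then have "ds = []" using cmor_length[OF Nil(6)] by simp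
  then have "es = []" using cmor_length[OF Nil(7)] by simp
  then show ?case using Nil \<open>ds = []\<close> by simp
next
  case (Cons c cs)
  obtain i p where [simp]: "c = (i, p)" by (cases c)
  obtain A K where c: "cf C Y A K i p" "chain C X K cs" using Cons.prems(1) by auto
  obtain i' p' ds' A' K' m k where d: "ds = (i', p') # ds'" "cf C Y' A' K' i' p'" "chain C X' K' ds'"
    "m \<in> hom A A'" "k \<in> hom K K'" "m \<cdot> i = i' \<cdot> a" "p' \<cdot> m = k \<cdot> p" "cmor C k b cs ds'"
    using cmor_ConsE[OF Cons.prems(6)[simplified \<open>c = (i, p)\<close>] c(1) Cons.prems(2)] by metis
  obtain i'' p'' es' A'' K'' m' k' where e: "es = (i'', p'') # es'" "cf C Y'' A'' K'' i'' p''" "chain C X'' K'' es'"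
    "m' \<in> hom A' A''" "k' \<in> hom K' K''" "m' \<cdot> i' = i'' \<cdot> a'" "p'' \<cdot> m' = k' \<cdot> p'" "cmor C k' b' ds' es'"
    using cmor_ConsE[OF Cons.prems(7)[unfolded d(1)] d(2) Cons.prems(3)] by metis
  note [simp] = cfD[OF c(1)] cfD[OF d(2)] cfD[OF e(2)] homD[OF d(4)] homD[OF d(5)] homD[OF e(4)] homD[OF e(5)]
    homD[OF Cons.prems(4)] homD[OF Cons.prems(5)]
  have "cmor C (k' \<cdot> k) (b' \<cdot> b) cs es'"
    by (rule Cons.IH[OF c(2) d(3) e(3) d(5) e(5) d(8) e(8)])
  moreover have "(m' \<cdot> m) \<cdot> i = i'' \<cdot> (a' \<cdot> a)"
    using cmp_reduce[OF e(6), of a] by (simp add: d(6))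
  moreover have "p'' \<cdot> (m' \<cdot> m) = (k' \<cdot> k) \<cdot> p"
    using cmp_reduce[OF e(7), of m] by (simp add: d(7))
  ultimately show ?case unfolding e(1) \<open>c = (i, p)\<close>
    by (intro cmor_ConsI[OF c(1) e(2), of "m' \<cdot> m" "k' \<cdot> k"]) auto
qed

lemma cmor_comp_id:
  assumes "chain C X Y cs" "chain C X Y' ds" "chain C X Y'' es" "a \<in> hom Y Y'" "a' \<in> hom Y' Y''"
    "cmor C a (idm X) cs ds" "cmor C a' (idm X) ds es"
  shows "cmor C (a' \<cdot> a) (idm X) cs es"
  using cmor_comp[OF assms] chain_Ob[OF assms(1)] by simp

text \<open>Only the first conflation changes. The universal property in the last clause is what
  makes the pushforward of a class well defined up to \<open>rr\<close>.\<close>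

lemma chain_pushout:
  assumes "chain C X Y cs" "cs \<noteq> []" "a \<in> hom Y Y'"
  shows "\<exists>ds. chain C X Y' ds \<and> length ds = length cs \<and> cmor C a (idm X) cs ds \<and>
    (\<forall>y Y'' es. y \<in> hom Y' Y'' \<longrightarrow> chain C X Y'' es \<longrightarrow> cmor C (y \<cdot> a) (idm X) cs es \<longrightarrow>
      cmor C y (idm X) ds es)"
proof -
  obtain i p cs' where [simp]: "cs = (i, p) # cs'" using assms(2) by (cases cs) auto
  obtain A K where c: "cf C Y A K i p" "chain C X K cs'" using assms(1) by auto
  obtain A' i' p' f' where d: "cf C Y' A' K i' p'" "p' \<cdot> f' = p" "po C Y A Y' A' i a i' f'"
    using pushout[OF c(1) assms(3)] by blast
  note P = poD[OF d(3)]
  note [simp] = cfD[OF c(1)] cfD[OF d(1)] homD[OF P(4)] homD[OF assms(3)]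
  have 1: "cmor C a (idm X) cs ((i', p') # cs')"
    unfolding \<open>cs = (i, p) # cs'\<close>
    by (rule cmor_ConsI[OF c(1) d(1), of f' "idm K"]) (auto simp: cmor_refl[OF c(2)] d(2) P(5))
  have "cmor C y (idm X) ((i', p') # cs') es"
    if y: "y \<in> hom Y' Y''" "chain C X Y'' es" "cmor C (y \<cdot> a) (idm X) cs es" for y Y'' es
  proof -
    obtain i2 p2 ds A2 K2 m k where e: "es = (i2, p2) # ds" "cf C Y'' A2 K2 i2 p2" "chain C X K2 ds"
      "m \<in> hom A A2" "k \<in> hom K K2" "m \<cdot> i = i2 \<cdot> (y \<cdot> a)" "p2 \<cdot> m = k \<cdot> p" "cmor C k (idm X) cs' ds"
      using cmor_ConsE[OF y(3)[simplified] c(1) y(2)] by metis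
    note [simp] = cfD[OF e(2)] homD[OF e(4)] homD[OF e(5)] homD[OF y(1)]
    obtain w where w: "w \<in> hom A' A2" "w \<cdot> i' = i2 \<cdot> y" "w \<cdot> f' = m"
      using P(6)[of "i2 \<cdot> y" A2 m] e by auto
    note [simp] = homD[OF w(1)]
    have "p2 \<cdot> w = k \<cdot> p'"
    proof (rule P(7)[where T = K2])
      show "(p2 \<cdot> w) \<cdot> i' = (k \<cdot> p') \<cdot> i'"
        using cmp_reduce[OF cfD(7)[OF e(2)], of y] by (simp add: w)
      show "(p2 \<cdot> w) \<cdot> f' = (k \<cdot> p') \<cdot> f'" by (simp add: w d e)
    qed auto
    then show ?thesis unfolding e(1)
      by (intro cmor_ConsI[OF d(1) e(2), of w k]) (use w e in auto)
  qed
  then show ?thesis using 1 c d by (intro exI[of _ "(i', p') # cs'"]) auto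
qed

text \<open>The case of length one. Since \<open>f\<close> is a deflation, so is
  \<open>\<alpha>\<close> by \<open>mor_deflation\<close>. The pullback \<open>A''\<close> of
  \<open>\<alpha>\<close> along \<open>\<alpha>'\<close> therefore has a deflation onto
  \<open>A'\<close> and further onto \<open>X\<close>, whose kernel maps compatibly to
  \<open>K\<close> and \<open>K'\<close>.\<close>

lemma conflation_weak_pullback:
  assumes "cf C K A X i p" "cf C K' A' X i' p'" "cf C L M X l q"
    "\<alpha> \<in> hom A M" "\<alpha> \<cdot> i = l \<cdot> f" "q \<cdot> \<alpha> = p" "\<alpha>' \<in> hom A' M" "\<alpha>' \<cdot> i' = l \<cdot> f'" "q \<cdot> \<alpha>' = p'"
    "f' \<in> hom K' L" "cf C J K L j f"
  shows "\<exists>K'' A'' i'' p'' g g' m m'. cf C K'' A'' X i'' p'' \<and> g \<in> hom K'' K \<and> g' \<in> hom K'' K' \<and>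
    f \<cdot> g = f' \<cdot> g' \<and> m \<in> hom A'' A \<and> m' \<in> hom A'' A' \<and> m \<cdot> i'' = i \<cdot> g \<and> m' \<cdot> i'' = i' \<cdot> g' \<and>
    p \<cdot> m = p'' \<and> p' \<cdot> m' = p''"
proof -
  have \<alpha>: "cf C J A M (i \<cdot> j) \<alpha>"
    by (rule mor_deflation[OF assms(1,3,4,5,6,11)])
  obtain A'' k m' m where 1: "cf C J A'' A' k m'" "pb C A'' A A' M m m' \<alpha> \<alpha>'"
    using pullback[OF \<alpha> assms(7)] by blast
  note P = pbD[OF 1(2)]
  obtain R r where R: "cf C R A'' X r (p' \<cdot> m')" using noether_dual[OF 1(1) assms(2)] by blast
  note [simp] = cfD[OF assms(1)] cfD[OF assms(2)] cfD[OF assms(3)] homD[OF assms(4)] homD[OF assms(7)]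
    homD[OF assms(10)] cfD[OF assms(11)] homD[OF P(1)] homD[OF P(2)] cfD[OF R]
  have pm: "p \<cdot> m = p' \<cdot> m'"
    using cmp_reduce[OF assms(6), of m] cmp_reduce[OF assms(9), of m'] P(5) by simp
  have r0: "p' \<cdot> (m' \<cdot> r) = zer R X"
    by (subst cmp_assoc[symmetric]) (auto simp del: cmp_assoc)
  then obtain g' where g': "g' \<in> hom R K'" "i' \<cdot> g' = m' \<cdot> r" using cf_kernel[OF assms(2), of "m' \<cdot> r" R] by auto
  have "p \<cdot> (m \<cdot> r) = zer R X" using cmp_reduce[OF pm, of r] r0 by simp
  then obtain g where g: "g \<in> hom R K" "i \<cdot> g = m \<cdot> r" using cf_kernel[OF assms(1), of "m \<cdot> r" R] by auto
  note [simp] = homD[OF g'(1)] homD[OF g(1)]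
  have "l \<cdot> (f \<cdot> g) = l \<cdot> (f' \<cdot> g')"
  proof -
    have "l \<cdot> (f \<cdot> g) = \<alpha> \<cdot> (m \<cdot> r)" using cmp_reduce[OF assms(5), of g] g(2) by simp
    also have "\<dots> = \<alpha>' \<cdot> (m' \<cdot> r)" using cmp_reduce[OF P(5), of r] by simp
    also have "\<dots> = l \<cdot> (f' \<cdot> g')" using cmp_reduce[OF assms(8), of g'] g'(2) by simp
    finally show ?thesis .
  qed
  then have "f \<cdot> g = f' \<cdot> g'" using cf_mono[OF assms(3), of "f \<cdot> g" R "f' \<cdot> g'"] by simp
  then show ?thesis using R g g' pm P(1,2) by metis
qed

end

definition dualc :: "('m \<times> 'm) list \<Rightarrow> ('m \<times> 'm) list" where
  "dualc cs = rev (map prod.swap cs)"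

lemma dualc_simps [simp]:
  "dualc [] = []" "dualc (c # cs) = dualc cs @ [prod.swap c]" "dualc (cs @ ds) = dualc ds @ dualc cs"
  "dualc (dualc cs) = cs" "length (dualc cs) = length cs" "dualc cs = [] \<longleftrightarrow> cs = []"
  by (auto simp: dualc_def rev_map comp_def)

definition terms :: "('o, 'm) excat \<Rightarrow> ('m \<times> 'm) list \<Rightarrow> 'o set" where
  "terms C cs = (\<lambda>c. Cod C (fst c)) ` set cs"

lemma terms_simps [simp]:
  "terms C [] = {}" "terms C (c # cs) = insert (Cod C (fst c)) (terms C cs)"
  "terms C (cs @ ds) = terms C cs \<union> terms C ds"
  by (auto simp: terms_def)

lemma terms_nth: "terms C cs \<subseteq> U \<longleftrightarrow> (\<forall>j < length cs. Cod C (fst (cs ! j)) \<in> U)"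
  by (auto simp: terms_def image_subset_iff all_set_conv_all_nth)

context exc
begin

text \<open>In the inductive step the vertical map \<open>u : B \<rightarrow> N\<close> need not be a deflation; replacing \<open>B\<close> by
  \<open>B \<oplus> M\<close>, where \<open>L \<rightarrow> M \<rightarrow> N\<close> is the first conflation of \<open>ls\<close>, makes it one. This changes
  \<open>u\<close> only by maps that factor through \<open>M\<close>, and these act trivially on the class of
  \<open>L \<rightarrow> M \<rightarrow> N\<close>.\<close>

lemma chain_weak_pullback:
  assumes "length es = n" "es \<noteq> []" "chain C X K es" "chain C X K' es'" "chain C X L ls"
    "cmor C f (idm X) es ls" "cmor C f' (idm X) es' ls" "cf C J K L j f" "f' \<in> hom K' L"
  shows "\<exists>K'' g g' ds. g \<in> hom K'' K \<and> g' \<in> hom K'' K' \<and> f \<cdot> g = f' \<cdot> g' \<and> chain C X K'' ds \<and>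
    cmor C g (idm X) ds es \<and> cmor C g' (idm X) ds es'"
  using assms
proof (induction n arbitrary: es es' ls K K' L f f' J j)
  case (Suc n)
  obtain i p b where es: "es = (i, p) # b" using Suc.prems(2) by (cases es) auto
  obtain A B where c: "cf C K A B i p" "chain C X B b" using Suc.prems(3) es by auto
  obtain l q ms M N \<alpha> u where ls: "ls = (l, q) # ms" "cf C L M N l q" "chain C X N ms"
    "\<alpha> \<in> hom A M" "u \<in> hom B N" "\<alpha> \<cdot> i = l \<cdot> f" "q \<cdot> \<alpha> = u \<cdot> p" "cmor C u (idm X) b ms"
    using cmor_ConsE[OF Suc.prems(6)[unfolded es] c(1) Suc.prems(5)] by metis
  obtain i' p' b' A' B' \<alpha>' u' where es': "es' = (i', p') # b'" "cf C K' A' B' i' p'" "chain C X B' b'"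
    "\<alpha>' \<in> hom A' M" "u' \<in> hom B' N" "\<alpha>' \<cdot> i' = l \<cdot> f'" "q \<cdot> \<alpha>' = u' \<cdot> p'" "cmor C u' (idm X) b' ms"
    using cmor_ConsE'[OF Suc.prems(7)[unfolded ls(1)] ls(2) Suc.prems(4)] by metis
  note cD = cfD[OF c(1)] cfD[OF ls(2)] cfD[OF es'(2)] cfD[OF Suc.prems(8)]
    homD[OF ls(4)] homD[OF ls(5)] homD[OF es'(4)] homD[OF es'(5)] homD[OF Suc.prems(9)]
  show ?case
  proof (cases "b = []")
    case True
    then have ms: "ms = []" using cmor_length[OF ls(8)] by simp
    then have b': "b' = []" using cmor_length[OF es'(8)] by simp
    have X: "B = X" "N = X" "B' = X" "X \<in> Ob C" using c(2) ls(3) es'(3) True ms b' by auto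
    have u: "u = idm X" "u' = idm X" using ls(8) es'(8) True ms b' by auto
    have "q \<cdot> \<alpha> = p" "q \<cdot> \<alpha>' = p'" using ls(7) es'(7) u X cD by auto
    from conflation_weak_pullback[OF c(1)[unfolded X] es'(2)[unfolded X] ls(2)[unfolded X] ls(4) ls(6) this(1)
      es'(4) es'(6) this(2) Suc.prems(9) Suc.prems(8)]
    obtain K'' A'' i'' p'' g g' m m' where W: "cf C K'' A'' X i'' p''" "g \<in> hom K'' K" "g' \<in> hom K'' K'"
      "f \<cdot> g = f' \<cdot> g'" "m \<in> hom A'' A" "m' \<in> hom A'' A'" "m \<cdot> i'' = i \<cdot> g" "m' \<cdot> i'' = i' \<cdot> g'"
      "p \<cdot> m = p''" "p' \<cdot> m' = p''" by blast
    note [simp] = cfD[OF W(1)]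
    have "cmor C g (idm X) [(i'', p'')] es" unfolding es True
      by (rule cmor_ConsI[OF W(1) c(1)[unfolded X] W(5), of "idm X"]) (use W X in auto)
    moreover have "cmor C g' (idm X) [(i'', p'')] es'" unfolding es' b'
      by (rule cmor_ConsI[OF W(1) es'(2)[unfolded X] W(6), of "idm X"]) (use W X in auto)
    moreover have "chain C X K'' [(i'', p'')]" using W(1) X by auto
    ultimately show ?thesis using W by blast
  next
    case False
    note [simp] = cD
    obtain S iB iM pB pM where S: "biproduct C B M S iB iM pB pM"
      using biprodE[OF cfD(10)[OF c(1)] cfD(9)[OF ls(2)]] by blast
    note [simp] = biproductD[OF S]
    note red = biproduct_reduce[OF S]
    have iB: "iB \<in> hom B S" by simp
    obtain bt where bt: "chain C X S bt" "length bt = length b" "cmor C iB (idm X) b bt"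
      "\<And>y Y'' es. y \<in> hom S Y'' \<Longrightarrow> chain C X Y'' es \<Longrightarrow> cmor C (y \<cdot> iB) (idm X) b es \<Longrightarrow> cmor C y (idm X) bt es"
      using chain_pushout[OF c(2) False iB] by blast
    define y where "y = u \<cdot> pB \<oplus> q \<cdot> pM"
    have y: "y \<in> hom S N" "y \<cdot> iB = u" by (auto simp: y_def)
    obtain R r where R: "cf C R S N r y" using copair_deflation[OF ls(2,5) S] y_def by blast
    have ym: "cmor C y (idm X) bt ms" by (rule bt(4)[OF y(1) ls(3)]) (use y ls in simp)
    have pb: "cmor C pB (idm X) bt b"
      by (rule bt(4)[OF _ c(2)]) (use cmor_refl[OF c(2)] in simp_all)
    have "length bt = n" "bt \<noteq> []" using bt(2) Suc.prems(1) es False by auto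
    from Suc.IH[OF this bt(1) es'(3) ls(3) ym es'(8) R es'(5)]
    obtain K2 g0 g' ds0 where I: "g0 \<in> hom K2 S" "g' \<in> hom K2 B'" "y \<cdot> g0 = u' \<cdot> g'" "chain C X K2 ds0"
      "cmor C g0 (idm X) ds0 bt" "cmor C g' (idm X) ds0 b'" by blast
    note [simp] = homD[OF I(1)] homD[OF I(2)]
    define g where "g = pB \<cdot> g0"
    define t where "t = pM \<cdot> g0"
    have g: "g \<in> hom K2 B" and t: "t \<in> hom K2 M" by (auto simp: g_def t_def)
    note [simp] = homD[OF g] homD[OF t]
    have ut: "u \<cdot> g \<oplus> q \<cdot> t = u' \<cdot> g'" using I(3) by (simp add: y_def g_def t_def)
    have gb: "cmor C g (idm X) ds0 b" unfolding g_def
      by (rule cmor_comp_id[OF I(4) bt(1) c(2) I(1) _ I(5) pb]) simp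
    obtain A1 i1 p1 a1 where 1: "cf C K A1 K2 i1 p1" "a1 \<cdot> i1 = i" "pb C A1 A K2 B a1 p1 p g"
      using pullback[OF c(1) g] by blast
    obtain A1' i1' p1' a1' where one': "cf C K' A1' K2 i1' p1'" "a1' \<cdot> i1' = i'" "pb C A1' A' K2 B' a1' p1' p' g'"
      using pullback[OF es'(2) I(2)] by blast
    have ug: "u \<cdot> g \<in> hom K2 N" by simp
    obtain M1 l1 q1 m1 where L: "cf C L M1 K2 l1 q1" "m1 \<cdot> l1 = l" "pb C M1 M K2 N m1 q1 q (u \<cdot> g)"
      using pullback[OF ls(2) ug] by blast
    note P = pbD[OF 1(3)] and P' = pbD[OF one'(3)] and PL = pbD[OF L(3)]
    note [simp] = cfD[OF 1(1)] cfD[OF one'(1)] cfD[OF L(1)] homD[OF P(1)] homD[OF P'(1)] homD[OF PL(1)]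
    \<comment> \<open>As \<open>u' \<cdot> g'\<close> exceeds \<open>u \<cdot> g\<close> by
      \<open>q \<cdot> t\<close>, the same conflation \<open>L -> M1 -> K2\<close> is also the
      pullback along \<open>u' \<cdot> g'\<close>, with \<open>m2\<close> in place of
      \<open>m1\<close>.\<close>
    define m2 where "m2 = m1 \<oplus> t \<cdot> q1"
    have [simp]: "m2 \<in> Mor C" "Dom C m2 = M1" "Cod C m2 = M" by (auto simp: m2_def)
    have ug': "u' \<cdot> g' \<in> hom K2 N" by simp
    have m2l: "m2 \<cdot> l1 = l" using L(2) by (simp add: m2_def)
    have qm2: "q \<cdot> m2 = (u' \<cdot> g') \<cdot> q1"
      using PL(5) by (simp add: m2_def ut[symmetric])
    have pb2: "pb C M1 M K2 N m2 q1 q (u' \<cdot> g')"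
      by (rule pb_of_mor[OF L(1) ls(2) _ ug' m2l qm2]) simp
    note P2 = pbD[OF pb2]
    have x0: "(u \<cdot> g) \<cdot> p1 = q \<cdot> (\<alpha> \<cdot> a1)"
      using cmp_reduce[OF ls(7), of a1] P(5) by simp
    obtain x where x: "x \<in> hom A1 M1" "q1 \<cdot> x = p1" "m1 \<cdot> x = \<alpha> \<cdot> a1"
      using PL(6)[OF P(2) _ x0] by auto
    have x0': "(u' \<cdot> g') \<cdot> p1' = q \<cdot> (\<alpha>' \<cdot> a1')"
      using cmp_reduce[OF es'(7), of a1'] P'(5) by simp
    obtain x' where x': "x' \<in> hom A1' M1" "q1 \<cdot> x' = p1'" "m2 \<cdot> x' = \<alpha>' \<cdot> a1'"
      using P2(6)[OF P'(2) _ x0'] by auto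
    note [simp] = homD[OF x(1)] homD[OF x'(1)]
    have xi: "x \<cdot> i1 = l1 \<cdot> f"
      by (rule PL(7)[where T = K])
        (use x ls(6) cmp_reduce[OF x(2), of i1] cmp_reduce[OF x(3), of i1] cmp_reduce[OF L(2), of f]
          cmp_reduce[OF cfD(7)[OF L(1)], of f] 1(2) in auto)
    have xi': "x' \<cdot> i1' = l1 \<cdot> f'"
      by (rule P2(7)[where T = K'])
        (use x' es'(6) cmp_reduce[OF x'(2), of i1'] cmp_reduce[OF x'(3), of i1'] cmp_reduce[OF m2l, of f']
          cmp_reduce[OF cfD(7)[OF L(1)], of f'] one'(2) in auto)
    \<comment> \<open>All three conflations now end in \<open>K2\<close> with identities there,
      which is the case of length one.\<close>
    obtain K'' A'' i'' p'' h h' m m' where W: "cf C K'' A'' K2 i'' p''" "h \<in> hom K'' K" "h' \<in> hom K'' K'"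
      "f \<cdot> h = f' \<cdot> h'" "m \<in> hom A'' A1" "m' \<in> hom A'' A1'" "m \<cdot> i'' = i1 \<cdot> h" "m' \<cdot> i'' = i1' \<cdot> h'"
      "p1 \<cdot> m = p''" "p1' \<cdot> m' = p''"
      using conflation_weak_pullback[OF 1(1) one'(1) L(1) x(1) xi x(2) x'(1) xi' x'(2) Suc.prems(9,8)]
      by blast
    note [simp] = cfD[OF W(1)] homD[OF W(2)] homD[OF W(3)] homD[OF W(5)] homD[OF W(6)]
    have "cmor C h (idm X) ((i'', p'') # ds0) es" unfolding es
      by (rule cmor_ConsI[OF W(1) c(1), of "a1 \<cdot> m" g])
        (use W gb cmp_reduce[OF 1(2), of h] cmp_reduce[OF P(5), of m] in auto)
    moreover have "cmor C h' (idm X) ((i'', p'') # ds0) es'" unfolding es'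
      by (rule cmor_ConsI[OF W(1) es'(2), of "a1' \<cdot> m'" g'])
        (use W I(6) cmp_reduce[OF one'(2), of h'] cmp_reduce[OF P'(5), of m'] in auto)
    moreover have "chain C X K'' ((i'', p'') # ds0)" using W(1) I(4) by auto
    ultimately show ?thesis using W by blast
  qed
qed simp

section \<open>Roofs form an equivalence relation that respects pushforward\<close>

lemma rr_chain:
  assumes "rr C X Y cs ds" "cs \<noteq> []"
  obtains es where "chain C X Y es" "es \<noteq> []" "cmor C (idm Y) (idm X) es cs" "cmor C (idm Y) (idm X) es ds"
  using assms cmor_length by (fastforce simp: rr_def)

lemma rr_sym: "rr C X Y cs ds \<Longrightarrow> rr C X Y ds cs"
  by (auto simp: rr_def)

lemma rr_cmor: "chain C X Y cs \<Longrightarrow> cmor C (idm Y) (idm X) cs ds \<Longrightarrow> rr C X Y cs ds"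
  using cmor_refl by (auto simp: rr_def)

text \<open>Trades a common target for a common source. The identity of \<open>Y\<close> is a
  deflation with zero kernel, so \<open>chain_weak_pullback\<close> gives a chain over both that
  starts at some \<open>K\<close>; pushing it out along \<open>K -> Y\<close> restores the left
  end.\<close>

lemma rr_zigzag:
  assumes "cs \<noteq> []" "chain C X Y cs" "chain C X Y ds" "chain C X Y ls"
    "cmor C (idm Y) (idm X) cs ls" "cmor C (idm Y) (idm X) ds ls"
  shows "rr C X Y cs ds"
proof -
  have Y: "Y \<in> Ob C" "X \<in> Ob C" using chain_Ob[OF assms(2)] by auto
  obtain Z where Z: "zero_object C Z" by (rule zero_objectE)
  obtain K g g' es where K: "g \<in> hom K Y" "g' \<in> hom K Y" "idm Y \<cdot> g = idm Y \<cdot> g'" "chain C X K es"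
    "cmor C g (idm X) es cs" "cmor C g' (idm X) es ds"
    using chain_weak_pullback[OF refl assms(1-6) cf_zero_idm[OF Z Y(1)]] Y by auto
  note [simp] = homD[OF K(1)] homD[OF K(2)]
  have g: "g' = g" using K(3) by simp
  have "es \<noteq> []" using cmor_length[OF K(5)] assms(1) by auto
  from chain_pushout[OF K(4) this K(1)] obtain fs where fs: "chain C X Y fs"
    "\<And>y Y'' es'. y \<in> hom Y Y'' \<Longrightarrow> chain C X Y'' es' \<Longrightarrow> cmor C (y \<cdot> g) (idm X) es es' \<Longrightarrow> cmor C y (idm X) fs es'"
    by blast
  have "cmor C (idm Y) (idm X) fs cs" "cmor C (idm Y) (idm X) fs ds"
    by (rule fs(2)[OF _ assms(2)] fs(2)[OF _ assms(3)]; use K g Y in simp)+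
  then show ?thesis using fs(1) by (auto simp: rr_def)
qed

text \<open>Two consecutive roofs meet in the common target \<open>ds\<close>, which
  \<open>rr_zigzag\<close> replaces by a common source.\<close>

lemma rr_trans:
  assumes "rr C X Y cs ds" "rr C X Y ds es" "cs \<noteq> []" "chain C X Y cs" "chain C X Y ds" "chain C X Y es"
  shows "rr C X Y cs es"
proof -
  obtain fs where fs: "chain C X Y fs" "fs \<noteq> []" "cmor C (idm Y) (idm X) fs cs" "cmor C (idm Y) (idm X) fs ds"
    by (rule rr_chain[OF assms(1,3)])
  obtain gs where gs: "chain C X Y gs" "cmor C (idm Y) (idm X) gs ds" "cmor C (idm Y) (idm X) gs es"
    using assms(2) by (auto simp: rr_def)
  obtain hs where hs: "chain C X Y hs" "cmor C (idm Y) (idm X) hs fs" "cmor C (idm Y) (idm X) hs gs"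
    using rr_zigzag[OF fs(2,1) gs(1) assms(5) fs(4) gs(2)] by (auto simp: rr_def)
  have id: "idm Y \<in> hom Y Y" "idm Y \<cdot> idm Y = idm Y" using chain_Ob[OF fs(1)] by auto
  have "cmor C (idm Y) (idm X) hs cs" "cmor C (idm Y) (idm X) hs es"
    using cmor_comp_id[OF hs(1) fs(1) assms(4) id(1) id(1) hs(2) fs(3)]
      cmor_comp_id[OF hs(1) gs(1) assms(6) id(1) id(1) hs(3) gs(3)] id(2) by auto
  then show ?thesis using hs(1) by (auto simp: rr_def)
qed

lemma rr_pushout:
  assumes "cs \<noteq> []" "chain C X Y cs" "chain C X Y' ds" "chain C X Y' ds'" "a \<in> hom Y Y'"
    "cmor C a (idm X) cs ds" "cmor C a (idm X) cs ds'"
  shows "rr C X Y' ds ds'"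
proof -
  obtain fs where fs: "chain C X Y' fs"
    "\<And>y Y'' es'. y \<in> hom Y' Y'' \<Longrightarrow> chain C X Y'' es' \<Longrightarrow> cmor C (y \<cdot> a) (idm X) cs es' \<Longrightarrow> cmor C y (idm X) fs es'"
    using chain_pushout[OF assms(2,1,5)] by blast
  note [simp] = homD[OF assms(5)]
  have "cmor C (idm Y') (idm X) fs ds" "cmor C (idm Y') (idm X) fs ds'"
    by (rule fs(2)[OF _ assms(3)] fs(2)[OF _ assms(4)]; use assms(6,7) in simp)+
  then show ?thesis using fs(1) by (auto simp: rr_def)
qed

lemma rr_map:
  assumes "rr C X Y cs ds" "cs \<noteq> []" "chain C X Y cs" "chain C X Y ds"
    "chain C X Y' cs'" "chain C X Y' ds'" "a \<in> hom Y Y'"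
    "cmor C a (idm X) cs cs'" "cmor C a (idm X) ds ds'"
  shows "rr C X Y' cs' ds'"
proof -
  obtain es where es: "chain C X Y es" "es \<noteq> []" "cmor C (idm Y) (idm X) es cs" "cmor C (idm Y) (idm X) es ds"
    by (rule rr_chain[OF assms(1,2)])
  note [simp] = homD[OF assms(7)]
  have id: "idm Y \<in> hom Y Y" "a \<cdot> idm Y = a" by auto
  show ?thesis
    using rr_pushout[OF es(2,1) assms(5,6,7)] cmor_comp_id[OF es(1) assms(3,5) id(1) assms(7) es(3) assms(8)]
      cmor_comp_id[OF es(1) assms(4,6) id(1) assms(7) es(4) assms(9)] id(2) by simp
qed

section \<open>Vanishing of Ext, cancellation and dimension shift\<close>

lemma zero_chain_ex:
  assumes "zero_object C Z" "X \<in> Ob C" "0 < n"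
  shows "\<exists>z. chain C X Z z \<and> length z = n"
  using assms(3)
proof (induction n)
  case (Suc n)
  have Z: "Z \<in> Ob C" using assms(1) by (simp add: zero_object_def)
  show ?case
  proof (cases n)
    case 0
    then show ?thesis using cf_zero_idm[OF assms(1,2)] assms(2)
      by (intro exI[of _ "[(zer Z X, idm X)]"]) auto
  next
    case (Suc k)
    then obtain z where "chain C X Z z" "length z = n" using Suc.IH by auto
    then show ?thesis using cf_zero_idm[OF assms(1) Z]
      by (intro exI[of _ "(zer Z Z, idm Z) # z"]) auto
  qed
qed simp

text \<open>A representative-level form of triviality of the class of \<open>w\<close>: it receives
  a morphism from a chain that starts at zero. By vanishing, \<open>w\<close> is equivalent to the
  pushforward \<open>w0\<close> of a chain \<open>z\<close> at \<open>Z\<close>; the roof is pulled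
  back against \<open>z\<close> and then pushed out to \<open>Z\<close>.\<close>

lemma EZ_zero:
  assumes "EZ C n X W" "zero_object C Z" "0 < n" "chain C X W w" "length w = n"
  shows "\<exists>z. chain C X Z z \<and> cmor C (zer Z W) (idm X) z w"
proof -
  have ob: "X \<in> Ob C" "W \<in> Ob C" using chain_Ob[OF assms(4)] by auto
  have Z: "Z \<in> Ob C" using assms(2) by (simp add: zero_object_def)
  note [simp] = ob Z
  obtain z where z: "chain C X Z z" "length z = n" using zero_chain_ex[OF assms(2) ob(1) assms(3)] by blast
  have zn: "z \<noteq> []" "w \<noteq> []" using z assms by auto
  have zw: "zer Z W \<in> hom Z W" by simp
  obtain w0 where w0: "chain C X W w0" "length w0 = n" "cmor C (zer Z W) (idm X) z w0"
    using chain_pushout[OF z(1) zn(1) zw] z(2) by auto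
  have "rr C X W w w0" using assms w0 by (auto simp: EZ_def)
  from rr_chain[OF this zn(2)] obtain e where e: "chain C X W e" "e \<noteq> []"
    "cmor C (idm W) (idm X) e w" "cmor C (idm W) (idm X) e w0" by metis
  obtain K g g' ds where K: "g \<in> hom K W" "g' \<in> hom K Z" "idm W \<cdot> g = zer Z W \<cdot> g'" "chain C X K ds"
    "cmor C g (idm X) ds e" "cmor C g' (idm X) ds z"
    using chain_weak_pullback[OF refl e(2,1) z(1) w0(1) e(4) w0(3) cf_zero_idm[OF assms(2) ob(2)] zw]
    by blast
  note [simp] = homD[OF K(1)] homD[OF K(2)]
  have dn: "ds \<noteq> []" using cmor_length[OF K(5)] e(2) by auto
  obtain z2 where z2: "chain C X Z z2"
    "\<And>y Y'' es'. y \<in> hom Z Y'' \<Longrightarrow> chain C X Y'' es' \<Longrightarrow> cmor C (y \<cdot> g') (idm X) ds es' \<Longrightarrow> cmor C y (idm X) z2 es'"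
    using chain_pushout[OF K(4) dn K(2)] by blast
  have "cmor C (idm W \<cdot> g) (idm X) ds w"
    using cmor_comp_id[OF K(4) e(1) assms(4) K(1) _ K(5) e(3)] by simp
  then have "cmor C (zer Z W) (idm X) z2 w" using z2(2)[OF zw assms(4)] K(3) by simp
  then show ?thesis using z2(1) by blast
qed

text \<open>Replaces exactness of \<open>Ext^n(X, W) -> Ext^n(X, K) -> Ext^(n+1)(X, U)\<close>. A
  roof over the two splices starts with \<open>U -> A -> L\<close> and continues with
  \<open>l\<close>, and \<open>l\<close> has morphisms to \<open>cs\<close> and \<open>ds\<close>
  with left ends \<open>f\<close> and \<open>f'\<close>. These differ by \<open>p \<cdot> s\<close>
  with \<open>s : L -> W\<close>, and the pushforward of \<open>l\<close> along \<open>s\<close> is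
  trivial by hypothesis.\<close>

lemma splice_cancel:
  assumes "cf C U W K i p" "chain C X K cs" "chain C X K ds" "rr C X U ((i, p) # cs) ((i, p) # ds)"
    "EZ C (length cs) X W" "cs \<noteq> []"
  shows "rr C X K cs ds"
proof -
  obtain es where es: "chain C X U es" "cmor C (idm U) (idm X) es ((i, p) # cs)"
    "cmor C (idm U) (idm X) es ((i, p) # ds)" using assms(4) by (auto simp: rr_def)
  note [simp] = cfD[OF assms(1)]
  have ch: "chain C X U ((i, p) # cs)" "chain C X U ((i, p) # ds)" using assms(1-3) by auto
  obtain c r l A L m f where l: "es = (c, r) # l" "cf C U A L c r" "chain C X L l"
    "m \<in> hom A W" "f \<in> hom L K" "m \<cdot> c = i \<cdot> idm U" "p \<cdot> m = f \<cdot> r" "cmor C f (idm X) l cs"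
    using cmor_ConsE'[OF es(2) assms(1) es(1)] by metis
  obtain m' f' where l': "m' \<in> hom A W" "f' \<in> hom L K" "m' \<cdot> c = i \<cdot> idm U" "p \<cdot> m' = f' \<cdot> r"
    "cmor C f' (idm X) l ds"
    using es(3) unfolding l(1) by simp (metis cfD(4,6) l(2))
  note [simp] = cfD[OF l(2)] homD[OF l(4)] homD[OF l(5)] homD[OF l'(1)] homD[OF l'(2)]
  have "(m' \<oplus> neg m) \<cdot> c = zer U W" using l(6) l'(3) by simp
  then obtain s where s: "s \<in> hom L W" "s \<cdot> r = m' \<oplus> neg m"
    using cf_cokernel[OF l(2), of "m' \<oplus> neg m" W] by auto
  note [simp] = homD[OF s(1)]
  have f': "f \<oplus> p \<cdot> s = f'"
  proof (rule cf_epi[OF l(2), where T = K])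
    show "(f \<oplus> p \<cdot> s) \<cdot> r = f' \<cdot> r"
      using s(2) l(7) l'(4) add_left_comm[of "f \<cdot> r" "f' \<cdot> r" "neg (f \<cdot> r)"] by simp
  qed auto
  obtain S iK iW pK pW where S: "biproduct C K W S iK iW pK pW"
    using biprodE[OF cfD(10,9)[OF assms(1)]] by blast
  note [simp] = biproductD[OF S]
  note red = biproduct_reduce[OF S]
  \<comment> \<open>Treats \<open>f\<close> and \<open>s\<close> together: with \<open>b\<close> the
    pushforward of \<open>l\<close> along \<open>t\<close>, both given chains are images of
    \<open>b\<close>, one under \<open>pK\<close> and the other under
    \<open>pK \<oplus> p \<cdot> pW\<close>.\<close>
  define t where "t = iK \<cdot> f \<oplus> iW \<cdot> s"
  have t: "t \<in> hom L S" by (simp add: t_def)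
  note [simp] = homD[OF t]
  have ln: "l \<noteq> []" "length l = length cs" using cmor_length[OF l(8)] assms(6) by auto
  obtain b where b: "chain C X S b" "length b = length l" "cmor C t (idm X) l b"
    "\<And>y Y'' es'. y \<in> hom S Y'' \<Longrightarrow> chain C X Y'' es' \<Longrightarrow> cmor C (y \<cdot> t) (idm X) l es' \<Longrightarrow> cmor C y (idm X) b es'"
    using chain_pushout[OF l(3) ln(1) t] by blast
  have bn: "b \<noteq> []" using b(2) ln by auto
  have pW: "pW \<in> hom S W" by simp
  obtain w where w: "chain C X W w" "length w = length b" "cmor C pW (idm X) b w"
    using chain_pushout[OF b(1) bn pW] by blast
  obtain Z where Z: "zero_object C Z" "Z \<in> Ob C" by (rule zero_objectE)
  have "length w = length cs" "0 < length cs" using w(2) b(2) ln assms(6) by auto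
  from EZ_zero[OF assms(5) Z(1) this(2) w(1) this(1)]
  obtain z where z: "chain C X Z z" "cmor C (zer Z W) (idm X) z w" by blast
  have zw: "zer Z W \<in> hom Z W" using Z(2) by simp
  \<comment> \<open>The image of \<open>b\<close> under \<open>pW\<close> is trivial, so
    \<open>b\<close> comes from a chain \<open>a\<close> at \<open>K\<close> along
    \<open>iK\<close>, and after \<open>iK\<close> both maps to \<open>K\<close> are the
    identity.\<close>
  obtain K2 h h' a2 where h: "h \<in> hom K2 S" "h' \<in> hom K2 Z" "pW \<cdot> h = zer Z W \<cdot> h'" "chain C X K2 a2"
    "cmor C h (idm X) a2 b"
    using chain_weak_pullback[OF refl bn b(1) z(1) w(1) w(3) z(2) cf_biproduct[OF S] zw] by blast
  note [simp] = homD[OF h(1)] homD[OF h(2)] Z(2)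
  have hh: "h = iK \<cdot> (pK \<cdot> h)" using biproduct_decompose[OF S h(1)] h(3) by simp
  have a2n: "a2 \<noteq> []" using cmor_length[OF h(5)] bn by auto
  have ph: "pK \<cdot> h \<in> hom K2 K" by simp
  obtain a where a: "chain C X K a"
    "\<And>y Y'' es'. y \<in> hom K Y'' \<Longrightarrow> chain C X Y'' es' \<Longrightarrow> cmor C (y \<cdot> (pK \<cdot> h)) (idm X) a2 es' \<Longrightarrow> cmor C y (idm X) a es'"
    using chain_pushout[OF h(4) a2n ph] by blast
  have iK: "iK \<in> hom K S" by simp
  have ab: "cmor C iK (idm X) a b" using a(2)[OF iK b(1)] h(5) hh by simp
  have "pK \<cdot> t = f" by (simp add: t_def red)
  then have 1: "cmor C pK (idm X) b cs" using b(4)[OF _ assms(2)] l(8) by simp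
  have "(pK \<oplus> p \<cdot> pW) \<cdot> t = f'" using f' by (simp add: t_def red)
  then have 2: "cmor C (pK \<oplus> p \<cdot> pW) (idm X) b ds" using b(4)[OF _ assms(3), of "pK \<oplus> p \<cdot> pW"] l'(5) by simp
  have "cmor C (pK \<cdot> iK) (idm X) a cs" "cmor C ((pK \<oplus> p \<cdot> pW) \<cdot> iK) (idm X) a ds"
    using cmor_comp_id[OF a(1) b(1) assms(2) iK _ ab 1] cmor_comp_id[OF a(1) b(1) assms(3) iK _ ab 2] by auto
  then show ?thesis using a(1) by (auto simp: rr_def)
qed

lemma chain_dualc: "chain C X Y cs \<Longrightarrow> chain (opp C) Y X (dualc cs)"
proof (induction cs arbitrary: Y)
  case (Cons c cs)
  obtain A K where c: "cf C Y A K (fst c) (snd c)" "chain C X K cs" using Cons.prems by auto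
  then show ?case
    using Cons.IH[OF c(2)] exc.chain_append[OF opp, of Y X "dualc cs" "[prod.swap c]"]
      exc.chain_single[OF opp, of Y K "prod.swap c"] by auto
qed simp

lemma cmor_dualc:
  "cmor C a b cs ds \<Longrightarrow> chain C X Y cs \<Longrightarrow> chain C X' Y' ds \<Longrightarrow> a \<in> hom Y Y' \<Longrightarrow>
    cmor (opp C) b a (dualc ds) (dualc cs)"
proof (induction cs arbitrary: a Y Y' ds)
  case Nil
  then show ?case using cmor_length[OF Nil(1)] by simp
next
  case (Cons c cs)
  obtain i p where c: "c = (i, p)" by (cases c)
  obtain A K where 1: "cf C Y A K i p" "chain C X K cs" using Cons.prems(2) c by auto
  obtain i' p' ds' A' K' m k where d: "ds = (i', p') # ds'" "cf C Y' A' K' i' p'" "chain C X' K' ds'"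
    "m \<in> hom A A'" "k \<in> hom K K'" "m \<cdot> i = i' \<cdot> a" "p' \<cdot> m = k \<cdot> p" "cmor C k b cs ds'"
    using cmor_ConsE[OF Cons.prems(1)[unfolded c] 1(1) Cons.prems(3)] by metis
  note [simp] = cfD[OF 1(1)] cfD[OF d(2)]
  have "cmor (opp C) b k (dualc ds') (dualc cs)" by (rule Cons.IH[OF d(8) 1(2) d(3,5)])
  moreover have "cmor (opp C) k a [(p', i')] [(p, i)]" using d Cons.prems(4) by auto
  ultimately show ?case
    using cmor_append[of "dualc ds'" "dualc cs" "opp C" b a "[(p', i')]" "[(p, i)]"]
      cmor_length[OF d(8)] by (auto simp: c d(1))
qed

text \<open>Reversal turns the common source into a common target, which \<open>rr_zigzag\<close>
  repairs in the opposite category.\<close>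

lemma rr_dualc:
  assumes "rr C X Y cs ds" "cs \<noteq> []" "chain C X Y cs" "chain C X Y ds"
  shows "rr (opp C) Y X (dualc cs) (dualc ds)"
proof -
  obtain es where es: "chain C X Y es" "cmor C (idm Y) (idm X) es cs" "cmor C (idm Y) (idm X) es ds"
    using assms(1) by (auto simp: rr_def)
  have id: "idm Y \<in> hom Y Y" using chain_Ob[OF es(1)] by simp
  show ?thesis
    using exc.rr_zigzag[OF opp, of "dualc cs" Y X "dualc ds" "dualc es"] assms
      chain_dualc cmor_dualc[OF es(2,1) assms(3) id] cmor_dualc[OF es(3,1) assms(4) id] es(1) by simp
qed

lemma terms_dualc: "chain C X Y cs \<Longrightarrow> terms (opp C) (dualc cs) = terms C cs"
  by (induction cs arbitrary: Y) (auto dest: cfD)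

lemma chain_opp_iff: "chain (opp C) Y X (dualc cs) \<longleftrightarrow> chain C X Y cs"
  using chain_dualc exc.chain_dualc[OF opp, of Y X "dualc cs"] by auto

lemma EZ_opp:
  assumes "0 < n" "EZ C n X Y"
  shows "EZ (opp C) n Y X"
  unfolding EZ_def
proof (intro allI impI)
  fix cs ds assume *: "chain (opp C) Y X cs" "chain (opp C) Y X ds" "length cs = n" "length ds = n"
  have c: "chain C X Y (dualc cs)" "chain C X Y (dualc ds)"
    using * chain_opp_iff[of Y X "dualc cs"] chain_opp_iff[of Y X "dualc ds"] by auto
  then have "rr C X Y (dualc cs) (dualc ds)" using assms * by (auto simp: EZ_def)
  from rr_dualc[OF this _ c] show "rr (opp C) Y X cs ds" using assms * by auto
qed

lemma EZ_opp_iff: "0 < n \<Longrightarrow> EZ (opp C) n Y X \<longleftrightarrow> EZ C n X Y"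
  using EZ_opp exc.EZ_opp[OF opp, of n Y X] by auto

lemma rr_Cons:
  assumes "rr C X K cs ds" "cf C Y A K i p"
  shows "rr C X Y ((i, p) # cs) ((i, p) # ds)"
proof -
  obtain es where es: "chain C X K es" "cmor C (idm K) (idm X) es cs" "cmor C (idm K) (idm X) es ds"
    using assms by (auto simp: rr_def)
  note [simp] = cfD[OF assms(2)]
  have "cmor C (idm Y) (idm X) ((i, p) # es) ((i, p) # xs)" if "cmor C (idm K) (idm X) es xs" for xs
    by (rule cmor_ConsI[OF assms(2) assms(2), of "idm A" "idm K"]) (use that in auto)
  moreover have "chain C X Y ((i, p) # es)" using es(1) assms(2) by auto
  ultimately show ?thesis using es(2,3) unfolding rr_def by blast
qed

text \<open>Splicing with \<open>(i, p)\<close> lands in degree \<open>n + 1\<close>, where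
  everything is equivalent; \<open>splice_cancel\<close> then removes the conflation again.\<close>

lemma EZ_shift:
  assumes "cf C U W K i p" "EZ C (Suc n) X U" "EZ C n X W" "0 < n"
  shows "EZ C n X K"
  unfolding EZ_def
proof (intro allI impI)
  fix cs ds assume *: "chain C X K cs" "chain C X K ds" "length cs = n" "length ds = n"
  have "chain C X U ((i, p) # cs)" "chain C X U ((i, p) # ds)" using * assms(1) by auto
  then have "rr C X U ((i, p) # cs) ((i, p) # ds)" using assms(2) * by (simp add: EZ_def)
  from splice_cancel[OF assms(1) *(1,2) this] show "rr C X K cs ds" using assms * by auto
qed

lemma EZ_shift_dual:
  assumes "cf C K W U i p" "EZ C (Suc n) U X" "EZ C n W X" "0 < n"
  shows "EZ C n K X"
  using exc.EZ_shift[OF opp, of U W K p i n X] assms by (simp add: EZ_opp_iff)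

text \<open>Each conflation of \<open>y\<close> is cancelled at the price of one vanishing Ext
  group, in the degree given by the number of conflations still to its right.\<close>

lemma splice_cancel_iter:
  assumes "chain C K U y" "chain C X K cs" "chain C X K ds" "length cs = length ds" "cs \<noteq> []"
    "rr C X U (y @ cs) (y @ ds)"
    "\<And>T n. T \<in> terms C y \<Longrightarrow> length cs \<le> n \<Longrightarrow> n < length cs + length y \<Longrightarrow> EZ C n X T"
  shows "rr C X K cs ds"
  using assms(1,6,7)
proof (induction y arbitrary: U)
  case (Cons c y)
  obtain i p where c: "c = (i, p)" by (cases c)
  obtain A L where 1: "cf C U A L i p" "chain C K L y" using Cons.prems(1) c by auto
  note [simp] = cfD[OF 1(1)]
  have ch: "chain C X L (y @ cs)" "chain C X L (y @ ds)" using 1(2) assms(2,3) chain_append by auto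
  have "EZ C (length (y @ cs)) X A" by (rule Cons.prems(3)) (auto simp: c)
  moreover have "rr C X U ((i, p) # (y @ cs)) ((i, p) # (y @ ds))" using Cons.prems(2) c by simp
  ultimately have "rr C X L (y @ cs) (y @ ds)" using splice_cancel[OF 1(1) ch] assms(5) by simp
  then show ?case using Cons.IH[OF 1(2)] Cons.prems(3) by simp
qed simp

lemma splice_cancel_iter_dual:
  assumes "chain C X K z" "chain C K U cs" "chain C K U ds" "length cs = length ds" "cs \<noteq> []"
    "rr C X U (cs @ z) (ds @ z)"
    "\<And>T n. T \<in> terms C z \<Longrightarrow> length cs \<le> n \<Longrightarrow> n < length cs + length z \<Longrightarrow> EZ C n T U"
  shows "rr C K U cs ds"
proof -
  have ch: "chain C X U (cs @ z)" "chain C X U (ds @ z)" using assms(1-3) chain_append by auto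
  have r: "rr (opp C) U X (dualc z @ dualc cs) (dualc z @ dualc ds)"
    using rr_dualc[OF assms(6) _ ch] assms(5) by simp
  have e: "EZ (opp C) n U T" if "T \<in> terms (opp C) (dualc z)" "length (dualc cs) \<le> n"
    "n < length (dualc cs) + length (dualc z)" for T n
  proof -
    have "0 < n" using that(2) assms(5) by (cases cs) auto
    then show ?thesis using that assms(7) EZ_opp terms_dualc[OF assms(1)] by simp
  qed
  have "rr (opp C) U K (dualc cs) (dualc ds)"
    by (rule exc.splice_cancel_iter[OF opp, of K X "dualc z" U "dualc cs" "dualc ds"])
      (use chain_dualc assms(1-5) r e in simp_all)
  then show ?thesis
    using exc.rr_dualc[OF opp, of U K "dualc cs" "dualc ds"] assms(2,3,5) chain_dualc by simp
qed

section \<open>Chains of length one and chains that split at the left end\<close>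

lemma cmor_single_id:
  assumes "cf C Y A X i p" "cf C Y A' X i' p'" "cmor C (idm Y) (idm X) [(i, p)] [(i', p')]"
  shows "\<exists>m. iso_mor C A A' m \<and> m \<cdot> i = i' \<and> p' \<cdot> m = p"
proof -
  note [simp] = cfD[OF assms(1)] cfD[OF assms(2)]
  obtain m where m: "m \<in> hom A A'" "m \<cdot> i = i'" "p' \<cdot> m = p" using assms(3) by auto
  then show ?thesis using short_five[OF assms(1,2)] by blast
qed

lemma cmor_single_idI:
  assumes "cf C Y A X i p" "cf C Y A' X i' p'" "m \<in> hom A A'" "m \<cdot> i = i'" "p' \<cdot> m = p"
  shows "cmor C (idm Y) (idm X) [(i, p)] [(i', p')]"
proof -
  note [simp] = cfD[OF assms(1)] cfD[OF assms(2)]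
  show ?thesis using assms(3-5) by auto
qed

text \<open>In length one both legs of the roof are isomorphisms by \<open>short_five\<close>, so
  one of them can be inverted.\<close>

lemma rr_single:
  assumes "cf C Y A X i p" "cf C Y A' X i' p'" "rr C X Y [(i, p)] [(i', p')]"
  shows "\<exists>m. iso_mor C A A' m \<and> m \<cdot> i = i' \<and> p' \<cdot> m = p"
proof -
  note [simp] = cfD[OF assms(1)] cfD[OF assms(2)]
  obtain es where es: "chain C X Y es" "cmor C (idm Y) (idm X) es [(i, p)]"
    "cmor C (idm Y) (idm X) es [(i', p')]" using assms(3) by (auto simp: rr_def)
  obtain j q where e: "es = [(j, q)]" using cmor_length[OF es(2)] by (cases es) auto
  obtain B where B: "cf C Y B X j q" using es(1) e cfD by auto
  note [simp] = cfD[OF B]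
  obtain m where m: "iso_mor C B A m" "m \<cdot> j = i" "p \<cdot> m = q"
    using cmor_single_id[OF B assms(1)] es(2) e by auto
  obtain m' where m': "iso_mor C B A' m'" "m' \<cdot> j = i'" "p' \<cdot> m' = q"
    using cmor_single_id[OF B assms(2)] es(3) e by auto
  obtain n where n: "m \<in> hom B A" "n \<in> hom A B" "n \<cdot> m = idm B" "m \<cdot> n = idm A" using m(1) by (rule iso_morE)
  have m'h: "m' \<in> hom B A'" using m'(1) by (simp add: iso_mor_def)
  note [simp] = homD[OF n(1)] homD[OF n(2)] homD[OF m'h]
  have "n \<cdot> i = j" using cmp_reduce[OF n(3), of j] m(2) by simp
  then have 1: "(m' \<cdot> n) \<cdot> i = i'" using m'(2) by simp
  have "q \<cdot> n = p" using cmp_reduce[OF m(3), of n] n(4) by simp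
  then have 2: "p' \<cdot> (m' \<cdot> n) = p" using cmp_reduce[OF m'(3), of n] by simp
  have "iso_mor C A A' (m' \<cdot> n)" by (rule short_five[OF assms(1,2) _ 1 2]) simp
  then show ?thesis using 1 2 by blast
qed

text \<open>The conflation is compared with the one given by the biproduct.\<close>

lemma EZ_split:
  assumes "EZ C 1 X Y" "cf C Y A X i p"
  shows "\<exists>r \<in> hom A Y. r \<cdot> i = idm Y"
proof -
  note [simp] = cfD[OF assms(2)]
  obtain S iY iX pY pX where S: "biproduct C Y X S iY iX pY pX"
    using biprodE[OF cfD(8,10)[OF assms(2)]] by blast
  note [simp] = biproductD[OF S]
  have "chain C X Y [(i, p)]" "chain C X Y [(iY, pX)]"
    using assms(2) cf_biproduct[OF S] by auto
  then have "rr C X Y [(i, p)] [(iY, pX)]" using assms(1) by (simp add: EZ_def del: chain.simps)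
  then obtain m where m: "iso_mor C A S m" "m \<cdot> i = iY" using rr_single[OF assms(2) cf_biproduct[OF S]] by blast
  have "m \<in> hom A S" using m by (simp add: iso_mor_def)
  note [simp] = homD[OF this]
  show ?thesis using m(2) by (intro bexI[of _ "pY \<cdot> m"]) auto
qed

text \<open>Pushing out along \<open>g\<close> gives a conflation that splits. The hypothesis is
  phrased by splitting rather than by \<open>EZ\<close>, so that it can be used inside
  subcategories.\<close>

lemma EZ_extend:
  assumes "\<And>B j q. cf C Y B X j q \<Longrightarrow> \<exists>r \<in> hom B Y. r \<cdot> j = idm Y" "cf C A B X i p" "g \<in> hom A Y"
  shows "\<exists>h \<in> hom B Y. h \<cdot> i = g"
proof -
  note [simp] = cfD[OF assms(2)] homD[OF assms(3)]
  obtain B' i' p' f' where P: "cf C Y B' X i' p'" "po C A B Y B' i g i' f'"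
    using pushout[OF assms(2,3)] by blast
  note Q = poD[OF P(2)]
  note [simp] = cfD[OF P(1)] homD[OF Q(4)]
  obtain r where r: "r \<in> hom B' Y" "r \<cdot> i' = idm Y" using assms(1)[OF P(1)] by blast
  note [simp] = homD[OF r(1)]
  have "(r \<cdot> f') \<cdot> i = g" using Q(5) cmp_reduce[OF r(2), of g] by simp
  then show ?thesis by (intro bexI[of _ "r \<cdot> f'"]) auto
qed

lemma split_to_zero:
  assumes "cf C W P K i p" "r \<in> hom P W" "r \<cdot> i = idm W" "chain C V K k" "k \<noteq> []" "zero_object C Z"
  shows "\<exists>k0. chain C V Z k0 \<and> length k0 = length k \<and>
    chain C V W ((idm W, zer W Z) # k0) \<and> cmor C (idm W) (idm V) ((i, p) # k) ((idm W, zer W Z) # k0)"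
proof -
  note [simp] = cfD[OF assms(1)] homD[OF assms(2)]
  have Z: "Z \<in> Ob C" using assms(6) by (simp add: zero_object_def)
  have z: "zer K Z \<in> hom K Z" using Z by simp
  obtain k0 where k0: "chain C V Z k0" "length k0 = length k" "cmor C (zer K Z) (idm V) k k0"
    using chain_pushout[OF assms(4,5) z] by blast
  have c: "cf C W W Z (idm W) (zer W Z)" using cf_idm_zero[OF assms(6)] by simp
  have "cmor C (idm W) (idm V) ((i, p) # k) ((idm W, zer W Z) # k0)"
    by (rule cmor_ConsI[OF assms(1) c, of r "zer K Z"]) (use assms k0 Z in auto)
  then show ?thesis using k0 c by auto
qed

text \<open>By \<open>split_to_zero\<close> either chain maps to one that begins with
  \<open>W = W -> 0\<close>. The remainders start at \<open>Z\<close> and are equivalent by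
  vanishing.\<close>

lemma split_splice_rr:
  assumes "cf C W P K i p" "r \<in> hom P W" "r \<cdot> i = idm W" "chain C V K k" "k \<noteq> []"
    "cf C W P' K' i' p'" "r' \<in> hom P' W" "r' \<cdot> i' = idm W" "chain C V K' k'" "length k' = length k"
    "zero_object C Z" "EZ C (length k) V Z"
  shows "rr C V W ((i, p) # k) ((i', p') # k')"
proof -
  obtain k0 where k0: "chain C V Z k0" "length k0 = length k" "chain C V W ((idm W, zer W Z) # k0)"
    "cmor C (idm W) (idm V) ((i, p) # k) ((idm W, zer W Z) # k0)"
    using split_to_zero[OF assms(1-5,11)] by blast
  have k': "k' \<noteq> []" using assms(5,10) by auto
  obtain k1 where k1: "chain C V Z k1" "length k1 = length k'" "chain C V W ((idm W, zer W Z) # k1)"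
    "cmor C (idm W) (idm V) ((i', p') # k') ((idm W, zer W Z) # k1)"
    using split_to_zero[OF assms(6-9) k' assms(11)] by blast
  have W: "W \<in> Ob C" using cfD[OF assms(1)] by simp
  have "rr C V Z k0 k1" using assms(10,12) k0 k1 by (auto simp: EZ_def)
  from rr_Cons[OF this cf_idm_zero[OF assms(11) W]]
  have 1: "rr C V W ((idm W, zer W Z) # k0) ((idm W, zer W Z) # k1)" .
  have c: "chain C V W ((i, p) # k)" "chain C V W ((i', p') # k')" using assms by auto
  have 2: "rr C V W ((i, p) # k) ((idm W, zer W Z) # k0)" by (rule rr_cmor[OF c(1) k0(4)])
  have 3: "rr C V W ((idm W, zer W Z) # k1) ((i', p') # k')" by (rule rr_sym[OF rr_cmor[OF c(2) k1(4)]])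
  show ?thesis
    by (rule rr_trans[OF rr_trans[OF 2 1 _ c(1) k0(3) k1(3)] 3 _ c(1) k1(3) c(2)]) auto
qed

end

section \<open>Rigid and extension closed subcategories\<close>

text \<open>\<open>up C U k\<close> is the subcategory \<open>U\<^sup>k\<^sup>+\<^sup>1(C)\<close>, and \<open>up (opp C) U k\<close> is \<open>U\<^sub>k\<^sub>+\<^sub>1(C)\<close>.\<close>

fun up :: "('o, 'm) excat \<Rightarrow> 'o set \<Rightarrow> nat \<Rightarrow> 'o \<Rightarrow> bool" where
  "up C U 0 A \<longleftrightarrow> A \<in> U"
| "up C U (Suc k) A \<longleftrightarrow> (\<exists>V B i p. V \<in> U \<and> cf C A V B i p \<and> up C U k B)"

locale exc_sub = exc C for C :: "('o, 'm) excat" (structure) +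
  fixes U :: "'o set"
  assumes subU: "subcategory C U"
begin

lemma opp_sub: "exc_sub (opp C) U"
  using opp subU by (simp add: exc_sub_def exc_sub_axioms_def)

lemma U_Ob: "A \<in> U \<Longrightarrow> A \<in> Ob C"
  using subU unfolding subcategory_def by blast

lemma U_iso: "A \<in> U \<Longrightarrow> iso_mor C A B f \<Longrightarrow> B \<in> U"
  using subU unfolding subcategory_def isomorphic_def by blast

lemma U_zero: "zero_object C Z \<Longrightarrow> Z \<in> U"
  using subU unfolding subcategory_def by blast

lemma U_biproduct: "A \<in> U \<Longrightarrow> B \<in> U \<Longrightarrow> biproduct C A B S iA iB pA pB \<Longrightarrow> S \<in> U"
  using subU unfolding subcategory_def direct_sum_def by blast

lemma up_Ob: "up C U k A \<Longrightarrow> A \<in> Ob C"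
  by (cases k) (auto simp: U_Ob dest: cfD)

lemma up_iso:
  assumes "up C U k A" "iso_mor C A B f"
  shows "up C U k B"
proof (cases k)
  case 0
  then show ?thesis using assms U_iso by auto
next
  case (Suc l)
  obtain V D i p where V: "V \<in> U" "cf C A V D i p" "up C U l D" using assms(1) Suc by auto
  obtain g where g: "iso_mor C B A g" using iso_morE[OF assms(2)] by blast
  note [simp] = cfD[OF V(2)]
  have "cf C B V D (i \<cdot> g) p" using cf_iso_ends[OF V(2) g iso_idm] by simp
  then show ?thesis using V Suc by auto
qed

lemma up_Suc: "up C U k A \<Longrightarrow> up C U (Suc k) A"
proof (induction k arbitrary: A)
  case 0
  obtain Z where Z: "zero_object C Z" by (rule zero_objectE)
  have "cf C A A Z (idm A) (zer A Z)" using cf_idm_zero[OF Z] U_Ob 0 by simp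
  then show ?case using 0 U_zero[OF Z] by auto
next
  case (Suc k)
  then obtain V B i p where "V \<in> U" "cf C A V B i p" "up C U k B" by auto
  then show ?case using Suc.IH[of B] by (subst up.simps) blast
qed

lemma up_mono: "up C U k A \<Longrightarrow> k \<le> l \<Longrightarrow> up C U l A"
  by (induction l) (auto simp: le_Suc_eq intro: up_Suc simp del: up.simps)

text \<open>The last term of the coresolution is the right end \<open>V\<close> of the chain, so
  \<open>k + 1\<close> terms make a chain of length \<open>k\<close>.\<close>

lemma up_chain:
  "up C U k A \<longleftrightarrow> (\<exists>V \<in> U. \<exists>cs. chain C V A cs \<and> length cs = k \<and> terms C cs \<subseteq> U)"
proof (induction k arbitrary: A)
  case 0
  then show ?case using U_Ob by auto
next
  case (Suc k)
  show ?case
  proof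
    assume "up C U (Suc k) A"
    then obtain V B i p where V: "V \<in> U" "cf C A V B i p" "up C U k B" by auto
    then obtain V' cs where "V' \<in> U" "chain C V' B cs" "length cs = k" "terms C cs \<subseteq> U" using Suc.IH by blast
    then show "\<exists>V \<in> U. \<exists>cs. chain C V A cs \<and> length cs = Suc k \<and> terms C cs \<subseteq> U"
      using V cfD[OF V(2)] by (intro bexI[of _ V'] exI[of _ "(i, p) # cs"]) auto
  next
    assume "\<exists>V \<in> U. \<exists>cs. chain C V A cs \<and> length cs = Suc k \<and> terms C cs \<subseteq> U"
    then obtain V cs where cs: "V \<in> U" "chain C V A cs" "length cs = Suc k" "terms C cs \<subseteq> U" by blast
    then obtain i p cs' where c: "cs = (i, p) # cs'" by (cases cs) auto
    then have "cf C A (Cod C i) (Cod C p) i p" "chain C V (Cod C p) cs'" using cs(2) chain_Cons by auto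
    then show "up C U (Suc k) A" using cs c Suc.IH[of "Cod C p"] by auto
  qed
qed

text \<open>Mapping cone of a morphism of chains, with the contractible summands at both ends removed.\<close>

lemma up_of_cmor:
  assumes "cf C Y Q Z i p" "chain C V Z z" "terms C z \<subseteq> U" "chain C V Y w" "terms C w \<subseteq> U"
    "cmor C (idm Y) (idm V) ((i, p) # z) w"
  shows "up C U (length z) Q"
  using assms
proof (induction z arbitrary: Y Q Z i p w)
  case Nil
  then have Z: "Z = V" by simp
  have "length w = 1" using cmor_length[OF Nil(6)] by simp
  then obtain i' p' where w: "w = [(i', p')]" by (cases w) auto
  obtain A' where d: "cf C Y A' V i' p'" using Nil(4) w chain_single[of V Y "(i', p')"] by auto
  obtain m where "iso_mor C Q A' m"
    using cmor_single_id[OF Nil(1)[unfolded Z] d] Nil(6) w by auto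
  then obtain m' where "iso_mor C A' Q m'" by (rule iso_morE)
  moreover have "A' \<in> U" using Nil(5) w cfD[OF d] by auto
  ultimately have "Q \<in> U" using U_iso by blast
  then show ?case by simp
next
  case (Cons c z)
  obtain j q where c: "c = (j, q)" by (cases c)
  obtain V1 Z1 where z: "cf C Z V1 Z1 j q" "chain C V Z1 z" using Cons.prems(2) c by auto
  obtain i' p' w' W K m f where w: "w = (i', p') # w'" "cf C Y W K i' p'" "chain C V K w'"
    "m \<in> hom Q W" "f \<in> hom Z K" "m \<cdot> i = i' \<cdot> idm Y" "p' \<cdot> m = f \<cdot> p" "cmor C f (idm V) (c # z) w'"
    using cmor_ConsE[OF Cons.prems(6,1,4)] by metis
  obtain j' q' w'' W1 K1 m1 f1 where w': "w' = (j', q') # w''" "cf C K W1 K1 j' q'" "chain C V K1 w''"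
    "m1 \<in> hom V1 W1" "f1 \<in> hom Z1 K1" "m1 \<cdot> j = j' \<cdot> f" "q' \<cdot> m1 = f1 \<cdot> q" "cmor C f1 (idm V) z w''"
    using cmor_ConsE[OF w(8)[unfolded c] z(1) w(3)] by metis
  note [simp] = cfD[OF Cons.prems(1)] cfD[OF z(1)] cfD[OF w(2)] cfD[OF w'(2)] homD[OF w(4)] homD[OF w(5)]
    homD[OF w'(4)] homD[OF w'(5)]
  have U: "V1 \<in> U" "W \<in> U" using Cons.prems(3,5) c w(1) by auto
  have pb: "pb C Q W Z K m p p' f" by (rule pb_of_mor[OF Cons.prems(1) w(2,4,5)]) (use w in auto)
  obtain S iZ iW pZ pW where S: "biproduct C Z W S iZ iW pZ pW"
    using biprodE[OF cfD(10)[OF Cons.prems(1)] cfD(9)[OF w(2)]] by blast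
  \<comment> \<open>The square over \<open>f\<close> is a pullback, whence a conflation from
    \<open>Q\<close> to the sum \<open>S\<close> of \<open>Z\<close> and \<open>W\<close> with
    quotient \<open>K\<close>. Enlarging \<open>Z\<close> to \<open>V1\<close> puts the middle term
    into \<open>U\<close> and makes the quotient an extension \<open>R\<close> of \<open>Z1\<close>
    by \<open>K\<close>.\<close>
  note c1 = cf_of_pb[OF w(2) pb S]
  obtain S' j2 q2 l s r t where T: "cf C S S' Z1 j2 q2" "biproduct C V1 W S' l s r t" "j2 \<cdot> iZ = l \<cdot> j"
    "q2 \<cdot> l = q" and po: "po C Z V1 S S' j iZ j2 l"
    using cf_add_summand[OF z(1) S] by metis
  note [simp] = biproductD[OF S] cfD[OF T(1)] biproductD[OF T(2)]
  have S'U: "S' \<in> U" using U_biproduct[OF U T(2)] .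
  obtain R rr0 u v where N: "cf C Q S' R (j2 \<cdot> (iZ \<cdot> p \<oplus> neg (iW \<cdot> m))) rr0" "cf C K R Z1 u v"
    "u \<cdot> (f \<cdot> pZ \<oplus> p' \<cdot> pW) = rr0 \<cdot> j2" "v \<cdot> rr0 = q2"
    using noether[OF c1 T(1)] by metis
  note [simp] = cfD[OF N(1)] cfD[OF N(2)]
  \<comment> \<open>The map \<open>x\<close> is induced by the map \<open>y\<close> on
    \<open>S'\<close> that is \<open>m1\<close> on \<open>V1\<close> and, on \<open>S\<close>, the
    deflation to \<open>K\<close> followed by \<open>j'\<close>. With it, \<open>(u, v) # z\<close>
    maps to \<open>w'\<close> with identity ends, as the induction hypothesis demands.\<close>
  obtain x where x: "x \<in> hom R W1" "x \<cdot> u = j'" "q' \<cdot> x = f1 \<cdot> v"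
  proof -
    have e: "(j' \<cdot> (f \<cdot> pZ \<oplus> p' \<cdot> pW)) \<cdot> iZ = m1 \<cdot> j" using w'(6) by simp
    obtain y where y: "y \<in> hom S' W1" "y \<cdot> j2 = j' \<cdot> (f \<cdot> pZ \<oplus> p' \<cdot> pW)" "y \<cdot> l = m1"
      using poD(6)[OF po _ w'(4) e] by auto
    note [simp] = homD[OF y(1)]
    have "(f \<cdot> pZ \<oplus> p' \<cdot> pW) \<cdot> (iZ \<cdot> p \<oplus> neg (iW \<cdot> m)) = zer Q K" using cfD(7)[OF c1] .
    then have "y \<cdot> (j2 \<cdot> (iZ \<cdot> p \<oplus> neg (iW \<cdot> m))) = zer Q W1"
      using cmp_reduce[OF y(2), of "iZ \<cdot> p \<oplus> neg (iW \<cdot> m)"]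
        cmp_assoc[of "iZ \<cdot> p \<oplus> neg (iW \<cdot> m)" "f \<cdot> pZ \<oplus> p' \<cdot> pW" j'] by (simp del: cmp_assoc cmp_add)
    then obtain x where x: "x \<in> hom R W1" "x \<cdot> rr0 = y" using cf_cokernel[OF N(1) y(1)] by auto
    note [simp] = homD[OF x(1)]
    have "x \<cdot> u = j'"
    proof (rule cf_epi[OF c1, where T = W1])
      have "(x \<cdot> u) \<cdot> (f \<cdot> pZ \<oplus> p' \<cdot> pW) = x \<cdot> (rr0 \<cdot> j2)"
        unfolding N(3)[symmetric] by (rule cmp_assoc) auto
      then show "(x \<cdot> u) \<cdot> (f \<cdot> pZ \<oplus> p' \<cdot> pW) = j' \<cdot> (f \<cdot> pZ \<oplus> p' \<cdot> pW)"
        using cmp_reduce[OF x(2), of j2] y(2) by simp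
    qed auto
    moreover have "q' \<cdot> x = f1 \<cdot> v"
    proof (rule cf_epi[OF N(1), where T = K1])
      show "(q' \<cdot> x) \<cdot> rr0 = (f1 \<cdot> v) \<cdot> rr0"
      proof (rule poD(7)[OF po, where T = K1])
        have "q' \<cdot> (y \<cdot> j2) = zer S K1"
          using y(2) cmp_reduce[OF cfD(7)[OF w'(2)], of "f \<cdot> pZ \<oplus> p' \<cdot> pW"] by (simp del: cmp_add)
        then show "((q' \<cdot> x) \<cdot> rr0) \<cdot> j2 = ((f1 \<cdot> v) \<cdot> rr0) \<cdot> j2"
          using x(2) N(4) cmp_reduce[OF x(2), of j2] cmp_reduce[OF N(4), of j2] by simp
        show "((q' \<cdot> x) \<cdot> rr0) \<cdot> l = ((f1 \<cdot> v) \<cdot> rr0) \<cdot> l"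
          using w'(7) T(4) y(3) cmp_reduce[OF x(2), of l] cmp_reduce[OF N(4), of l] by simp
      qed auto
    qed auto
    ultimately show ?thesis using that x(1) by blast
  qed
  have M: "cmor C (idm K) (idm V) ((u, v) # z) w'" unfolding w'(1)
    by (rule cmor_ConsI[OF N(2) w'(2) x(1) w'(5)]) (use x w'(8) in auto)
  have "up C U (length z) R"
    by (rule Cons.IH[OF N(2) z(2) _ w(3) _ M]) (use Cons.prems(3,5) w(1) in auto)
  then show ?case using N(1) S'U by auto
qed

end

text \<open>The hypotheses of the theorem in the language of chains, where they are self-dual by
  \<open>opp_rigid\<close>.\<close>

locale chain_rigid = exc_sub C U for C :: "('o, 'm) excat" (structure) and U :: "'o set" +
  fixes d :: nat
  assumes d_pos: "0 < d"
    and EZU: "0 < n \<Longrightarrow> n < d \<Longrightarrow> V \<in> U \<Longrightarrow> V' \<in> U \<Longrightarrow> EZ C n V V'"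
    and chain_closed: "V \<in> U \<Longrightarrow> V' \<in> U \<Longrightarrow> chain C V V' cs \<Longrightarrow> length cs = d \<Longrightarrow>
      \<exists>ds. chain C V V' ds \<and> length ds = d \<and> rr C V V' cs ds \<and> terms C ds \<subseteq> U"
begin

lemma opp_rigid: "chain_rigid (opp C) U d"
proof (intro chain_rigid.intro[OF opp_sub] chain_rigid_axioms.intro)
  fix V V' cs assume *: "V \<in> U" "V' \<in> U" "chain (opp C) V V' cs" "length cs = d"
  have c: "chain C V' V (dualc cs)" "length (dualc cs) = d" using * chain_opp_iff[of V V' "dualc cs"] by auto
  obtain ds where ds: "chain C V' V ds" "length ds = d" "rr C V' V (dualc cs) ds" "terms C ds \<subseteq> U"
    using chain_closed[OF *(2,1) c] by blast
  have csn: "cs \<noteq> []" using *(4) d_pos by auto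
  show "\<exists>ds. chain (opp C) V V' ds \<and> length ds = d \<and> rr (opp C) V V' cs ds \<and> terms (opp C) ds \<subseteq> U"
    using chain_dualc[OF ds(1)] ds rr_dualc[OF ds(3) _ c(1) ds(1)] terms_dualc[OF ds(1)] csn
    by (intro exI[of _ "dualc ds"]) auto
qed (use d_pos EZU EZ_opp in auto)

text \<open>Each term of the coresolution is traded for one degree of Ext, which explains the bound
  on \<open>n + k\<close>.\<close>

lemma EZ_up: "up C U k A \<Longrightarrow> 0 < n \<Longrightarrow> n + k < d \<Longrightarrow> V \<in> U \<Longrightarrow> EZ C n A V"
proof (induction k arbitrary: A n)
  case 0
  then show ?case using EZU by simp
next
  case (Suc k)
  then obtain W B i p where W: "W \<in> U" "cf C A W B i p" "up C U k B" by auto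
  show ?case
    using EZ_shift_dual[OF W(2), of n V] Suc.IH[OF W(3), of "Suc n"] EZU[of n W V] Suc.prems W(1) by simp
qed

lemma up_split:
  assumes "up C U k A" "k < d - 1" "V \<in> U" "cf C V B A i p"
  shows "\<exists>r \<in> hom B V. r \<cdot> i = idm V"
  using EZ_split[OF EZ_up[OF assms(1), of 1 V] assms(4)] assms(2,3) by simp

text \<open>The comparison theorem for coresolutions: the cokernels in \<open>z\<close> have short
  coresolutions by \<open>U\<close>, so maps into the terms of \<open>k\<close> extend along its
  inflations.\<close>

lemma extend_chain:
  assumes "chain C V Z z" "terms C z \<subseteq> U" "V \<in> U" "length z < d" "chain C V2 K k" "length k = length z"
    "terms C k \<subseteq> U" "f \<in> hom Z K"
  shows "\<exists>\<phi> \<in> hom V V2. cmor C f \<phi> z k"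
  using assms
proof (induction z arbitrary: Z K k f)
  case (Cons c z)
  obtain i p where c: "c = (i, p)" by (cases c)
  obtain W Z1 where z: "cf C Z W Z1 i p" "chain C V Z1 z" using Cons.prems(1) c by auto
  obtain j q k' where k: "k = (j, q) # k'" using Cons.prems(6) by (cases k) auto
  obtain W' K1 where k': "cf C K W' K1 j q" "chain C V2 K1 k'" using Cons.prems(5) k by auto
  note [simp] = cfD[OF z(1)] cfD[OF k'(1)] homD[OF Cons.prems(8)]
  have W': "W' \<in> U" using Cons.prems(7) k by auto
  have up: "up C U (length z) Z1" unfolding up_chain using z(2) Cons.prems(2,3) by auto
  have "\<exists>h \<in> hom W W'. h \<cdot> i = j \<cdot> f"
    by (rule EZ_extend[OF up_split[OF up _ W'] z(1)]) (use Cons.prems(4) in auto)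
  then obtain h where h: "h \<in> hom W W'" "h \<cdot> i = j \<cdot> f" by blast
  note [simp] = homD[OF h(1)]
  have "(q \<cdot> h) \<cdot> i = zer Z K1" using h(2) cmp_reduce[OF cfD(7)[OF k'(1)], of f] by simp
  then obtain f1 where f1: "f1 \<in> hom Z1 K1" "f1 \<cdot> p = q \<cdot> h" using cf_cokernel[OF z(1), of "q \<cdot> h" K1] by auto
  obtain \<phi> where \<phi>: "\<phi> \<in> hom V V2" "cmor C f1 \<phi> z k'"
    using Cons.IH[OF z(2) _ Cons.prems(3) _ k'(2) _ _ f1(1)] Cons.prems k by auto
  have "cmor C f \<phi> ((i, p) # z) ((j, q) # k')"
    by (rule cmor_ConsI[OF z(1) k'(1) h(1) f1(1)]) (use h f1 \<phi> in auto)
  then show ?case using \<phi>(1) c k by blast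
qed auto

text \<open>The pushout of the first conflation \<open>w\<close> of a chain along its own inflation splits, hence by
  rigidity so does the pushout of any \<open>(i, p)\<close> such that \<open>(i, p) # z\<close> is equivalent to that chain.
  This gives a map \<open>Z \<rightarrow> K\<close>, which extends to a morphism of chains \<open>(id, \<phi>)\<close>;
  cancellation of \<open>w\<close> and the middle of the chain then allows to replace \<open>\<phi>\<close> by the identity.\<close>

lemma chain_lift:
  assumes "V \<in> U" "V' \<in> U" "cf C V' Y Z i p" "chain C V Z z" "length z = d - 1" "terms C z \<subseteq> U"
  shows "\<exists>ws. chain C V V' ws \<and> length ws = d \<and> terms C ws \<subseteq> U \<and> cmor C (idm V') (idm V) ((i, p) # z) ws"
proof -
  have ch: "chain C V V' ((i, p) # z)" using assms by auto
  have "length ((i, p) # z) = d" using assms(5) d_pos by simp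
  from chain_closed[OF assms(1,2) ch this]
  obtain ds where ds: "chain C V V' ds" "length ds = d" "rr C V V' ((i, p) # z) ds" "terms C ds \<subseteq> U" by blast
  obtain wi wp k where dsw: "ds = (wi, wp) # k" using ds(2) d_pos by (cases ds) auto
  obtain W K where w: "cf C V' W K wi wp" "chain C V K k" using ds(1) dsw by auto
  note [simp] = cfD[OF assms(3)] cfD[OF w(1)]
  have W: "W \<in> U" "terms C k \<subseteq> U" using ds(4) dsw by auto
  have lk: "length k = d - 1" using ds(2) dsw by simp
  \<comment> \<open>For \<open>d = 1\<close> the equivalence is already an isomorphism of
    conflations; the cancellations below need a nonempty \<open>z\<close>.\<close>
  show ?thesis
  proof (cases "z = []")
    case True
    then have k: "k = []" and Z: "Z = V" using lk assms(4,5) by auto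
    have K: "K = V" using w(2) k by auto
    obtain m where m: "iso_mor C Y W m" "m \<cdot> i = wi" "wp \<cdot> m = p"
      using rr_single[OF assms(3)[unfolded Z] w(1)[unfolded K]] ds(3) dsw k True by auto
    then have "cmor C (idm V') (idm V) ((i, p) # z) ds" unfolding dsw k True
      by (intro cmor_single_idI[OF assms(3)[unfolded Z] w(1)[unfolded K]]) (auto simp: iso_mor_def)
    then show ?thesis using ds by blast
  next
    case False
    have kn: "k \<noteq> []" using lk False assms(5) by auto
    obtain Y1 i1 p1 f1 where c1: "cf C W Y1 Z i1 p1" "p1 \<cdot> f1 = p" "po C V' Y W Y1 i wi i1 f1"
      using pushout[OF assms(3) cf_hom(1)[OF w(1)]] by blast
    obtain P i2 p2 f2 where w1: "cf C W P K i2 p2" "p2 \<cdot> f2 = wp" "po C V' W W P wi wi i2 f2"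
      using pushout[OF w(1) cf_hom(1)[OF w(1)]] by blast
    note [simp] = cfD[OF c1(1)] cfD[OF w1(1)] homD[OF poD(4)[OF c1(3)]] homD[OF poD(4)[OF w1(3)]]
    obtain r where r: "r \<in> hom P W" "r \<cdot> i2 = idm W" using poD(6)[OF w1(3), of "idm W" W "idm W"] by auto
    \<comment> \<open>The split conflation followed by \<open>z\<close> is the reference chain. It
      is equivalent to \<open>(i2, p2) # k\<close>, which also splits at its left end, hence to
      \<open>(i1, p1) # z\<close>, and there \<open>z\<close> can be cancelled.\<close>
    obtain S iW iZ pW pZ where S: "biproduct C W Z S iW iZ pW pZ"
      using biprodE[OF cfD(9)[OF w(1)] cfD(10)[OF assms(3)]] by blast
    note c0 = cf_biproduct[OF S]
    note [simp] = biproductD[OF S]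
    have chs: "chain C V W ((i1, p1) # z)" "chain C V W ((i2, p2) # k)" "chain C V W ((iW, pZ) # z)"
      using c1(1) w1(1) c0 assms(4) w(2) by auto
    have m1: "cmor C wi (idm V) ((i, p) # z) ((i1, p1) # z)"
      by (rule cmor_ConsI[OF assms(3) c1(1), of f1 "idm Z"])
        (use c1(2) poD(5)[OF c1(3)] cmor_refl[OF assms(4)] in auto)
    have m2: "cmor C wi (idm V) ds ((i2, p2) # k)" unfolding dsw
      by (rule cmor_ConsI[OF w(1) w1(1), of f2 "idm K"])
        (use w1(2) poD(5)[OF w1(3)] cmor_refl[OF w(2)] in auto)
    have r1: "rr C V W ((i1, p1) # z) ((i2, p2) # k)"
      by (rule rr_map[OF ds(3) _ ch ds(1) chs(1,2) cf_hom(1)[OF w(1)] m1 m2]) simp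
    obtain O' where O': "zero_object C O'" by (rule zero_objectE)
    have "length k < d" "0 < length k" using lk d_pos by linarith (use kn in simp)
    then have EZ0: "EZ C (length k) V O'" using EZU assms(1) U_zero[OF O'] by blast
    have r2: "rr C V W ((i2, p2) # k) ((iW, pZ) # z)"
      by (rule split_splice_rr[OF w1(1) r w(2) kn c0 _ _ assms(4) _ O' EZ0, of pW]) (use lk assms(5) in auto)
    have r3: "rr C V W ([(i1, p1)] @ z) ([(iW, pZ)] @ z)"
      using rr_trans[OF r1 r2 _ chs] by simp
    have "rr C Z W [(i1, p1)] [(iW, pZ)]"
    proof (rule splice_cancel_iter_dual[OF assms(4) _ _ _ _ r3])
      fix T n assume "T \<in> terms C z" "length [(i1, p1)] \<le> n" "n < length [(i1, p1)] + length z"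
      then show "EZ C n T W" using EZU[of n T W] assms(5,6) W(1) by auto
    qed (use c1(1) c0 in auto)
    from rr_single[OF c1(1) c0 this] obtain m where m: "iso_mor C Y1 S m" "m \<cdot> i1 = iW" by blast
    have mh: "m \<in> hom Y1 S" using m by (simp add: iso_mor_def)
    note [simp] = homD[OF mh]
    \<comment> \<open>The retraction onto \<open>W\<close>, restricted to \<open>Y\<close>: an
      extension of \<open>wi\<close> along \<open>i\<close>.\<close>
    define h where "h = pW \<cdot> (m \<cdot> f1)"
    have h [simp]: "h \<in> Mor C" "Dom C h = Y" "Cod C h = W" by (auto simp: h_def)
    have hi: "h \<cdot> i = wi"
      using cmp_reduce[OF m(2), of wi] poD(5)[OF c1(3)] cmp_reduce[OF biproductD(13)[OF S], of wi]
      by (simp add: h_def)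
    then have "(wp \<cdot> h) \<cdot> i = zer V' K" by simp
    then obtain f where f: "f \<in> hom Z K" "f \<cdot> p = wp \<cdot> h"
      using cf_cokernel[OF assms(3), of "wp \<cdot> h" K] by auto
    have ld: "length z < d" using assms(5) d_pos by simp
    have lkz: "length k = length z" using lk assms(5) by simp
    obtain \<phi> where \<phi>: "\<phi> \<in> hom V V" "cmor C f \<phi> z k"
      using extend_chain[OF assms(4,6,1) ld w(2) lkz W(2) f(1)] by blast
    obtain z0 zi zp where z0: "z = z0 @ [(zi, zp)]" using False by (cases z rule: rev_exhaust) auto
    obtain k0 ki kp where k0: "k = k0 @ [(ki, kp)]" using kn by (cases k rule: rev_exhaust) auto
    obtain Zl where zl: "chain C Zl Z z0" "chain C V Zl [(zi, zp)]" using assms(4) z0 chain_append by auto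
    obtain Kl where kl: "chain C Kl K k0" "chain C V Kl [(ki, kp)]" using w(2) k0 chain_append by auto
    obtain A where A: "cf C Zl A V zi zp" using zl(2) chain_single by auto
    obtain B where B: "cf C Kl B V ki kp" using kl(2) chain_single by auto
    note [simp] = cfD[OF A] cfD[OF B]
    have "length z0 = length k0" using lkz z0 k0 by simp
    from cmor_append[OF this] \<phi>(2) obtain g where g: "cmor C f g z0 k0" "cmor C g \<phi> [(zi, zp)] [(ki, kp)]"
      unfolding z0 k0 by blast
    have gh: "g \<in> hom Zl Kl" by (rule cmor_hom[OF g(1) zl(1) kl(1) f(1)])
    note [simp] = homD[OF gh] homD[OF \<phi>(1)]
    obtain n where n: "n \<in> hom A B" "n \<cdot> zi = ki \<cdot> g" "kp \<cdot> n = \<phi> \<cdot> zp" using g(2) by auto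
    \<comment> \<open>The morphism ending in \<open>\<phi>\<close> is factored through the pullback
      of the last conflation along \<open>\<phi>\<close>. Exchanging the last conflation for this
      pullback gives a chain \<open>k'\<close> that is reached with the identity on
      \<open>V\<close>.\<close>
    obtain B' ki' kp' a where B': "cf C Kl B' V ki' kp'" "a \<cdot> ki' = ki" "pb C B' B V V a kp' kp \<phi>"
      using pullback[OF B \<phi>(1)] by blast
    note Pb = pbD[OF B'(3)]
    note [simp] = cfD[OF B'(1)] homD[OF n(1)] homD[OF Pb(1)]
    obtain x where x: "x \<in> hom A B'" "kp' \<cdot> x = zp" "a \<cdot> x = n"
      using Pb(6)[OF cf_hom(2)[OF A] n(1)] n(3) by auto
    note [simp] = homD[OF x(1)]
    have xz: "x \<cdot> zi = ki' \<cdot> g"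
      by (rule Pb(7)[where T = Zl])
        (use x n(2) B'(2) cmp_reduce[OF x(2), of zi] cmp_reduce[OF x(3), of zi]
          cmp_reduce[OF B'(2), of g] cmp_reduce[OF cfD(7)[OF B'(1)], of g] in auto)
    have gx: "cmor C g (idm V) [(zi, zp)] [(ki', kp')]" using x xz by auto
    have chk': "chain C V Kl [(ki', kp')]" using B'(1) by auto
    define k' where "k' = k0 @ [(ki', kp')]"
    have "length z0 = length k0" using lkz z0 k0 by simp
    from cmor_append[OF this] have fz: "cmor C f (idm V) z k'" unfolding z0 k'_def using g(1) gx by blast
    have chk: "chain C V K k'" using chain_append kl(1) chk' k'_def by auto
    have ch': "chain C V V' ((wi, wp) # k')" using w(1) chk by auto
    have M: "cmor C (idm V') (idm V) ((i, p) # z) ((wi, wp) # k')"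
      by (rule cmor_ConsI[OF assms(3) w(1), of h f]) (use h hi f fz in auto)
    \<comment> \<open>Both chains are equivalent to \<open>(i, p) # z\<close> and differ only in the
      last conflation. Cancelling the rest makes these two conflations isomorphic, and the
      isomorphism removes \<open>\<phi>\<close>.\<close>
    have "rr C V V' ((wi, wp) # k') ds"
      by (rule rr_trans[OF rr_sym[OF rr_cmor[OF ch M]] ds(3) _ ch' ch ds(1)]) simp
    then have r4: "rr C V V' (((wi, wp) # k0) @ [(ki', kp')]) (((wi, wp) # k0) @ [(ki, kp)])"
      unfolding dsw k'_def k0 by simp
    have chw: "chain C Kl V' ((wi, wp) # k0)" using w(1) kl(1) by auto
    have "rr C V Kl [(ki', kp')] [(ki, kp)]"
    proof (rule splice_cancel_iter[OF chw chk' kl(2) _ _ r4])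
      fix T l assume *: "T \<in> terms C ((wi, wp) # k0)" "length [(ki', kp')] \<le> l"
        "l < length [(ki', kp')] + length ((wi, wp) # k0)"
      then have "T \<in> U" using W k0 by auto
      moreover have "l < d" using * lk k0 d_pos by auto
      ultimately show "EZ C l V T" using EZU[of l V T] * assms(1) by auto
    qed auto
    from rr_single[OF B'(1) B this] obtain y where y: "iso_mor C B' B y" "y \<cdot> ki' = ki" "kp \<cdot> y = kp'" by blast
    have yh: "y \<in> hom B' B" using y(1) by (simp add: iso_mor_def)
    note [simp] = homD[OF yh]
    have "(y \<cdot> x) \<cdot> zi = ki \<cdot> g" using xz cmp_reduce[OF y(2), of g] by simp
    moreover have "kp \<cdot> (y \<cdot> x) = zp" using cmp_reduce[OF y(3), of x] x(2) by simp
    ultimately have "cmor C g (idm V) [(zi, zp)] [(ki, kp)]" by (auto intro!: bexI[of _ "y \<cdot> x"])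
    then have "cmor C f (idm V) z k" unfolding z0 k0
      using cmor_append[OF \<open>length z0 = length k0\<close>] g(1) by blast
    then have "cmor C (idm V') (idm V) ((i, p) # z) ds" unfolding dsw
      by (intro cmor_ConsI[OF assms(3) w(1), of h f]) (use h hi f in auto)
    then show ?thesis using ds by blast
  qed
qed

end

section \<open>Extension closed subcategories\<close>

definition ext_closed :: "('o, 'm) excat \<Rightarrow> 'o set \<Rightarrow> bool" where
  "ext_closed C S \<longleftrightarrow> S \<subseteq> Ob C \<and> (\<forall>Z. zero_object C Z \<longrightarrow> Z \<in> S) \<and>
     (\<forall>A B D i p. cf C A B D i p \<longrightarrow> A \<in> S \<longrightarrow> D \<in> S \<longrightarrow> B \<in> S)"

lemma ext_closed_opp: "ext_closed C S \<Longrightarrow> ext_closed (opp C) S"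
  unfolding ext_closed_def opp_simps zero_object_opp using cf_opp by (metis opp_opp)

text \<open>Properties (a) and (b) of the overview, as \<open>split\<close> and \<open>lift\<close>,
  with \<open>N\<close> for \<open>d - 1\<close>.\<close>

locale lifting = exc_sub C U for C :: "('o, 'm) excat" (structure) and U :: "'o set" +
  fixes N :: nat
  assumes split: "up C U k A \<Longrightarrow> k < N \<Longrightarrow> V \<in> U \<Longrightarrow> cf C V B A i p \<Longrightarrow> \<exists>r \<in> Hom C B V. r \<cdot> i = Idm C V"
    and lift: "V \<in> U \<Longrightarrow> V' \<in> U \<Longrightarrow> cf C V' Y Z i p \<Longrightarrow> chain C V Z z \<Longrightarrow> length z = N \<Longrightarrow>
      terms C z \<subseteq> U \<Longrightarrow>
      \<exists>ws. chain C V V' ws \<and> terms C ws \<subseteq> U \<and> cmor C (Idm C V') (Idm C V) ((i, p) # z) ws"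
begin

text \<open>A horseshoe argument. The pushout \<open>P\<close> of \<open>Y\<close> and
  \<open>V\<close> under \<open>X\<close> is an extension of \<open>Z\<close> by \<open>V\<close>,
  hence a direct sum, and embeds into the sum of \<open>V'\<close> and \<open>V\<close>. The
  quotient of that sum by \<open>Y\<close> is an extension of \<open>Z1\<close> by
  \<open>X1\<close>.\<close>

lemma up_ext_less:
  assumes "k < N" "cf C X Y Z i p" "up C U k X" "up C U k Z"
  shows "up C U k Y"
  using assms
proof (induction k arbitrary: X Y Z i p)
  case 0
  have XZ: "X \<in> U" "Z \<in> U" using 0(3,4) by auto
  obtain r where "r \<in> hom Y X" "r \<cdot> i = idm X" using split[OF 0(4,1) XZ(1) 0(2)] by blast
  from split_retraction[OF 0(2) this] have "Y \<in> U" using XZ U_biproduct by blast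
  then show ?case by simp
next
  case (Suc k)
  obtain V X1 j q where V: "V \<in> U" "cf C X V X1 j q" "up C U k X1" using Suc.prems(3) by auto
  obtain V' Z1 j' q' where V': "V' \<in> U" "cf C Z V' Z1 j' q'" "up C U k Z1" using Suc.prems(4) by auto
  obtain P i1 p1 i2 p2 where P: "cf C V P Z i1 p1" "cf C Y P X1 i2 p2"
    using pushout_two[OF Suc.prems(2) V(2)] by metis
  obtain r where r: "r \<in> hom P V" "r \<cdot> i1 = idm V" using split[OF Suc.prems(4,1) V(1) P(1)] by blast
  obtain s where S: "biproduct C V Z P i1 s r p1" using split_retraction[OF P(1) r] by blast
  obtain S' j2 q2 l s' r' t where T: "cf C P S' Z1 j2 q2" "biproduct C V' V S' l s' r' t"
    using cf_add_summand[OF V'(2) biproduct_swap[OF S]] by metis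
  have "S' \<in> U" using U_biproduct[OF V'(1) V(1) T(2)] .
  moreover obtain R r2 u v where R: "cf C Y S' R (j2 \<cdot> i2) r2" "cf C X1 R Z1 u v"
    using noether[OF P(2) T(1)] by metis
  moreover have "up C U k R" using Suc.IH[OF _ R(2) V(3) V'(3)] Suc.prems(1) by simp
  ultimately show ?case by auto
qed

text \<open>At level \<open>N\<close> the splitting used in \<open>up_ext_less\<close> is not at
  hand; the morphism from \<open>lift\<close> and its mapping cone take its place.\<close>

lemma up_ext_U:
  assumes "V' \<in> U" "cf C V' Y Z i p" "up C U N Z"
  shows "up C U N Y"
proof -
  obtain V z where z: "V \<in> U" "chain C V Z z" "length z = N" "terms C z \<subseteq> U"
    using assms(3) unfolding up_chain by blast
  obtain ws where "chain C V V' ws" "terms C ws \<subseteq> U" "cmor C (idm V') (idm V) ((i, p) # z) ws"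
    using lift[OF z(1) assms(1,2) z(2-4)] by blast
  from up_of_cmor[OF assms(2) z(2,4) this] show ?thesis using z(3) by simp
qed

text \<open>At the top level, pushing out along \<open>X -> V\<close> reduces to a left end in
  \<open>U\<close>. The quotient \<open>X1\<close> of \<open>P\<close> by \<open>Y\<close> has a
  shorter coresolution, which \<open>up_ext_less\<close> can handle.\<close>

lemma up_ext:
  assumes "k \<le> N" "cf C X Y Z i p" "up C U k X" "up C U k Z"
  shows "up C U k Y"
proof -
  have "up C U N Y" if kN: "k = N"
  proof (cases N)
    case 0
    then show ?thesis using up_ext_U[OF _ assms(2)] assms(3,4) kN by simp
  next
    case (Suc n)
    obtain V X1 j q where V: "V \<in> U" "cf C X V X1 j q" "up C U n X1" using assms(3)[unfolded kN Suc] by auto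
    obtain P i1 p1 i2 p2 where P: "cf C V P Z i1 p1" "cf C Y P X1 i2 p2"
      using pushout_two[OF assms(2) V(2)] by metis
    have "up C U N P" using up_ext_U[OF V(1) P(1)] assms(4) kN by simp
    then obtain T P1 j' q' where T: "T \<in> U" "cf C P T P1 j' q'" "up C U n P1" using Suc by auto
    obtain R r2 u v where R: "cf C Y T R (j' \<cdot> i2) r2" "cf C X1 R P1 u v"
      using noether[OF P(2) T(2)] by metis
    have "up C U n R" using up_ext_less[OF _ R(2) V(3) T(3)] Suc by simp
    then show ?thesis using T(1) R(1) Suc by auto
  qed
  then show ?thesis using up_ext_less[OF _ assms(2-4)] assms(1) by fastforce
qed

lemma up_zero: "zero_object C Z \<Longrightarrow> up C U k Z"
  using up_mono[of 0 Z k] U_zero by simp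

lemma ext_closed_up: "k \<le> N \<Longrightarrow> ext_closed C {A. up C U k A}"
  unfolding ext_closed_def using up_ext up_zero up_Ob by blast

end

section \<open>The induced exact structure on an extension closed subcategory\<close>

lemma full_sub_simps [simp]:
  "Ob (full_sub C S) = S" "f \<in> Mor (full_sub C S) \<longleftrightarrow> f \<in> Mor C \<and> Dom C f \<in> S \<and> Cod C f \<in> S"
  "Dom (full_sub C S) = Dom C" "Cod (full_sub C S) = Cod C" "Idm (full_sub C S) = Idm C"
  "Cmp (full_sub C S) = Cmp C" "Add (full_sub C S) = Add C" "Zer (full_sub C S) = Zer C"
  "(i, p) \<in> Conf (full_sub C S) \<longleftrightarrow> (i, p) \<in> Conf C \<and> Dom C i \<in> S \<and> Cod C i \<in> S \<and> Cod C p \<in> S"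
  by (auto simp: full_sub_def)

lemma Hom_full_sub: "f \<in> Hom (full_sub C S) A B \<longleftrightarrow> f \<in> Hom C A B \<and> A \<in> S \<and> B \<in> S"
  by (auto simp: Hom_def)

lemma cf_full_sub: "cf (full_sub C S) A B D i p \<longleftrightarrow> cf C A B D i p \<and> A \<in> S \<and> B \<in> S \<and> D \<in> S"
  by (auto simp: cf_def Hom_full_sub) (auto simp: Hom_def)

lemma full_sub_full_sub: "S' \<subseteq> S \<Longrightarrow> full_sub (full_sub C S) S' = full_sub C S'"
  by (cases C) (auto simp: full_sub_def)

context exc
begin

lemma full_sub_opp: "full_sub (opp C) S = opp (full_sub C S)"
proof -
  have "\<And>i p. (i, p) \<in> Conf C \<Longrightarrow> Cod C i = Dom C p" using cfD(4,5)[OF cfI] by simp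
  then show ?thesis by (cases C) (auto simp: full_sub_def opp_def)
qed

context
  fixes S assumes S: "ext_closed C S"
begin

lemma S_Ob: "A \<in> S \<Longrightarrow> A \<in> Ob C"
  using S unfolding ext_closed_def by blast

lemma S_zero: "zero_object C Z \<Longrightarrow> Z \<in> S"
  using S unfolding ext_closed_def by blast

lemma S_ext: "cf C A B D i p \<Longrightarrow> A \<in> S \<Longrightarrow> D \<in> S \<Longrightarrow> B \<in> S"
  using S unfolding ext_closed_def by blast

lemma inflation_full_sub:
  "inflation (full_sub C S) i \<longleftrightarrow> (\<exists>A B D p. cf C A B D i p \<and> A \<in> S \<and> B \<in> S \<and> D \<in> S)"
proof
  assume "inflation (full_sub C S) i"
  then obtain p where p: "(i, p) \<in> Conf C" "Dom C i \<in> S" "Cod C i \<in> S" "Cod C p \<in> S" by (auto simp: inflation_def)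
  from cfI[OF p(1)] p(2-) show "\<exists>A B D p. cf C A B D i p \<and> A \<in> S \<and> B \<in> S \<and> D \<in> S" by blast
next
  assume "\<exists>A B D p. cf C A B D i p \<and> A \<in> S \<and> B \<in> S \<and> D \<in> S"
  then obtain A B D p where c: "cf C A B D i p" "A \<in> S" "B \<in> S" "D \<in> S" by blast
  note [simp] = cfD[OF c(1)]
  show "inflation (full_sub C S) i" unfolding inflation_def using c by (auto simp: cf_def intro!: exI[of _ p])
qed

lemma zero_object_full_sub: "zero_object C Z \<Longrightarrow> zero_object (full_sub C S) Z"
  using S_zero[of Z] S_Ob unfolding zero_object_def Hom_full_sub by auto

lemma biproduct_full_sub:
  assumes "A \<in> S" "B \<in> S" "biproduct C A B P iA iB pA pB"
  shows "biproduct (full_sub C S) A B P iA iB pA pB"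
  using assms S_ext[OF cf_biproduct[OF assms(3)]] by (auto simp: biproduct_def Hom_full_sub)

lemma inflation_idm_full_sub:
  assumes "A \<in> S"
  shows "inflation (full_sub C S) (idm A)"
proof -
  obtain Z where Z: "zero_object C Z" by (rule zero_objectE)
  have "A \<in> S" "A \<in> Ob C" using assms S_Ob by auto
  then show ?thesis unfolding inflation_full_sub full_sub_simps using cf_idm_zero[OF Z, of A] S_zero[OF Z] by blast
qed

text \<open>An inflation of the subcategory must have its cokernel in \<open>S\<close>. That of the
  composite is an extension of \<open>Q\<close> by \<open>D\<close>.\<close>

lemma inflation_cmp_full_sub:
  assumes "inflation (full_sub C S) i" "inflation (full_sub C S) j" "Cod C i = Dom C j"
  shows "inflation (full_sub C S) (j \<cdot> i)"
proof -
  obtain A B D p where i: "cf C A B D i p" "A \<in> S" "B \<in> S" "D \<in> S" using assms(1) inflation_full_sub by auto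
  obtain B' E Q q where j: "cf C B' E Q j q" "B' \<in> S" "E \<in> S" "Q \<in> S" using assms(2) inflation_full_sub by auto
  have "B' = B" using assms(3) cfD[OF i(1)] cfD[OF j(1)] by simp
  then obtain R r u v where R: "cf C A E R (j \<cdot> i) r" "cf C D R Q u v" using noether[OF i(1)] j(1) by blast
  have "R \<in> S" using S_ext[OF R(2)] i j by simp
  then show ?thesis unfolding inflation_full_sub full_sub_simps using R(1) i j by blast
qed

lemma inflation_pushout_full_sub:
  assumes "inflation (full_sub C S) i" "f \<in> Mor C" "Dom C f \<in> S" "Cod C f \<in> S" "Dom C f = Dom C i"
  shows "\<exists>i' f'. is_pushout (full_sub C S) i f i' f' \<and> inflation (full_sub C S) i'"
proof -
  obtain A B D p where i: "cf C A B D i p" "A \<in> S" "B \<in> S" "D \<in> S" using assms(1) inflation_full_sub by auto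
  note [simp] = cfD[OF i(1)]
  obtain A' where f: "f \<in> hom A A'" "A' \<in> S" using assms that[of "Cod C f"] by simp
  note [simp] = homD[OF f(1)]
  obtain B' i' p' f' where P: "cf C A' B' D i' p'" "po C A B A' B' i f i' f'"
    using pushout[OF i(1) f(1)] by blast
  note Q = poD[OF P(2)]
  note [simp] = cfD[OF P(1)] homD[OF Q(4)]
  have B': "B' \<in> S" using S_ext[OF P(1) f(2) i(4)] .
  have "is_pushout (full_sub C S) i f i' f'"
    unfolding is_pushout_def full_sub_simps Hom_full_sub
  proof (intro conjI allI ballI impI)
    fix T u v assume uv: "u \<in> Hom (full_sub C S) (Cod C f) T" "v \<in> Hom (full_sub C S) (Cod C i) T" "u \<cdot> f = v \<cdot> i"
    then have uv': "u \<in> hom A' T" "v \<in> hom B T" "T \<in> S" by (auto simp: Hom_full_sub)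
    obtain w where w: "w \<in> hom B' T" "w \<cdot> i' = u" "w \<cdot> f' = v" using Q(6)[OF uv'(1,2) uv(3)] by blast
    show "\<exists>!w. (w \<in> hom (Cod C i') T \<and> Cod C i' \<in> S \<and> T \<in> S) \<and> w \<cdot> i' = u \<and> w \<cdot> f' = v"
    proof (rule ex1I[of _ w])
      show "(w \<in> hom (Cod C i') T \<and> Cod C i' \<in> S \<and> T \<in> S) \<and> w \<cdot> i' = u \<and> w \<cdot> f' = v"
        using w B' uv'(3) by (simp del: homI)
    next
      fix w' assume "(w' \<in> hom (Cod C i') T \<and> Cod C i' \<in> S \<and> T \<in> S) \<and> w' \<cdot> i' = u \<and> w' \<cdot> f' = v"
      then show "w' = w" using Q(7)[of w' T w] w by (simp del: homI)
    qed
  qed (use i f B' Q(5) in auto)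
  moreover have "inflation (full_sub C S) i'" unfolding inflation_full_sub full_sub_simps using P(1) B' f i by blast
  ultimately show ?thesis by blast
qed

lemma exact_full_sub: "exact_category (full_sub C S)"
proof (intro exact_category.intro additive_category.intro category.intro
      additive_category_axioms.intro exact_category_axioms.intro, goal_cases)
  case (3 A) then show ?case using S_Ob by (simp add: Hom_full_sub)
next
  case 4 then show ?case by (auto simp: Hom_full_sub intro: Cmp_in_Hom)
next
  case (5 f A B) then show ?case using Cmp_Idm[of f A B] by (simp add: Hom_full_sub)
next
  case (6 f A B) then show ?case using Idm_Cmp[of f A B] by (simp add: Hom_full_sub)
next
  case (7 f A B g D h F) then show ?case using Cmp_assoc[of f A B g D h F] by (simp add: Hom_full_sub del: cmp_assoc)
next
  case (8 A B)
  then have "Hom_group (full_sub C S) A B = Hom_group C A B" by (auto simp: Hom_group_def Hom_full_sub)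
  then show ?case using Hom_comm_group[of A B] S_Ob 8 by simp
next
  case (9 f A B g D g') then show ?case using Cmp_Add_left[of f A B g D g'] by (simp add: Hom_full_sub)
next
  case (10 f A B f' g D) then show ?case using Cmp_Add_right[of f A B f' g D] by (simp add: Hom_full_sub)
next
  case 11 show ?case using zero_object_full_sub zero_object_exists by blast
next
  case (12 A B)
  then have AB: "A \<in> S" "B \<in> S" by auto
  then obtain P iA iB pA pB where "biproduct C A B P iA iB pA pB" using biprodE S_Ob by blast
  from biproduct_full_sub[OF AB this] show ?case unfolding direct_sum_def by blast
next
  case (13 i p)
  then have c: "(i, p) \<in> Conf C" "Dom C i \<in> S" "Cod C i \<in> S" "Cod C p \<in> S" by auto
  have e: "Cod C i = Dom C p" using cfD(4,5)[OF cfI[OF c(1)]] by simp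
  have "is_kernel C i p" "is_cokernel C i p" using Conf_kernel_cokernel[OF c(1)] by auto
  then show ?case using c(2-) e unfolding is_kernel_def is_cokernel_def full_sub_simps Hom_full_sub by simp
next
  case (14 i p i' p' a b c)
  have c: "(i, p) \<in> Conf C" using 14(1) by simp
  have iso: "iso_mor (full_sub C S) A B f \<Longrightarrow> iso_mor C A B f" for A B f
    unfolding iso_mor_def Bex_def Hom_full_sub full_sub_simps by blast
  have "(i', p') \<in> Conf C"
    by (rule Conf_iso_closed[OF c _ _ _ iso[of _ _ a] iso[of _ _ b] iso[of _ _ c]]) (use 14 in auto)
  then show ?case using 14(2,3) by auto
next
  case (15 A) then show ?case using inflation_idm_full_sub by simp
next
  \<comment> \<open>The axioms on deflations are those on inflations for the opposite category, in
    which \<open>S\<close> is extension closed as well.\<close>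
  case (16 A) then show ?case
    using exc.inflation_idm_full_sub[OF opp ext_closed_opp[OF S]] by (simp add: full_sub_opp)
next
  case (17 i j) then show ?case using inflation_cmp_full_sub by simp
next
  case (18 p q) then show ?case
    using exc.inflation_cmp_full_sub[OF opp ext_closed_opp[OF S], of q p] by (simp add: full_sub_opp)
next
  case (19 i f) then show ?case using inflation_pushout_full_sub[of i f] by simp
next
  case (20 p f) then show ?case
    using exc.inflation_pushout_full_sub[OF opp ext_closed_opp[OF S], of p f] by (simp add: full_sub_opp)
qed auto

lemma exc_full_sub: "exc (full_sub C S)"
  by (simp add: exc.intro exact_full_sub)

lemma subcategory_full_sub:
  assumes "subcategory C U" "U \<subseteq> S"
  shows "subcategory (full_sub C S) U"
  unfolding subcategory_def
proof (intro conjI allI impI)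
  show "U \<subseteq> Ob (full_sub C S)" using assms by simp
next
  fix A B assume "A \<in> U" "isomorphic (full_sub C S) A B"
  moreover from this(2) have "isomorphic C A B"
    unfolding isomorphic_def iso_mor_def Bex_def Hom_full_sub full_sub_simps by blast
  ultimately show "B \<in> U" using assms(1) unfolding subcategory_def by blast
next
  fix Z assume Z: "zero_object (full_sub C S) Z"
  obtain Z0 where Z0: "zero_object C Z0" "Z0 \<in> Ob C" by (rule zero_objectE)
  have ZS: "Z \<in> S" "Z \<in> Ob C" using Z S_Ob by (auto simp: zero_object_def)
  \<comment> \<open>A zero object of the subcategory is recognized as one of \<open>C\<close> by its
    identity being zero, a property that does not depend on the other objects.\<close>
  have "idm Z = zer Z Z"
    using exc.zero_object_hom(1)[OF exc_full_sub Z, of "idm Z" Z] ZS by (simp add: Hom_full_sub)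
  moreover have "idm Z0 = zer Z0 Z0" using zero_object_hom(1)[OF Z0(1), of "idm Z0" Z0] Z0(2) by simp
  ultimately have "iso_mor C Z0 Z (zer Z0 Z)"
    using Z0(2) ZS(2) by (intro iso_morI[of _ _ _ "zer Z Z0"]) auto
  then show "Z \<in> U" using assms(1) Z0 unfolding subcategory_def isomorphic_def by blast
next
  fix A B P assume *: "A \<in> U" "B \<in> U" "direct_sum (full_sub C S) A B P"
  then have "direct_sum C A B P" by (auto simp: direct_sum_def biproduct_def Hom_full_sub)
  then show "P \<in> U" using assms(1) * unfolding subcategory_def by blast
qed

end

lemma chain_full_sub_D:
  assumes "S \<subseteq> Ob C"
  shows "chain (full_sub C S) X Y cs \<Longrightarrow> chain C X Y cs"
  using assms by (induction cs arbitrary: Y) (auto simp: cf_full_sub)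

lemma cmor_full_sub:
  "cmor C a b cs ds \<Longrightarrow> chain (full_sub C S) X Y cs \<Longrightarrow> chain (full_sub C S) X' Y' ds \<Longrightarrow>
    cmor (full_sub C S) a b cs ds"
proof (induction cs arbitrary: a Y Y' ds)
  case Nil
  then show ?case using cmor_length[OF Nil(1)] by simp
next
  case (Cons c cs)
  obtain e es where ds: "ds = e # es" using cmor_length[OF Cons.prems(1)] by (cases ds) auto
  obtain A K where 1: "cf C Y A K (fst c) (snd c)" "A \<in> S" "K \<in> S" "chain (full_sub C S) X K cs"
    using Cons.prems(2) by (auto simp: cf_full_sub)
  obtain A' K' where 2: "cf C Y' A' K' (fst e) (snd e)" "A' \<in> S" "K' \<in> S" "chain (full_sub C S) X' K' es"
    using Cons.prems(3) ds by (auto simp: cf_full_sub)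
  obtain m k where m: "m \<in> hom (Cod C (fst c)) (Cod C (fst e))" "k \<in> hom (Cod C (snd c)) (Cod C (snd e))"
    "m \<cdot> fst c = fst e \<cdot> a" "snd e \<cdot> m = k \<cdot> snd c" "cmor C k b cs es"
    using Cons.prems(1) ds by auto
  have S: "Cod C (fst c) \<in> S" "Cod C (fst e) \<in> S" "Cod C (snd c) \<in> S" "Cod C (snd e) \<in> S"
    using 1 2 cfD(4,6)[OF 1(1)] cfD(4,6)[OF 2(1)] by auto
  have "cmor (full_sub C S) k b cs es" by (rule Cons.IH[OF m(5) 1(4) 2(4)])
  then show ?case using m S unfolding ds cmor.simps Hom_full_sub Bex_def full_sub_simps by blast
qed

lemma chain_pullback:
  assumes "chain C X Y cs" "cs \<noteq> []" "b \<in> hom X' X"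
  shows "\<exists>ds. chain C X' Y ds \<and> length ds = length cs \<and> cmor C (idm Y) b ds cs"
proof -
  have "chain (opp C) Y X (dualc cs)" using chain_dualc[OF assms(1)] .
  from exc.chain_pushout[OF opp this, of b X'] assms(2,3) obtain ds where
    ds: "chain (opp C) Y X' ds" "length ds = length cs" "cmor (opp C) b (idm Y) (dualc cs) ds"
    by auto
  have "cmor C (idm Y) b (dualc ds) cs"
    using exc.cmor_dualc[OF opp ds(3) \<open>chain (opp C) Y X (dualc cs)\<close> ds(1)] assms(3) by simp
  moreover have "chain C X' Y (dualc ds)" using chain_opp_iff[of Y X' "dualc ds"] ds(1) by simp
  ultimately show ?thesis using ds(2) by (intro exI[of _ "dualc ds"]) simp
qed

lemma up_full_sub_D: "up (full_sub C S) U k A \<Longrightarrow> up C U k A"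
  by (induction k arbitrary: A) (auto simp: cf_full_sub)

text \<open>The successive cokernels of a coresolution have shorter coresolutions, so it is enough
  that objects of this kind lie in \<open>S\<close>.\<close>

lemma up_full_sub_I:
  assumes "U \<subseteq> S"
  shows "up C U k A \<Longrightarrow> A \<in> S \<Longrightarrow> (\<And>j B. j < k \<Longrightarrow> up C U j B \<Longrightarrow> B \<in> S) \<Longrightarrow> up (full_sub C S) U k A"
proof (induction k arbitrary: A)
  case (Suc k)
  obtain V B i p where V: "V \<in> U" "cf C A V B i p" "up C U k B" using Suc.prems(1) by auto
  have B: "B \<in> S" using Suc.prems(3)[OF _ V(3)] by simp
  have "up (full_sub C S) U k B"
  proof (rule Suc.IH[OF V(3) B])
    fix j D assume "j < k" "up C U j D"
    then show "D \<in> S" using Suc.prems(3)[of j D] by simp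
  qed
  then show ?case using B using V Suc.prems(2) assms by (auto simp: cf_full_sub)
qed simp

end

context exc_sub
begin

lemma chain_full_sub_up:
  assumes "U \<subseteq> S" "V \<in> U"
  shows "chain C V A cs \<Longrightarrow> terms C cs \<subseteq> U \<Longrightarrow> A \<in> S \<Longrightarrow>
    (\<And>j B. j < length cs \<Longrightarrow> up C U j B \<Longrightarrow> B \<in> S) \<Longrightarrow> chain (full_sub C S) V A cs"
proof (induction cs arbitrary: A)
  case (Cons c cs)
  obtain W K where c: "cf C A W K (fst c) (snd c)" "chain C V K cs" using Cons.prems(1) by auto
  have W: "W \<in> U" "terms C cs \<subseteq> U" using Cons.prems(2) cfD[OF c(1)] by auto
  have "up C U (length cs) K" unfolding up_chain using c(2) W assms(2) by blast
  then have K: "K \<in> S" using Cons.prems(4)[of "length cs"] by simp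
  have "chain (full_sub C S) V K cs"
  proof (rule Cons.IH[OF c(2) W(2) K])
    fix j D assume "j < length cs" "up C U j D"
    then show "D \<in> S" using Cons.prems(4)[of j D] by simp
  qed
  then show ?case using c(1) W(1) K Cons.prems(3) assms(1) by (auto simp: cf_full_sub)
qed auto

lemma exc_sub_full_sub: "ext_closed C S \<Longrightarrow> U \<subseteq> S \<Longrightarrow> exc_sub (full_sub C S) U"
  using exc_full_sub subcategory_full_sub subU by (simp add: exc_sub_def exc_sub_axioms_def)

end

section \<open>The exact category \<open>U^d(E)\<close> and its lifting properties\<close>

context chain_rigid
begin

text \<open>The lift is made in \<open>C\<close>. Its terms are in \<open>U\<close> anyway;
  \<open>closed\<close> ensures that the objects between its conflations are in \<open>S\<close>
  too.\<close>

lemma lifting_full_sub: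
  assumes "ext_closed C S" "U \<subseteq> S"
    and closed: "\<And>V V' ws. V \<in> U \<Longrightarrow> V' \<in> U \<Longrightarrow> chain C V V' ws \<Longrightarrow> terms C ws \<subseteq> U \<Longrightarrow> length ws = d \<Longrightarrow>
      chain (full_sub C S) V V' ws"
  shows "lifting (full_sub C S) U (d - 1)"
proof (intro lifting.intro lifting_axioms.intro)
  show "exc_sub (full_sub C S) U" by (rule exc_sub_full_sub[OF assms(1,2)])
next
  fix k A V B i p
  assume "up (full_sub C S) U k A" "k < d - 1" "V \<in> U" and c: "cf (full_sub C S) V B A i p"
  then show "\<exists>r \<in> Hom (full_sub C S) B V. r \<cdot>\<^bsub>full_sub C S\<^esub> i = Idm (full_sub C S) V"
    using up_split[OF up_full_sub_D, of S k A V B i p] unfolding Bex_def Hom_full_sub full_sub_simps cf_full_sub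
    by blast
next
  fix V V' Y Z i p z
  assume V: "V \<in> U" "V' \<in> U" and c: "cf (full_sub C S) V' Y Z i p" and z: "chain (full_sub C S) V Z z"
    "length z = d - 1" "terms (full_sub C S) z \<subseteq> U"
  have S: "S \<subseteq> Ob C" using assms(1) by (simp add: ext_closed_def)
  have z': "chain C V Z z" "terms C z \<subseteq> U" using chain_full_sub_D[OF S z(1)] z(3) by (auto simp: terms_def)
  have c': "cf C V' Y Z i p" using c by (simp add: cf_full_sub)
  obtain ws where ws: "chain C V V' ws" "length ws = d" "terms C ws \<subseteq> U" "cmor C (idm V') (idm V) ((i, p) # z) ws"
    using chain_lift[OF V c' z'(1) z(2) z'(2)] by blast
  have "chain (full_sub C S) V V' ws" by (rule closed[OF V ws(1,3,2)])
  moreover have "chain (full_sub C S) V V' ((i, p) # z)" using c z(1) by auto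
  ultimately have "cmor (full_sub C S) (idm V') (idm V) ((i, p) # z) ws" by (intro cmor_full_sub[OF ws(4)])
  then show "\<exists>ws. chain (full_sub C S) V V' ws \<and> terms (full_sub C S) ws \<subseteq> U \<and>
      cmor (full_sub C S) (Idm (full_sub C S) V') (Idm (full_sub C S) V) ((i, p) # z) ws"
    using ws(3) \<open>chain (full_sub C S) V V' ws\<close> by (intro exI[of _ ws]) (simp add: terms_def)
qed

lemma lifting: "lifting C U (d - 1)"
proof (intro lifting.intro lifting_axioms.intro)
  show "exc_sub C U" by (rule exc_sub_axioms)
next
  fix V V' Y Z i p z
  assume "V \<in> U" "V' \<in> U" "cf C V' Y Z i p" "chain C V Z z" "length z = d - 1" "terms C z \<subseteq> U"
  from chain_lift[OF this]
  show "\<exists>ws. chain C V V' ws \<and> terms C ws \<subseteq> U \<and> cmor C (idm V') (idm V) ((i, p) # z) ws" by blast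
qed (rule up_split)

abbreviation "upS \<equiv> {A. up C U (d - 1) A}"
abbreviation "upC \<equiv> full_sub C upS"

lemma U_upS: "U \<subseteq> upS"
  using up_mono[of 0] by auto

lemma ext_closed_upS: "ext_closed C upS"
  using lifting.ext_closed_up[OF lifting, of "d - 1"] by simp

lemma chain_upC:
  assumes "V \<in> U" "V' \<in> U" "chain C V V' ws" "terms C ws \<subseteq> U" "length ws = d"
  shows "chain upC V V' ws"
proof (rule chain_full_sub_up[OF U_upS assms(1,3,4)])
  fix j B assume "j < length ws" "up C U j B"
  then show "B \<in> upS" using up_mono[of j B "d - 1"] assms(5) by simp
qed (use assms U_upS in blast)

lemma lifting_upC: "lifting upC U (d - 1)"
  by (rule lifting_full_sub[OF ext_closed_upS U_upS chain_upC])

text \<open>A lift made in \<open>opp C\<close> is, read backwards, a chain in \<open>C\<close> with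
  terms and ends in \<open>U\<close>. Hence the objects between its conflations have coresolutions
  by \<open>U\<close> and lie in \<open>upS\<close>.\<close>

lemma lifting_opp_upC: "lifting (opp upC) U (d - 1)"
  unfolding full_sub_opp[symmetric]
proof (rule chain_rigid.lifting_full_sub[OF opp_rigid ext_closed_opp[OF ext_closed_upS] U_upS])
  fix V V' ws
  assume *: "V \<in> U" "V' \<in> U" "chain (opp C) V V' ws" "terms (opp C) ws \<subseteq> U" "length ws = d"
  have c: "chain C V' V (dualc ws)" using *(3) chain_opp_iff[of V V' "dualc ws"] by simp
  have "chain upC V' V (dualc ws)"
    by (rule chain_upC[OF *(2,1) c]) (use terms_dualc[OF c] *(4,5) in auto)
  from exc.chain_dualc[OF exc_full_sub[OF ext_closed_upS] this]
  show "chain (full_sub (opp C) upS) V V' ws" by (simp add: full_sub_opp)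
qed

lemma up_upC: "A \<in> Ob upC \<Longrightarrow> up upC U (d - 1) A"
  using up_full_sub_I[OF U_upS] up_mono by simp

end

section \<open>Objects with both a resolution and a coresolution\<close>

text \<open>Satisfied by \<open>U^d(E)\<close>, where all objects have coresolutions by
  \<open>U\<close> but not necessarily resolutions.\<close>

locale bilifting = lifting C U N for C :: "('o, 'm) excat" (structure) and U :: "'o set" and N :: nat +
  assumes lifting_opp: "lifting (opp C) U N"
    and up_all: "A \<in> Ob C \<Longrightarrow> up C U N A"
begin

abbreviation "lo \<equiv> up (opp C) U"

lemma lo_mono: "lo k A \<Longrightarrow> k \<le> l \<Longrightarrow> lo l A"
  by (rule exc_sub.up_mono[OF opp_sub])

lemma lo_ext: "k \<le> N \<Longrightarrow> cf C X Y Z i p \<Longrightarrow> lo k X \<Longrightarrow> lo k Z \<Longrightarrow> lo k Y"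
  using lifting.up_ext[OF lifting_opp, of k Z Y X p i] by simp

text \<open>The pushout of \<open>T\<close> along \<open>X' \<rightarrow> X''\<close> is \<open>T \<oplus> Q\<close>, so embedding the summand \<open>Q\<close> into \<open>U\<close> yields
  the first term of a shorter resolution of an object containing \<open>X\<close>.\<close>

lemma lo_shorten:
  "0 < k \<Longrightarrow> k \<le> N \<Longrightarrow> lo k X \<Longrightarrow> \<exists>X' Q i p. cf C X X' Q i p \<and> lo (k - 1) X' \<and> up C U (N - k) Q"
proof (induction k arbitrary: X)
  case (Suc k)
  obtain T X' i p where T: "T \<in> U" "cf C X' T X i p" "lo k X'" using Suc.prems(3) by auto
  show ?case
  proof (cases "k = 0")
    case True
    have "up C U N X" using up_all cfD(10)[OF T(2)] by simp
    moreover have "N = Suc (N - 1)" using Suc.prems by simp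
    ultimately have "up C U (Suc (N - 1)) X" by simp
    then obtain V Q j q where "V \<in> U" "cf C X V Q j q" "up C U (N - 1) Q" by auto
    then show ?thesis using True by auto
  next
    case False
    obtain X'' Q j q where IH: "cf C X' X'' Q j q" "lo (k - 1) X''" "up C U (N - k) Q"
      using Suc.IH[OF _ _ T(3)] False Suc.prems(2) by auto
    obtain P i1 p1 i2 p2 where P: "cf C X'' P X i1 p1" "cf C T P Q i2 p2"
      using pushout_two[OF T(2) IH(1)] by metis
    have "N - k < N" using False Suc.prems by simp
    then obtain r where "r \<in> hom P T" "r \<cdot> i2 = idm T" using split[OF IH(3) _ T(1) P(2)] by blast
    from split_retraction[OF P(2) this] obtain s where S: "biproduct C T Q P i2 s r p2" by blast
    have "up C U (Suc (N - Suc k)) Q" using IH(3) Suc.prems(2) by (simp add: Suc_diff_Suc del: up.simps)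
    then obtain V Q1 j1 q1 where V: "V \<in> U" "cf C Q V Q1 j1 q1" "up C U (N - Suc k) Q1" by auto
    obtain S' j2 q2 l s' r' t where S': "cf C P S' Q1 j2 q2" "biproduct C V T S' l s' r' t"
      using cf_add_summand[OF V(2) biproduct_swap[OF S]] by metis
    have S'U: "S' \<in> U" using U_biproduct[OF V(1) T(1) S'(2)] .
    obtain R r2 u v where R: "cf C X'' S' R (j2 \<cdot> i1) r2" "cf C X R Q1 u v"
      using noether[OF P(1) S'(1)] by metis
    have "lo (Suc (k - 1)) R" using S'U R(1) IH(2) by auto
    then show ?thesis using R(2) V(3) False by auto
  qed
qed simp

text \<open>By \<open>lo_shorten\<close>, \<open>X\<close> embeds into some \<open>X'\<close> whose
  resolution is one term shorter, with quotient \<open>V\<close> in \<open>U\<close>. The quotient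
  \<open>Q\<close> of an embedding of \<open>X'\<close> into \<open>R\<close> is then still in
  \<open>lo N\<close>, and \<open>R/X\<close> is an extension of \<open>Q\<close> by
  \<open>V\<close>.\<close>

lemma lo_coresolve0:
  assumes "lo N X" "0 < N"
  shows "\<exists>V X1 i p. V \<in> U \<and> cf C X V X1 i p \<and> lo N X1"
proof -
  obtain X' V i p where X': "cf C X X' V i p" "lo (N - 1) X'" "up C U 0 V"
    using lo_shorten[OF assms(2) order_refl assms(1)] by auto
  have N: "N = Suc (N - 1)" using assms(2) by simp
  have "up C U (Suc (N - 1)) X'" using up_all[OF cfD(9)[OF X'(1)]] N by simp
  then obtain R Q j q where R: "R \<in> U" "cf C X' R Q j q" by auto
  have "lo (Suc (N - 1)) Q" using R X'(2) by auto
  then have Q: "lo N Q" using N by simp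
  obtain X1 r u v where X1: "cf C X R X1 (j \<cdot> i) r" "cf C V X1 Q u v" using noether[OF X'(1) R(2)] by metis
  have "lo N V" using X'(3) lo_mono[of 0 V N] by simp
  then have "lo N X1" using lo_ext[OF order_refl X1(2)] Q by simp
  then show ?thesis using X1(1) R(1) by blast
qed

text \<open>One embedding of \<open>X\<close> controls the length of the coresolution of the
  quotient, another keeps the quotient in \<open>lo N\<close>. Embedding \<open>X\<close> diagonally
  into the sum of both targets gives the pushout \<open>P\<close> as quotient, which inherits both
  properties because it is an extension in two ways.\<close>

lemma lo_coresolve:
  assumes "lo N X" "up C U (Suc j) X" "Suc j \<le> N"
  shows "\<exists>V X1 i p. V \<in> U \<and> cf C X V X1 i p \<and> lo N X1 \<and> up C U j X1"
proof -
  obtain V Y a b where V: "V \<in> U" "cf C X V Y a b" "up C U j Y" using assms(2) by auto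
  obtain R X1 i p where R: "R \<in> U" "cf C X R X1 i p" "lo N X1" using lo_coresolve0[OF assms(1)] assms(3) by auto
  obtain P i' p' a' b' where P: "cf C V P X1 i' p'" "cf C R P Y a' b'" "po C X R V P i a i' a'"
    using pushout_two[OF R(2) V(2)] by metis
  obtain S iV iR pV pR where S: "biproduct C V R S iV iR pV pR"
    using biprodE[OF U_Ob[OF V(1)] U_Ob[OF R(1)]] by blast
  have "cf C X S P (iV \<cdot> a \<oplus> iR \<cdot> i) (i' \<cdot> pV \<oplus> neg (a' \<cdot> pR))" by (rule cf_of_po[OF R(2) P(3) S])
  moreover have "S \<in> U" using U_biproduct[OF V(1) R(1) S] .
  moreover have "up C U j R" "lo N V" using R(1) V(1) up_mono[of 0 R j] lo_mono[of 0 V N] by auto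
  then have "up C U j P" "lo N P" using up_ext[OF _ P(2) _ V(3)] lo_ext[OF order_refl P(1) _ R(3)] assms(3) by auto
  ultimately show ?thesis by blast
qed

abbreviation "loS \<equiv> {A. lo N A}"
abbreviation "loC \<equiv> full_sub C loS"

lemma U_loS: "U \<subseteq> loS"
  using lo_mono[of 0] by auto

lemma ext_closed_loS: "ext_closed C loS"
  using ext_closed_opp[OF lifting.ext_closed_up[OF lifting_opp order_refl]] by simp

lemma up_loC:
  assumes "A \<in> Ob loC"
  shows "up loC U N A"
proof -
  have "j \<le> N \<Longrightarrow> lo N X \<Longrightarrow> up C U j X \<Longrightarrow> up loC U j X" for j X
  proof (induction j arbitrary: X)
    case (Suc j)
    obtain V X1 i p where V: "V \<in> U" "cf C X V X1 i p" "lo N X1" "up C U j X1"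
      using lo_coresolve[OF Suc.prems(2,3,1)] by blast
    have "up loC U j X1" using Suc.IH[OF _ V(3,4)] Suc.prems by simp
    moreover have "lo N V" using V(1) lo_mono[of 0 V N] by simp
    ultimately show ?case using V Suc.prems(2) by (auto simp: cf_full_sub)
  qed simp
  moreover have "A \<in> Ob C" using assms ext_closed_loS unfolding ext_closed_def by auto
  ultimately show ?thesis using assms up_all by simp
qed

lemma lo_loC: "A \<in> Ob loC \<Longrightarrow> up (opp loC) U N A"
  unfolding full_sub_opp[symmetric] using exc.up_full_sub_I[OF opp U_loS] lo_mono by simp

end

text \<open>All that is needed about the final category: splitting on both sides and resolutions of
  both kinds. The list is self-dual and free of Ext groups.\<close>

locale two_sided = exc_sub C U for C :: "('o, 'm) excat" (structure) and U :: "'o set" +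
  fixes N :: nat
  assumes up_split: "up C U k A \<Longrightarrow> k < N \<Longrightarrow> V \<in> U \<Longrightarrow> cf C V B A i p \<Longrightarrow>
      \<exists>r \<in> Hom C B V. r \<cdot> i = Idm C V"
    and lo_split: "up (opp C) U k A \<Longrightarrow> k < N \<Longrightarrow> V \<in> U \<Longrightarrow> cf C A B V i p \<Longrightarrow>
      \<exists>s \<in> Hom C V B. p \<cdot> s = Idm C V"
    and up_all: "A \<in> Ob C \<Longrightarrow> up C U N A"
    and lo_all: "A \<in> Ob C \<Longrightarrow> up (opp C) U N A"

lemma (in bilifting) two_sided_loC: "two_sided loC U N"
proof (intro two_sided.intro two_sided_axioms.intro)
  show "exc_sub loC U" by (rule exc_sub_full_sub[OF ext_closed_loS U_loS])
next
  fix k A V B i p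
  assume *: "up loC U k A" "k < N" "V \<in> U" "cf loC V B A i p"
  then show "\<exists>r \<in> Hom loC B V. r \<cdot>\<^bsub>loC\<^esub> i = Idm loC V"
    using split[OF up_full_sub_D[OF *(1)] *(2,3)] unfolding Bex_def Hom_full_sub full_sub_simps cf_full_sub
    by blast
next
  fix k A V B i p
  assume *: "up (opp loC) U k A" "k < N" "V \<in> U" "cf loC A B V i p"
  have "up (opp C) U k A"
    by (rule exc.up_full_sub_D[OF opp, of loS]) (use *(1) in \<open>simp add: full_sub_opp\<close>)
  from lifting.split[OF lifting_opp this *(2,3), of B p i]
  show "\<exists>s \<in> Hom loC V B. p \<cdot>\<^bsub>loC\<^esub> s = Idm loC V"
    using *(4) unfolding Bex_def Hom_full_sub full_sub_simps cf_full_sub opp_simps Hom_opp cf_opp by blast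
qed (rule up_loC lo_loC; simp)+

section \<open>Rigidity, orthogonality and approximations in the final category\<close>

context two_sided
begin

lemma opp_two_sided: "two_sided (opp C) U N"
  by (intro two_sided.intro opp_sub two_sided_axioms.intro) (use up_split lo_split up_all lo_all in auto)

lemma cover:
  assumes "A \<in> Ob C"
  shows "\<exists>R M k q. R \<in> U \<and> cf C M R A k q"
proof (cases N)
  case 0
  obtain Z where Z: "zero_object C Z" by (rule zero_objectE)
  have "A \<in> U" using lo_all[OF assms] 0 by simp
  then show ?thesis using cf_zero_idm[OF Z assms] by blast
next
  case (Suc n)
  then show ?thesis using lo_all[OF assms] by auto
qed

lemma cocover: "A \<in> Ob C \<Longrightarrow> \<exists>R M k q. R \<in> U \<and> cf C A R M k q"
  using two_sided.cover[OF opp_two_sided, of A] unfolding cf_opp opp_simps by blast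

text \<open>Proceeding from the right end, each middle term is covered by an object of
  \<open>U\<close> and the part to its left is pulled back. Only the term next to \<open>Y\<close>
  remains arbitrary.\<close>

lemma chain_resolve:
  "chain C X Y cs \<Longrightarrow> length cs = Suc n \<Longrightarrow>
    \<exists>c ds. chain C X Y (c # ds) \<and> length ds = n \<and> terms C ds \<subseteq> U \<and> cmor C (idm Y) (idm X) (c # ds) cs"
proof (induction n arbitrary: X cs)
  case 0
  then obtain c where "cs = [c]" by (cases cs) auto
  then show ?case using 0 cmor_refl[OF 0(1)] by (intro exI[of _ c] exI[of _ "[]"]) auto
next
  case (Suc n)
  obtain cs' i p where cs: "cs = cs' @ [(i, p)]" using Suc.prems(2) by (cases cs rule: rev_exhaust) auto
  obtain K A where K: "chain C K Y cs'" "cf C K A X i p"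
    using Suc.prems(1) cs chain_append[of X Y cs'] chain_single[of X _ "(i, p)"] by auto
  obtain R M k q where R: "R \<in> U" "cf C M R A k q" using cover[OF cfD(9)[OF K(2)]] by blast
  obtain K1 r u v where K1: "cf C K1 R X r (p \<cdot> q)" "cf C M K1 K u v" "q \<cdot> r = i \<cdot> v"
    using noether_dual[OF R(2) K(2)] by blast
  have lcs: "length cs' = Suc n" using Suc.prems(2) cs by simp
  then have cs'n: "cs' \<noteq> []" by auto
  obtain ds where ds: "chain C K1 Y ds" "length ds = length cs'" "cmor C (idm Y) v ds cs'"
    using chain_pullback[OF K(1) cs'n cf_hom(2)[OF K1(2)]] by blast
  have "length ds = Suc n" using ds(2) lcs by simp
  from Suc.IH[OF ds(1) this] obtain c es where es: "chain C K1 Y (c # es)" "length es = n" "terms C es \<subseteq> U"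
    "cmor C (idm Y) (idm K1) (c # es) ds" by blast
  note [simp] = cfD[OF K(2)] cfD[OF R(2)] cfD[OF K1(1)] cfD[OF K1(2)]
  have Y: "idm Y \<in> hom Y Y" "idm Y \<cdot> idm Y = idm Y" using chain_Ob[OF K(1)] by auto
  have "cmor C (idm Y) v (c # es) cs'"
    using cmor_comp[OF es(1) ds(1) K(1) Y(1) Y(1) es(4) ds(3)] Y(2) by simp
  moreover have "cmor C v (idm X) [(r, p \<cdot> q)] [(i, p)]"
    using cmor_ConsI[OF K1(1) K(2), of q "idm X" v "idm X" "[]" "[]"] K1(3) by auto
  ultimately have "cmor C (idm Y) (idm X) ((c # es) @ [(r, p \<cdot> q)]) cs"
    unfolding cs using cmor_append[of "c # es" cs'] es(2) lcs by fastforce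
  moreover have "chain C X Y ((c # es) @ [(r, p \<cdot> q)])"
    unfolding chain_append using es(1) K1(1) by auto
  ultimately show ?case using es(2,3) R(1)
    by (intro exI[of _ c] exI[of _ "es @ [(r, p \<cdot> q)]"]) auto
qed

text \<open>After \<open>chain_resolve\<close>, every extension splits at its left end. Two such
  extensions are equivalent by \<open>split_splice_rr\<close>, whose vanishing hypothesis comes from
  the induction, as zero objects are in \<open>U\<close>.\<close>

lemma EZ_U: "0 < n \<Longrightarrow> n \<le> N \<Longrightarrow> V \<in> U \<Longrightarrow> V' \<in> U \<Longrightarrow> EZ C n V V'"
proof (induction n arbitrary: V V')
  case (Suc n)
  \<comment> \<open>The cokernel of the first inflation is coresolved by the remaining terms, so
    that \<open>up_split\<close> applies.\<close>
  have split: "\<exists>Z A i p z r. cs = (i, p) # z \<and> cf C V' A Z i p \<and> chain C V Z z \<and> r \<in> hom A V' \<and> r \<cdot> i = idm V'"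
    if cs: "chain C V V' cs" "length cs = Suc n" "terms C (tl cs) \<subseteq> U" for cs
  proof -
    obtain i p z where c: "cs = (i, p) # z" using cs(2) by (cases cs) auto
    obtain A Z where Z: "cf C V' A Z i p" "chain C V Z z" using cs(1) c by auto
    have up: "up C U n Z" unfolding up_chain using Z(2) c cs(2,3) Suc.prems(3) by auto
    have "n < N" using Suc.prems(2) by simp
    then obtain r where "r \<in> hom A V'" "r \<cdot> i = idm V'" using up_split[OF up _ Suc.prems(4) Z(1)] by blast
    then show ?thesis using c Z by blast
  qed
  obtain Z0 where Z0: "zero_object C Z0" by (rule zero_objectE)
  have main: "rr C V V' cs ds"
    if cs: "chain C V V' cs" "length cs = Suc n" "terms C (tl cs) \<subseteq> U"
      and ds: "chain C V V' ds" "length ds = Suc n" "terms C (tl ds) \<subseteq> U" for cs ds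
  proof -
    obtain Z A i p z r where c: "cs = (i, p) # z" "cf C V' A Z i p" "chain C V Z z" "r \<in> hom A V'" "r \<cdot> i = idm V'"
      using split[OF cs] by blast
    obtain Z' A' i' p' z' r' where d: "ds = (i', p') # z'" "cf C V' A' Z' i' p'" "chain C V Z' z'" "r' \<in> hom A' V'"
      "r' \<cdot> i' = idm V'" using split[OF ds] by blast
    show ?thesis
    proof (cases "n = 0")
      case True
      then have z: "z = []" "z' = []" using c d cs ds by auto
      then have Z: "Z = V" "Z' = V" using c(3) d(3) by auto
      obtain s where S: "biproduct C V' V A i s r p" using split_retraction[OF c(2,4,5)] Z by auto
      obtain s' where S': "biproduct C V' V A' i' s' r' p'" using split_retraction[OF d(2,4,5)] Z by auto
      note [simp] = biproductD[OF S] biproductD[OF S']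
      have "cmor C (idm V') (idm V) [(i, p)] [(i', p')]"
        by (rule cmor_single_idI[OF c(2)[unfolded Z] d(2)[unfolded Z], of "i' \<cdot> r \<oplus> s' \<cdot> p"])
          (auto simp: cmp_reduce[OF biproductD(14)[OF S']] cmp_reduce[OF biproductD(15)[OF S']])
      then show ?thesis using rr_cmor[OF cs(1)] c(1) d(1) z by simp
    next
      case False
      have "z \<noteq> []" "length z' = length z" "length z = n" using c(1) d(1) cs(2) ds(2) False by auto
      moreover have "EZ C n V Z0" using Suc.IH[OF _ _ Suc.prems(3) U_zero[OF Z0]] False Suc.prems(2) by simp
      ultimately show ?thesis unfolding c(1) d(1)
        by (intro split_splice_rr[OF c(2,4,5,3) _ d(2,4,5,3) _ Z0]) auto
    qed
  qed
  show ?case unfolding EZ_def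
  proof (intro allI impI)
    fix cs ds assume *: "chain C V V' cs" "chain C V V' ds" "length cs = Suc n" "length ds = Suc n"
    obtain c cs1 where 1: "chain C V V' (c # cs1)" "length cs1 = n" "terms C cs1 \<subseteq> U"
      "cmor C (idm V') (idm V) (c # cs1) cs" using chain_resolve[OF *(1,3)] by blast
    obtain d ds1 where 2: "chain C V V' (d # ds1)" "length ds1 = n" "terms C ds1 \<subseteq> U"
      "cmor C (idm V') (idm V) (d # ds1) ds" using chain_resolve[OF *(2,4)] by blast
    have m: "rr C V V' (c # cs1) (d # ds1)" by (rule main) (use 1 2 in auto)
    have "rr C V V' cs (d # ds1)"
      by (rule rr_trans[OF rr_sym[OF rr_cmor[OF 1(1,4)]] m _ *(1) 1(1) 2(1)]) (use *(3) in auto)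
    then show "rr C V V' cs ds"
      by (rule rr_trans[OF _ rr_cmor[OF 2(1,4)] _ *(1) 2(1) *(2)]) (use *(3) in auto)
  qed
qed simp

text \<open>The kernel \<open>A'\<close> of a cover of \<open>A\<close> satisfies the same condition
  up to degree \<open>k\<close> by dimension shift, hence is in \<open>U\<close> by induction. Then
  vanishing in degree one splits the cover and makes \<open>A\<close> a complement.\<close>

lemma perp_left:
  assumes "closed_under_additive_complements C U"
  shows "k \<le> N \<Longrightarrow> up (opp C) U k A \<Longrightarrow> (\<And>n V. 0 < n \<Longrightarrow> n \<le> k \<Longrightarrow> V \<in> U \<Longrightarrow> EZ C n A V) \<Longrightarrow> A \<in> U"
proof (induction k arbitrary: A)
  case (Suc k)
  obtain T A' i p where T: "T \<in> U" "cf C A' T A i p" "up (opp C) U k A'" using Suc.prems(2) by auto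
  have "A' \<in> U"
  proof (rule Suc.IH[OF _ T(3)])
    fix n V assume "0 < n" "n \<le> k" "V \<in> U"
    then show "EZ C n A' V"
      using EZ_shift_dual[OF T(2), of n V] Suc.prems(1) Suc.prems(3)[of "Suc n" V] EZ_U[of n T V] T(1) by simp
  qed (use Suc.prems in simp)
  then obtain r where "r \<in> hom T A'" "r \<cdot> i = idm A'"
    using EZ_split[OF Suc.prems(3)[of 1 A'] T(2)] by auto
  from split_retraction[OF T(2) this] obtain s where "biproduct C A' A T i s r p" by blast
  then have "direct_sum C A A' T" using biproduct_swap unfolding direct_sum_def by blast
  then show ?case using assms T(1) \<open>A' \<in> U\<close> unfolding closed_under_additive_complements_def by blast
qed simp

lemma perp_left_iff:
  assumes "closed_under_additive_complements C U"
  shows "U = {A \<in> Ob C. \<forall>n V. 0 < n \<longrightarrow> n \<le> N \<longrightarrow> V \<in> U \<longrightarrow> EZ C n A V}"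
  using EZ_U U_Ob perp_left[OF assms order_refl lo_all] by blast

lemma perp_right_iff:
  assumes "closed_under_additive_complements C U"
  shows "U = {A \<in> Ob C. \<forall>n V. 0 < n \<longrightarrow> n \<le> N \<longrightarrow> V \<in> U \<longrightarrow> EZ C n V A}"
proof -
  have "U = {A \<in> Ob C. \<forall>n V. 0 < n \<longrightarrow> n \<le> N \<longrightarrow> V \<in> U \<longrightarrow> EZ (opp C) n A V}"
    using two_sided.perp_left_iff[OF opp_two_sided] assms by simp
  moreover have "(\<forall>n V. 0 < n \<longrightarrow> n \<le> N \<longrightarrow> V \<in> U \<longrightarrow> EZ (opp C) n A V) \<longleftrightarrow>
      (\<forall>n V. 0 < n \<longrightarrow> n \<le> N \<longrightarrow> V \<in> U \<longrightarrow> EZ C n V A)" for A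
    using EZ_opp_iff by blast
  ultimately show ?thesis by simp
qed

text \<open>The first inflation of a coresolution is a left approximation: maps to \<open>U\<close>
  extend along it because its cokernel has a coresolution one term shorter, to which
  \<open>up_split\<close> applies.\<close>

lemma covariantly_finite: "covariantly_finite C U"
  unfolding covariantly_finite_def
proof
  fix A assume A: "A \<in> Ob C"
  show "\<exists>V \<in> U. \<exists>f \<in> hom A V. \<forall>V' \<in> U. \<forall>g \<in> hom A V'. \<exists>h \<in> hom V V'. h \<cdot> f = g"
  proof (cases N)
    case 0
    then have "A \<in> U" using up_all[OF A] by simp
    moreover have "\<exists>h \<in> hom A V'. h \<cdot> idm A = g" if "g \<in> hom A V'" for V' g
      using that homD[OF that] by (intro bexI[of _ g]) auto
    ultimately show ?thesis using A by (intro bexI[of _ A] bexI[of _ "idm A"]) auto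
  next
    case (Suc n)
    then obtain V B i p where V: "V \<in> U" "cf C A V B i p" "up C U n B" using up_all[OF A] by auto
    have "\<exists>h \<in> hom V V'. h \<cdot> i = g" if "V' \<in> U" "g \<in> hom A V'" for V' g
      by (rule EZ_extend[OF up_split[OF V(3) _ that(1)] V(2) that(2)]) (use Suc in auto)
    then show ?thesis using V(1) cf_hom(1)[OF V(2)] by blast
  qed
qed

lemma contravariantly_finite: "contravariantly_finite C U"
  using two_sided.covariantly_finite[OF opp_two_sided]
  by (simp add: contravariantly_finite_def covariantly_finite_def)

lemma generating: "generating C U"
  unfolding generating_def deflation_def using cover unfolding cf_def by blast

lemma cogenerating: "cogenerating C U"
  unfolding cogenerating_def inflation_def using cocover unfolding cf_def by blast

end

section \<open>Lists of morphisms and Yoneda Ext\<close>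

text \<open>The morphisms of the spliced sequence, where \<open>p\<close> is the deflation waiting
  to be composed with the next inflation. In \<open>lst\<close> the identity of \<open>Y\<close>
  plays this role.\<close>

fun lst' :: "('o, 'm) excat \<Rightarrow> 'm \<Rightarrow> ('m \<times> 'm) list \<Rightarrow> 'm list" where
  "lst' C p [] = [p]"
| "lst' C p (c # cs) = (fst c \<cdot>\<^bsub>C\<^esub> p) # lst' C (snd c) cs"

definition lst :: "('o, 'm) excat \<Rightarrow> 'o \<Rightarrow> ('m \<times> 'm) list \<Rightarrow> 'm list" where
  "lst C Y cs = lst' C (Idm C Y) cs"

lemma length_lst' [simp]: "length (lst' C p cs) = Suc (length cs)"
  by (induction cs arbitrary: p) auto

lemma lst'_not_Nil [simp]: "lst' C p cs \<noteq> []"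
  by (cases cs) auto

lemma length_lst [simp]: "length (lst C Y cs) = Suc (length cs)"
  by (simp add: lst_def)

context exc
begin

lemma seq_term_lst':
  assumes "cf C Y A K i p" "chain C X K cs"
  shows "seq_term C (lst' C p cs) 0 = A"
    "j < length cs \<Longrightarrow> seq_term C (lst' C p cs) (Suc j) = Cod C (fst (cs ! j))"
    "seq_term C (lst' C p cs) (Suc (length cs)) = X"
proof -
  have "seq_term C (lst' C p cs) 0 = A \<and>
    (\<forall>j < length cs. seq_term C (lst' C p cs) (Suc j) = Cod C (fst (cs ! j))) \<and>
    seq_term C (lst' C p cs) (Suc (length cs)) = X"
    using assms
  proof (induction cs arbitrary: Y A K i p)
    case Nil
    then show ?case using cfD[OF Nil(1)] by (auto simp: seq_term_def)
  next
    case (Cons c cs)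
    obtain j q where c: "c = (j, q)" by (cases c)
    obtain B L where B: "cf C K B L j q" "chain C X L cs" using Cons.prems(2) c by auto
    have shift: "seq_term C (f # fs) (Suc n) = seq_term C fs n" if "fs \<noteq> []" for f fs n
      using that by (auto simp: seq_term_def)
    note [simp] = cfD[OF Cons.prems(1)] cfD[OF B(1)]
    have IH: "seq_term C (lst' C q cs) 0 = B"
      "\<forall>j < length cs. seq_term C (lst' C q cs) (Suc j) = Cod C (fst (cs ! j))"
      "seq_term C (lst' C q cs) (Suc (length cs)) = X" using Cons.IH[OF B] by auto
    have "seq_term C (lst' C p (c # cs)) 0 = A" by (auto simp: seq_term_def c)
    moreover have "seq_term C (lst' C p (c # cs)) (Suc n) = Cod C (fst ((c # cs) ! n))" if "n < length (c # cs)" for n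
      using that IH by (cases n) (auto simp: shift c)
    ultimately show ?case using IH by (auto simp: shift c)
  qed
  then show "seq_term C (lst' C p cs) 0 = A"
    "j < length cs \<Longrightarrow> seq_term C (lst' C p cs) (Suc j) = Cod C (fst (cs ! j))"
    "seq_term C (lst' C p cs) (Suc (length cs)) = X" by auto
qed

lemma seq_term_lst:
  assumes "chain C X Y cs"
  shows "seq_term C (lst C Y cs) 0 = Y"
    "j < length cs \<Longrightarrow> seq_term C (lst C Y cs) (Suc j) = Cod C (fst (cs ! j))"
    "seq_term C (lst C Y cs) (Suc (length cs)) = X"
proof -
  obtain Z where Z: "zero_object C Z" by (rule zero_objectE)
  have "cf C Z Y Y (zer Z Y) (idm Y)" using cf_zero_idm[OF Z] chain_Ob[OF assms] by simp
  from seq_term_lst'[OF this assms] show "seq_term C (lst C Y cs) 0 = Y"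
    "j < length cs \<Longrightarrow> seq_term C (lst C Y cs) (Suc j) = Cod C (fst (cs ! j))"
    "seq_term C (lst C Y cs) (Suc (length cs)) = X" by (simp_all add: lst_def)
qed

lemma conflations_of_lst':
  assumes "cf C Y A K i0 p0" "chain C X K cs"
  shows "\<exists>i p. i 0 = i0 \<and> p 0 = p0 \<and> (\<forall>j \<le> Suc (length cs). (i j, p j) \<in> Conf C) \<and>
    zero_object C (Cod C (p (Suc (length cs)))) \<and>
    (\<forall>j < Suc (length cs). Cod C (p j) = Dom C (i (Suc j)) \<and> lst' C p0 cs ! j = i (Suc j) \<cdot> p j)"
  using assms
proof (induction cs arbitrary: Y A K i0 p0)
  case Nil
  obtain Z where Z: "zero_object C Z" "Z \<in> Ob C" by (rule zero_objectE)
  have K: "K = X" "X \<in> Ob C" using Nil by auto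
  note [simp] = cfD[OF Nil(1)] Z(2) K(2)
  have "cf C K K Z (idm K) (zer K Z)" using cf_idm_zero[OF Z(1)] by simp
  note c = this
  show ?case
    \<comment> \<open>The conflation \<open>X = X -> 0\<close> closes the sequence, as
      \<open>exact_seq\<close> counts one conflation more than there are morphisms.\<close>
    by (rule exI[of _ "case_nat i0 (\<lambda>_. idm X)"], rule exI[of _ "case_nat p0 (\<lambda>_. zer X Z)"])
      (use c Nil(1) Z(1) K in \<open>auto simp: cf_def split: nat.split\<close>)
next
  case (Cons c cs)
  obtain j q where c: "c = (j, q)" by (cases c)
  obtain B L where B: "cf C K B L j q" "chain C X L cs" using Cons.prems(2) c by auto
  note [simp] = cfD[OF Cons.prems(1)] cfD[OF B(1)]
  obtain i p where ip: "i 0 = j" "p 0 = q" "\<forall>j \<le> Suc (length cs). (i j, p j) \<in> Conf C"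
    "zero_object C (Cod C (p (Suc (length cs))))"
    "\<forall>j < Suc (length cs). Cod C (p j) = Dom C (i (Suc j)) \<and> lst' C q cs ! j = i (Suc j) \<cdot> p j"
    using Cons.IH[OF B] by blast
  show ?case
    by (rule exI[of _ "case_nat i0 i"], rule exI[of _ "case_nat p0 p"])
      (use ip Cons.prems(1) in \<open>auto simp: c cf_def less_Suc_eq_0_disj split: nat.split\<close>)
qed

lemma exact_seq_lst:
  assumes "chain C X Y cs"
  shows "exact_seq C (lst C Y cs)"
proof -
  obtain Z where Z: "zero_object C Z" "Z \<in> Ob C" by (rule zero_objectE)
  have c: "cf C Z Y Y (zer Z Y) (idm Y)" using cf_zero_idm[OF Z(1)] chain_Ob[OF assms] by simp
  note [simp] = cfD[OF c]
  obtain i p where "i 0 = zer Z Y" "p 0 = idm Y" "\<forall>j \<le> Suc (length cs). (i j, p j) \<in> Conf C"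
    "zero_object C (Cod C (p (Suc (length cs))))"
    "\<forall>j < Suc (length cs). Cod C (p j) = Dom C (i (Suc j)) \<and> lst' C (idm Y) cs ! j = i (Suc j) \<cdot> p j"
    using conflations_of_lst'[OF c assms] by blast
  then show ?thesis unfolding exact_seq_def lst_def using Z by (intro conjI exI[of _ i] exI[of _ p]) auto
qed

text \<open>The last conflation has zero cokernel; its inflation is an isomorphism and is absorbed
  into the deflation before it.\<close>

lemma lst'_of_conflations:
  assumes "fs \<noteq> []" "\<forall>j \<le> length fs. (i j, p j) \<in> Conf C" "zero_object C (Cod C (p (length fs)))"
    "\<forall>j < length fs. Cod C (p j) = Dom C (i (Suc j)) \<and> fs ! j = i (Suc j) \<cdot> p j"
  shows "\<exists>p0 cs X. (i 0, p0) \<in> Conf C \<and> chain C X (Cod C p0) cs \<and> fs = lst' C p0 cs"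
  using assms
proof (induction fs arbitrary: i p)
  case (Cons f fs)
  have 0: "(i 0, p 0) \<in> Conf C" "(i 1, p 1) \<in> Conf C" "Cod C (p 0) = Dom C (i 1)" "f = i 1 \<cdot> p 0"
    using Cons.prems by (auto simp: Suc_le_eq)
  note c0 = cfI[OF 0(1)] and c1 = cfI[OF 0(2)]
  show ?case
  proof (cases "fs = []")
    case True
    have "zero_object C (Cod C (p 1))" using Cons.prems(3) True by simp
    from iso_of_zero_cokernel[OF c1 this] have "iso_mor C (Cod C (p 0)) (Cod C (i 1)) (i 1)" using 0(3) by simp
    from cf_iso_ends[OF c0 iso_idm this] have c: "cf C (Dom C (i 0)) (Cod C (i 0)) (Cod C (i 1)) (i 0) f"
      using 0(4) cfD(1,8)[OF c0] by simp
    then have "chain C (Cod C (i 1)) (Cod C f) []" using cfD[OF c] by simp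
    moreover have "(i 0, f) \<in> Conf C" using c by (simp add: cf_def)
    ultimately show ?thesis using True by (intro exI[of _ f] exI[of _ "[]"]) auto
  next
    case False
    obtain p1 cs X where IH: "(i 1, p1) \<in> Conf C" "chain C X (Cod C p1) cs" "fs = lst' C p1 cs"
      using Cons.IH[of "\<lambda>j. i (Suc j)" "\<lambda>j. p (Suc j)"] Cons.prems False by fastforce
    have "chain C X (Cod C (p 0)) ((i 1, p1) # cs)" using cfI[OF IH(1)] IH(2) 0(3) by auto
    moreover have "f # fs = lst' C (p 0) ((i 1, p1) # cs)" using 0(4) IH(3) by simp
    ultimately show ?thesis using 0(1) by blast
  qed
qed simp

lemma exact_seq_cases:
  assumes "exact_seq C fs"
  obtains (iso) f A B where "fs = [f]" "iso_mor C A B f"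
    | (chain) X Y cs where "cs \<noteq> []" "chain C X Y cs" "fs = lst C Y cs"
proof -
  obtain i p where ip: "fs \<noteq> []" "\<forall>j \<le> length fs. (i j, p j) \<in> Conf C" "zero_object C (Cod C (p (length fs)))"
    "\<forall>j < length fs. Cod C (p j) = Dom C (i (Suc j)) \<and> fs ! j = i (Suc j) \<cdot> p j" "zero_object C (Dom C (i 0))"
    using assms unfolding exact_seq_def by blast
  obtain p0 cs X where c: "(i 0, p0) \<in> Conf C" "chain C X (Cod C p0) cs" "fs = lst' C p0 cs"
    using lst'_of_conflations[OF ip(1-4)] by blast
  \<comment> \<open>At the left end the deflation out of the first term is an isomorphism, to be
    absorbed into the first inflation. If there is none, the sequence is a single
    isomorphism.\<close>
  have p0: "iso_mor C (Cod C (i 0)) (Cod C p0) p0" by (rule iso_of_zero_kernel[OF cfI[OF c(1)] ip(5)])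
  show thesis
  proof (cases cs)
    case Nil
    then show thesis using iso p0 c(3) by simp
  next
    case (Cons c' cs')
    obtain i1 p1 where c': "c' = (i1, p1)" by (cases c')
    obtain A K where A: "cf C (Cod C p0) A K i1 p1" "chain C X K cs'" using c(2) Cons c' by auto
    have "cf C (Cod C (i 0)) A K (i1 \<cdot> p0) p1"
      using cf_iso_ends[OF A(1) p0 iso_idm] cfD[OF A(1)] by simp
    moreover from cfD[OF this] have "i1 \<cdot> p0 \<cdot> idm (Cod C (i 0)) = i1 \<cdot> p0" by simp
    ultimately show thesis using chain[of "(i1 \<cdot> p0, p1) # cs'" X "Cod C (i 0)"] A(2) c(3) Cons c'
      by (auto simp: lst_def)
  qed
qed

lemma extensions_iff:
  assumes "0 < n"
  shows "fs \<in> extensions C n X Y \<longleftrightarrow> (\<exists>cs. chain C X Y cs \<and> length cs = n \<and> fs = lst C Y cs)"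
proof
  assume fs: "fs \<in> extensions C n X Y"
  then have "exact_seq C fs" "length fs = Suc n" by (auto simp: extensions_def)
  then show "\<exists>cs. chain C X Y cs \<and> length cs = n \<and> fs = lst C Y cs"
  proof (cases rule: exact_seq_cases)
    case (chain X' Y' cs)
    have l: "length cs = n" using chain \<open>length fs = Suc n\<close> by simp
    have "Y' = Y" "X' = X" using seq_term_lst[OF chain(2)] fs chain(3) l by (auto simp: extensions_def)
    then show ?thesis using chain l by blast
  qed (use assms in simp)
next
  assume "\<exists>cs. chain C X Y cs \<and> length cs = n \<and> fs = lst C Y cs"
  then show "fs \<in> extensions C n X Y"
    using seq_term_lst exact_seq_lst by (auto simp: extensions_def)
qed

lemma seq_term_Cons: "fs \<noteq> [] \<Longrightarrow> seq_term C (f # fs) (Suc n) = seq_term C fs n"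
  by (auto simp: seq_term_def)

text \<open>A ladder only gives maps between the terms; those between the objects \<open>K_j\<close>
  are recovered from the cokernel property.\<close>

lemma cmor_of_ladder:
  assumes "cf C Y A K i p" "cf C Y' A' K' i' p'" "chain C X K cs" "chain C X' K' ds" "length ds = length cs"
    "\<And>j. j \<le> Suc (length cs) \<Longrightarrow> h j \<in> hom (seq_term C (lst' C p cs) j) (seq_term C (lst' C p' ds) j)"
    "\<And>j. j \<le> length cs \<Longrightarrow> lst' C p' ds ! j \<cdot> h j = h (Suc j) \<cdot> lst' C p cs ! j"
    "k \<in> hom K K'" "p' \<cdot> h 0 = k \<cdot> p"
  shows "cmor C k (h (Suc (length cs))) cs ds"
  using assms
proof (induction cs arbitrary: Y A K i p Y' A' K' i' p' ds h k)
  case Nil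
  then have ds: "ds = []" and K: "K = X" "K' = X'" by auto
  have "p' \<cdot> h 0 = h 1 \<cdot> p" using Nil(7)[of 0] ds by simp
  then have e: "k \<cdot> p = h 1 \<cdot> p" using Nil(9) by simp
  have "h 1 \<in> hom X X'"
    using Nil(6)[of 1] seq_term_lst'(3)[OF Nil(1,3)] seq_term_lst'(3)[OF Nil(2,4)] ds by simp
  then have "k = h 1" using cf_epi[OF Nil(1) _ _ e] Nil(8) K by blast
  then show ?case using ds by simp
next
  case (Cons c cs)
  obtain j q where c: "c = (j, q)" by (cases c)
  obtain B L where B: "cf C K B L j q" "chain C X L cs" using Cons.prems(3) c by auto
  obtain j' q' ds' where d: "ds = (j', q') # ds'" using Cons.prems(5) by (cases ds) auto
  obtain B' L' where B': "cf C K' B' L' j' q'" "chain C X' L' ds'" using Cons.prems(4) d by auto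
  note [simp] = cfD[OF Cons.prems(1)] cfD[OF Cons.prems(2)] cfD[OF B(1)] cfD[OF B'(1)] homD[OF Cons.prems(8)]
  have h: "h 0 \<in> hom A A'"
    using Cons.prems(6)[of 0] seq_term_lst'(1)[OF Cons.prems(1,3)] seq_term_lst'(1)[OF Cons.prems(2,4)] by simp
  have h1: "h (Suc 0) \<in> hom B B'"
    using Cons.prems(6)[of "Suc 0"] seq_term_lst'(2)[OF Cons.prems(1,3), of 0] seq_term_lst'(2)[OF Cons.prems(2,4), of 0]
    by (simp add: c d)
  note [simp] = homD[OF h] homD[OF h1]
  have "(h (Suc 0) \<cdot> j) \<cdot> p = (j' \<cdot> k) \<cdot> p"
    using Cons.prems(7)[of 0] Cons.prems(9) by (simp add: c d)
  then have hj: "h (Suc 0) \<cdot> j = j' \<cdot> k" using cf_epi[OF Cons.prems(1), of "h (Suc 0) \<cdot> j" B' "j' \<cdot> k"] by simp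
  have "(q' \<cdot> h (Suc 0)) \<cdot> j = zer K L'" using hj cmp_reduce[OF cfD(7)[OF B'(1)], of k] by simp
  then obtain k1 where k1: "k1 \<in> hom L L'" "k1 \<cdot> q = q' \<cdot> h (Suc 0)"
    using cf_cokernel[OF B(1), of "q' \<cdot> h (Suc 0)" L'] by auto
  have "cmor C k1 ((\<lambda>n. h (Suc n)) (Suc (length cs))) cs ds'"
  proof (rule Cons.IH[OF B(1) B'(1) B(2) B'(2)])
    fix n assume n: "n \<le> Suc (length cs)"
    show "h (Suc n) \<in> hom (seq_term C (lst' C q cs) n) (seq_term C (lst' C q' ds') n)"
      using Cons.prems(6)[of "Suc n"] n by (simp add: c d seq_term_Cons)
  next
    fix n assume n: "n \<le> length cs"
    show "lst' C q' ds' ! n \<cdot> h (Suc n) = h (Suc (Suc n)) \<cdot> lst' C q cs ! n"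
      using Cons.prems(7)[of "Suc n"] n by (simp add: c d)
  qed (use Cons.prems(5) d k1 in auto)
  then have M: "cmor C k1 (h (Suc (length ((j, q) # cs)))) cs ds'" by simp
  show ?case unfolding c d by (rule cmor_ConsI[OF B(1) B'(1) h1 k1(1) hj k1(2)[symmetric] M])
qed

lemma ladder_of_cmor:
  assumes "cf C Y A K i p" "cf C Y' A' K' i' p'" "chain C X K cs" "chain C X' K' ds"
    "cmor C k b cs ds" "k \<in> hom K K'" "h0 \<in> hom A A'" "p' \<cdot> h0 = k \<cdot> p"
  shows "\<exists>h. h 0 = h0 \<and> h (Suc (length cs)) = b \<and>
    (\<forall>j \<le> Suc (length cs). h j \<in> hom (seq_term C (lst' C p cs) j) (seq_term C (lst' C p' ds) j)) \<and>
    (\<forall>j \<le> length cs. lst' C p' ds ! j \<cdot> h j = h (Suc j) \<cdot> lst' C p cs ! j)"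
  using assms
proof (induction cs arbitrary: Y A K i p Y' A' K' i' p' ds h0 k)
  case Nil
  have ds: "ds = []" and K: "K = X" "K' = X'" "k = b" using Nil cmor_length[OF Nil(5)] by auto
  note S = seq_term_lst'[OF Nil(1,3)] seq_term_lst'[OF Nil(2,4)]
  show ?case
    by (rule exI[of _ "case_nat h0 (\<lambda>_. b)"])
      (use S Nil(6-8) ds K in \<open>auto simp: le_Suc_eq\<close>)
next
  case (Cons c cs)
  obtain j q where c: "c = (j, q)" by (cases c)
  obtain B L where B: "cf C K B L j q" "chain C X L cs" using Cons.prems(3) c by auto
  obtain j' q' ds' B' L' m k1 where d: "ds = (j', q') # ds'" "cf C K' B' L' j' q'" "chain C X' L' ds'"
    "m \<in> hom B B'" "k1 \<in> hom L L'" "m \<cdot> j = j' \<cdot> k" "q' \<cdot> m = k1 \<cdot> q" "cmor C k1 b cs ds'"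
    using cmor_ConsE[OF Cons.prems(5)[unfolded c] B(1) Cons.prems(4)] by metis
  note [simp] = cfD[OF Cons.prems(1)] cfD[OF Cons.prems(2)] cfD[OF B(1)] cfD[OF d(2)] homD[OF Cons.prems(6)]
    homD[OF Cons.prems(7)] homD[OF d(4)]
  obtain h where h: "h 0 = m" "h (Suc (length cs)) = b"
    "\<forall>n \<le> Suc (length cs). h n \<in> hom (seq_term C (lst' C q cs) n) (seq_term C (lst' C q' ds') n)"
    "\<forall>n \<le> length cs. lst' C q' ds' ! n \<cdot> h n = h (Suc n) \<cdot> lst' C q cs ! n"
    using Cons.IH[OF B(1) d(2) B(2) d(3) d(8) d(5) d(4) d(7)] by blast
  have e: "(j' \<cdot> p') \<cdot> h0 = m \<cdot> (j \<cdot> p)"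
    using cmp_reduce[OF d(6), of p] Cons.prems(8) by simp
  have s0: "seq_term C (lst' C p (c # cs)) 0 = A" "seq_term C (lst' C p' ds) 0 = A'"
    using seq_term_lst'(1)[OF Cons.prems(1,3)] seq_term_lst'(1)[OF Cons.prems(2,4)] by auto
  have "case_nat h0 h n \<in> hom (seq_term C (lst' C p (c # cs)) n) (seq_term C (lst' C p' ds) n)"
    if n: "n \<le> Suc (length (c # cs))" for n
  proof (cases n)
    case 0
    then show ?thesis using s0 Cons.prems(7) by simp
  next
    case (Suc l)
    then show ?thesis using h(3) n by (simp add: c d(1) seq_term_Cons)
  qed
  moreover have "lst' C p' ds ! n \<cdot> case_nat h0 h n = case_nat h0 h (Suc n) \<cdot> lst' C p (c # cs) ! n"
    if n: "n \<le> length (c # cs)" for n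
    using n h(1,4) e by (cases n) (auto simp: c d(1))
  ultimately show ?case using h(2) by (intro exI[of _ "case_nat h0 h"]) auto
qed

lemma yoneda_step_lst:
  assumes "chain C X Y cs" "chain C X Y ds" "length cs = n" "length ds = n" "0 < n"
  shows "(lst C Y cs, lst C Y ds) \<in> yoneda_step C n X Y \<longleftrightarrow> cmor C (idm Y) (idm X) cs ds"
proof -
  obtain Z where Z: "zero_object C Z" by (rule zero_objectE)
  have Y: "Y \<in> Ob C" using chain_Ob[OF assms(1)] by simp
  note c = cf_zero_idm[OF Z Y]
  have ext: "lst C Y cs \<in> extensions C n X Y" "lst C Y ds \<in> extensions C n X Y"
    using extensions_iff[OF assms(5)] assms(1-4) by auto
  have Yh: "idm Y \<in> hom Y Y" using Y by simp
  show ?thesis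
  proof
    assume "(lst C Y cs, lst C Y ds) \<in> yoneda_step C n X Y"
    then obtain h where h: "\<forall>j \<le> Suc n. h j \<in> hom (seq_term C (lst' C (idm Y) cs) j) (seq_term C (lst' C (idm Y) ds) j)"
      "h 0 = idm Y" "h (Suc n) = idm X"
      "\<forall>j \<le> n. lst' C (idm Y) ds ! j \<cdot> h j = h (Suc j) \<cdot> lst' C (idm Y) cs ! j"
      unfolding yoneda_step_def lst_def by auto
    have "cmor C (idm Y) (h (Suc (length cs))) cs ds"
      by (rule cmor_of_ladder[OF c c assms(1,2)]) (use assms h Yh in auto)
    then show "cmor C (idm Y) (idm X) cs ds" using h(3) assms(3) by simp
  next
    assume "cmor C (idm Y) (idm X) cs ds"
    from ladder_of_cmor[OF c c assms(1,2) this Yh Yh] obtain h where h: "h 0 = idm Y" "h (Suc (length cs)) = idm X"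
      "\<forall>j \<le> Suc (length cs). h j \<in> hom (seq_term C (lst' C (idm Y) cs) j) (seq_term C (lst' C (idm Y) ds) j)"
      "\<forall>j \<le> length cs. lst' C (idm Y) ds ! j \<cdot> h j = h (Suc j) \<cdot> lst' C (idm Y) cs ! j"
      by auto
    then show "(lst C Y cs, lst C Y ds) \<in> yoneda_step C n X Y"
      unfolding yoneda_step_def using ext assms(3) unfolding lst_def by blast
  qed
qed

text \<open>A zigzag of any length collapses to one roof because \<open>rr\<close> is symmetric and
  transitive.\<close>

lemma rr_of_yoneda_equiv:
  assumes "(fs, gs) \<in> yoneda_equiv C n X Y" "fs = lst C Y cs" "chain C X Y cs" "length cs = n" "0 < n"
    "gs = lst C Y ds" "chain C X Y ds" "length ds = n"
  shows "rr C X Y cs ds"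
proof -
  have ne: "cs \<noteq> []" using assms by auto
  have single: "rr C X Y as bs"
    if "(lst C Y as, lst C Y bs) \<in> yoneda_step C n X Y \<union> (yoneda_step C n X Y)\<inverse>"
      "chain C X Y as" "length as = n" "chain C X Y bs" "length bs = n" for as bs
    using that yoneda_step_lst[of X Y as bs n] yoneda_step_lst[of X Y bs as n] assms(5) rr_cmor rr_sym by auto
  have "\<forall>ds. gs = lst C Y ds \<longrightarrow> chain C X Y ds \<longrightarrow> length ds = n \<longrightarrow> rr C X Y cs ds"
    using assms(1) unfolding yoneda_equiv_def
  proof (induction rule: rtrancl_induct)
    case base
    have "(lst C Y cs, lst C Y cs) \<in> yoneda_step C n X Y"
      using yoneda_step_lst[OF assms(3,3,4,4,5)] cmor_refl[OF assms(3)] by simp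
    then show ?case using single[of cs] assms(2-4) by auto
  next
    case (step gs gs')
    show ?case
    proof (intro allI impI)
      fix ds' assume ds': "gs' = lst C Y ds'" "chain C X Y ds'" "length ds' = n"
      have "gs \<in> extensions C n X Y" using step.hyps(2) by (auto simp: yoneda_step_def)
      then obtain ds where ds: "gs = lst C Y ds" "chain C X Y ds" "length ds = n"
        using extensions_iff[OF assms(5)] by blast
      have "rr C X Y ds ds'" using single[of ds ds'] step.hyps(2) ds ds' by simp
      moreover have "rr C X Y cs ds" using step.IH ds by simp
      ultimately show "rr C X Y cs ds'" using rr_trans ne assms(3) ds(2) ds'(2) by blast
    qed
  qed
  then show ?thesis using assms by blast
qed

lemma yoneda_equiv_of_rr:
  assumes "rr C X Y cs ds" "chain C X Y cs" "length cs = n" "chain C X Y ds" "length ds = n" "0 < n"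
  shows "(lst C Y cs, lst C Y ds) \<in> yoneda_equiv C n X Y"
proof -
  obtain es where es: "chain C X Y es" "cmor C (idm Y) (idm X) es cs" "cmor C (idm Y) (idm X) es ds"
    using assms(1) by (auto simp: rr_def)
  have l: "length es = n" using cmor_length[OF es(2)] assms(3) by simp
  have "(lst C Y es, lst C Y cs) \<in> yoneda_step C n X Y" "(lst C Y es, lst C Y ds) \<in> yoneda_step C n X Y"
    using yoneda_step_lst[OF es(1) assms(2) l assms(3,6)] yoneda_step_lst[OF es(1) assms(4) l assms(5,6)] es by auto
  then show ?thesis unfolding yoneda_equiv_def by (meson UnI1 UnI2 converseI r_into_rtrancl rtrancl_trans)
qed

lemma chain_ex:
  assumes "X \<in> Ob C" "Y \<in> Ob C" "0 < n"
  shows "\<exists>cs. chain C X Y cs \<and> length cs = n"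
proof -
  obtain Z where Z: "zero_object C Z" "Z \<in> Ob C" by (rule zero_objectE)
  obtain z where z: "chain C X Z z" "length z = n" using zero_chain_ex[OF Z(1) assms(1,3)] by blast
  have "z \<noteq> []" "zer Z Y \<in> hom Z Y" using z assms Z by auto
  from chain_pushout[OF z(1) this] show ?thesis using z(2) by blast
qed

text \<open>\<open>EZ\<close> says that there is at most one class, and \<open>chain_ex\<close>
  provides an extension, so that there is exactly one.\<close>

lemma Ext_zero_iff:
  assumes "X \<in> Ob C" "Y \<in> Ob C" "0 < n"
  shows "Ext_zero C n X Y \<longleftrightarrow> EZ C n X Y"
proof
  assume "Ext_zero C n X Y"
  then obtain q where q: "extensions C n X Y // yoneda_equiv C n X Y = {q}"
    by (auto simp: Ext_zero_def Ext_def is_singleton_def)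
  have eq: "(fs, gs) \<in> yoneda_equiv C n X Y" if "fs \<in> extensions C n X Y" "gs \<in> extensions C n X Y" for fs gs
  proof -
    have "yoneda_equiv C n X Y `` {fs} = q" "yoneda_equiv C n X Y `` {gs} = q"
      using q quotientI[OF that(1)] quotientI[OF that(2)] by blast+
    moreover have "gs \<in> yoneda_equiv C n X Y `` {gs}" by (simp add: yoneda_equiv_def)
    ultimately show ?thesis by blast
  qed
  show "EZ C n X Y" unfolding EZ_def
  proof (intro allI impI)
    fix cs ds assume *: "chain C X Y cs" "chain C X Y ds" "length cs = n" "length ds = n"
    then have "lst C Y cs \<in> extensions C n X Y" "lst C Y ds \<in> extensions C n X Y"
      using extensions_iff[OF assms(3)] by auto
    from rr_of_yoneda_equiv[OF eq[OF this] refl *(1,3) assms(3) refl *(2,4)] show "rr C X Y cs ds" .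
  qed
next
  assume EZ: "EZ C n X Y"
  have eq: "(fs, gs) \<in> yoneda_equiv C n X Y" if "fs \<in> extensions C n X Y" "gs \<in> extensions C n X Y" for fs gs
    using that EZ yoneda_equiv_of_rr[OF _ _ _ _ _ assms(3)] unfolding EZ_def extensions_iff[OF assms(3)] by blast
  obtain cs where cs: "chain C X Y cs" "length cs = n" using chain_ex[OF assms] by blast
  then have e: "lst C Y cs \<in> extensions C n X Y" using extensions_iff[OF assms(3)] by blast
  have tr: "trans (yoneda_equiv C n X Y)" unfolding yoneda_equiv_def by (rule trans_rtrancl)
  have "yoneda_equiv C n X Y `` {fs} = yoneda_equiv C n X Y `` {lst C Y cs}" if "fs \<in> extensions C n X Y" for fs
    using eq[OF that e] eq[OF e that] tr unfolding trans_def by blast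
  then have "extensions C n X Y // yoneda_equiv C n X Y = {yoneda_equiv C n X Y `` {lst C Y cs}}"
    unfolding quotient_def using e by blast
  then show "Ext_zero C n X Y" by (auto simp: Ext_zero_def Ext_def is_singleton_def)
qed

text \<open>For \<open>k = 0\<close> the sequence is a single isomorphism while the chain is empty;
  therefore the left end is only determined up to isomorphism.\<close>

lemma exact_seq_chainD:
  assumes "exact_seq C fs" "length fs = Suc k" "\<And>j. j < k \<Longrightarrow> seq_term C fs (Suc j) \<in> U"
  shows "\<exists>A cs. isomorphic C A (seq_term C fs 0) \<and> chain C (seq_term C fs (Suc k)) A cs \<and> length cs = k \<and>
    terms C cs \<subseteq> U"
  using assms(1)
proof (cases rule: exact_seq_cases)
  case (iso f A B)
  have f: "f \<in> hom A B" using iso(2) by (simp add: iso_mor_def)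
  have "isomorphic C B A" using iso(2) isomorphic_sym unfolding isomorphic_def by metis
  then show ?thesis using iso(1) homD[OF f] assms(2)
    by (intro exI[of _ B] exI[of _ "[]"]) (auto simp: seq_term_def)
next
  case (chain X Y cs)
  note S = seq_term_lst[OF chain(2)]
  have k: "k = length cs" using assms(2) chain by simp
  have "terms C cs \<subseteq> U" unfolding terms_nth using S(2) assms(3) k chain(3) by force
  moreover have "isomorphic C Y Y" using iso_idm chain_Ob[OF chain(2)] unfolding isomorphic_def by blast
  ultimately show ?thesis using S(1,3) chain k by auto
qed

lemma exact_seq_chainI:
  assumes "chain C X Y cs" "terms C cs \<subseteq> U"
  shows "\<exists>fs. length fs = Suc (length cs) \<and> exact_seq C fs \<and> seq_term C fs 0 = Y \<and>
    seq_term C fs (Suc (length cs)) = X \<and> (\<forall>j < length cs. seq_term C fs (Suc j) \<in> U)"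
  using seq_term_lst[OF assms(1)] exact_seq_lst[OF assms(1)] assms(2)
  by (intro exI[of _ "lst C Y cs"]) (auto simp: terms_nth)

end

section \<open>Translation back to the notions of the theorem\<close>

context exc_sub
begin

lemma upper_sub_eq: "upper_sub (Suc k) C U = {A. up C U k A}"
proof (intro equalityI subsetI)
  fix A assume "A \<in> upper_sub (Suc k) C U"
  then obtain fs where fs: "length fs = Suc k" "exact_seq C fs" "seq_term C fs 0 = A"
    "\<And>j. j \<le> k \<Longrightarrow> seq_term C fs (Suc j) \<in> U" by (auto simp: upper_sub_def)
  obtain B cs where "isomorphic C B A" "chain C (seq_term C fs (Suc k)) B cs" "length cs = k" "terms C cs \<subseteq> U"
    using exact_seq_chainD[OF fs(2,1), of U] fs(3,4) by auto
  then have "up C U k B" "isomorphic C B A" unfolding up_chain using fs(4)[of k] by auto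
  then show "A \<in> {A. up C U k A}" using up_iso by (auto simp: isomorphic_def)
next
  fix A assume "A \<in> {A. up C U k A}"
  then obtain V cs where cs: "V \<in> U" "chain C V A cs" "length cs = k" "terms C cs \<subseteq> U"
    unfolding up_chain by blast
  then obtain fs where fs: "length fs = Suc k" "exact_seq C fs" "seq_term C fs 0 = A"
    "seq_term C fs (Suc k) = V" "\<forall>j < k. seq_term C fs (Suc j) \<in> U" using exact_seq_chainI[OF cs(2,4)] by auto
  have "seq_term C fs j \<in> U" if "1 \<le> j" "j \<le> Suc k" for j
    using that fs(4,5) cs(1) by (cases j) (auto simp: le_less)
  then show "A \<in> upper_sub (Suc k) C U" using fs chain_Ob[OF cs(2)] by (auto simp: upper_sub_def)
qed

lemma lo_chain:
  "up (opp C) U k A \<longleftrightarrow> (\<exists>V \<in> U. \<exists>cs. chain C A V cs \<and> length cs = k \<and> terms C cs \<subseteq> U)"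
proof
  assume "up (opp C) U k A"
  then obtain V cs where cs: "V \<in> U" "chain (opp C) V A cs" "length cs = k" "terms (opp C) cs \<subseteq> U"
    using exc_sub.up_chain[OF opp_sub] by metis
  have "chain C A V (dualc cs)" using chain_opp_iff[of V A "dualc cs"] cs(2) by simp
  moreover from terms_dualc[OF this] have "terms C (dualc cs) \<subseteq> U" using cs(4) by simp
  ultimately show "\<exists>V \<in> U. \<exists>cs. chain C A V cs \<and> length cs = k \<and> terms C cs \<subseteq> U" using cs(1,3) by force
next
  assume "\<exists>V \<in> U. \<exists>cs. chain C A V cs \<and> length cs = k \<and> terms C cs \<subseteq> U"
  then obtain V cs where cs: "V \<in> U" "chain C A V cs" "length cs = k" "terms C cs \<subseteq> U" by blast
  then show "up (opp C) U k A"
    unfolding exc_sub.up_chain[OF opp_sub] using chain_dualc[OF cs(2)] terms_dualc[OF cs(2)] by force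
qed

lemma lower_sub_eq: "lower_sub (Suc k) C U = {A. up (opp C) U k A}"
proof (intro equalityI subsetI)
  fix A assume "A \<in> lower_sub (Suc k) C U"
  then obtain fs where fs: "length fs = Suc k" "exact_seq C fs" "seq_term C fs (Suc k) = A"
    "\<And>j. j < Suc k \<Longrightarrow> seq_term C fs j \<in> U" by (auto simp: lower_sub_def)
  obtain B cs where B: "isomorphic C B (seq_term C fs 0)" "chain C A B cs" "length cs = k" "terms C cs \<subseteq> U"
    using exact_seq_chainD[OF fs(2,1), of U] fs(3,4) by auto
  have "B \<in> U" using fs(4)[of 0] isomorphic_sym[OF B(1)] U_iso unfolding isomorphic_def by blast
  then show "A \<in> {A. up (opp C) U k A}" unfolding lo_chain using B by auto
next
  fix A assume "A \<in> {A. up (opp C) U k A}"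
  then obtain V cs where cs: "V \<in> U" "chain C A V cs" "length cs = k" "terms C cs \<subseteq> U"
    using lo_chain by blast
  then obtain fs where fs: "length fs = Suc k" "exact_seq C fs" "seq_term C fs 0 = V"
    "seq_term C fs (Suc k) = A" "\<forall>j < k. seq_term C fs (Suc j) \<in> U" using exact_seq_chainI[OF cs(2,4)] by auto
  have "seq_term C fs j \<in> U" if "j < Suc k" for j
    using that fs(3,5) cs(1) by (cases j) auto
  then show "A \<in> lower_sub (Suc k) C U" using fs chain_Ob[OF cs(2)] by (auto simp: lower_sub_def)
qed

end

lemma chain_rigidI:
  assumes "0 < d" "exact_category E" "d_rigid d E U" "d_extension_closed d E U"
  shows "chain_rigid E U d"
proof -
  interpret exc E by (rule exc.intro) fact
  have U: "subcategory E U" using assms(3) by (simp add: d_rigid_def)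
  interpret exc_sub E U by unfold_locales fact
  show ?thesis
  proof (unfold_locales)
    fix n V V' assume n: "0 < n" "n < d" "V \<in> U" "V' \<in> U"
    then have "Ext_zero E n V V'" using assms(3) by (simp add: d_rigid_def)
    then show "EZ E n V V'" using Ext_zero_iff U_Ob n by simp
  next
    fix V V' cs assume *: "V \<in> U" "V' \<in> U" "chain E V V' cs" "length cs = d"
    then have "lst E V' cs \<in> extensions E d V V'" using extensions_iff[OF assms(1)] by blast
    then obtain gs where gs: "gs \<in> extensions E d V V'" "(lst E V' cs, gs) \<in> yoneda_equiv E d V V'"
      "\<forall>j. 1 \<le> j \<and> j \<le> d \<longrightarrow> seq_term E gs j \<in> U"
      using assms(4) *(1,2) unfolding d_extension_closed_def by blast
    then obtain ds where ds: "chain E V V' ds" "length ds = d" "gs = lst E V' ds"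
      using extensions_iff[OF assms(1)] by blast
    have "terms E ds \<subseteq> U" unfolding terms_nth
    proof (intro allI impI)
      fix j assume "j < length ds"
      then show "Cod E (fst (ds ! j)) \<in> U"
        using seq_term_lst(2)[OF ds(1), of j] gs(3)[rule_format, of "Suc j"] ds by auto
    qed
    moreover have "rr E V V' cs ds" by (rule rr_of_yoneda_equiv[OF gs(2) refl *(3,4) assms(1) ds(3,1,2)])
    ultimately show "\<exists>ds. chain E V V' ds \<and> length ds = d \<and> rr E V V' cs ds \<and> terms E ds \<subseteq> U"
      using ds by blast
  qed (rule assms(1))
qed

context two_sided
begin

lemma Ext_zero_EZ:
  assumes "A \<in> Ob C"
  shows "(\<forall>i V. 0 < i \<longrightarrow> i < Suc N \<longrightarrow> V \<in> U \<longrightarrow> Ext_zero C i A V) \<longleftrightarrow>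
      (\<forall>n V. 0 < n \<longrightarrow> n \<le> N \<longrightarrow> V \<in> U \<longrightarrow> EZ C n A V)"
    "(\<forall>i V. 0 < i \<longrightarrow> i < Suc N \<longrightarrow> V \<in> U \<longrightarrow> Ext_zero C i V A) \<longleftrightarrow>
      (\<forall>n V. 0 < n \<longrightarrow> n \<le> N \<longrightarrow> V \<in> U \<longrightarrow> EZ C n V A)"
  unfolding less_Suc_eq_le using Ext_zero_iff U_Ob assms by blast+

lemma rigid: "d_rigid (Suc N) C U"
  unfolding d_rigid_def using subU EZ_U Ext_zero_iff U_Ob by (simp add: less_Suc_eq_le)

lemma weakly_maximal:
  "weakly_right_maximal_rigid (Suc N) C U" "weakly_left_maximal_rigid (Suc N) C U"
proof -
  have "upper_sub (Suc N) C U = Ob C" using upper_sub_eq[of N] up_all up_Ob by auto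
  moreover have "lower_sub (Suc N) C U = Ob C"
    using lower_sub_eq[of N] lo_all exc_sub.up_Ob[OF opp_sub] by auto
  ultimately show "weakly_right_maximal_rigid (Suc N) C U" "weakly_left_maximal_rigid (Suc N) C U"
    unfolding weakly_right_maximal_rigid_def weakly_left_maximal_rigid_def
    using rigid exact_category_axioms by auto
qed

lemma cluster_tilting:
  assumes "closed_under_additive_complements C U"
  shows "d_cluster_tilting (Suc N) C U"
proof -
  have "U = {A \<in> Ob C. \<forall>i V. 0 < i \<longrightarrow> i < Suc N \<longrightarrow> V \<in> U \<longrightarrow> Ext_zero C i A V}"
    by (subst perp_left_iff[OF assms], rule Collect_cong) (use Ext_zero_EZ(1) in blast)
  moreover have "U = {A \<in> Ob C. \<forall>i V. 0 < i \<longrightarrow> i < Suc N \<longrightarrow> V \<in> U \<longrightarrow> Ext_zero C i V A}"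
    by (subst perp_right_iff[OF assms], rule Collect_cong) (use Ext_zero_EZ(2) in blast)
  ultimately show ?thesis
    unfolding d_cluster_tilting_def functorially_finite_def
    using rigid exact_category_axioms generating cogenerating covariantly_finite contravariantly_finite by blast
qed

end

theorem theorem4p5:
  fixes E :: "('o, 'm) excat" and U :: "'o set" and d :: nat
  assumes "d \<ge> 1"
    and "exact_category E"
    and "d_rigid d E U"
    and "d_extension_closed d E U"
  shows "let C = full_sub E (lower_sub d (full_sub E (upper_sub d E U)) U) in
      (weakly_right_maximal_rigid d C U \<and> weakly_left_maximal_rigid d C U) \<and>
      (closed_under_additive_complements E U \<longrightarrow> d_cluster_tilting d C U)"
proof -
  have d: "0 < d" "Suc (d - 1) = d" using assms(1) by auto
  interpret E: chain_rigid E U d by (rule chain_rigidI[OF d(1) assms(2-4)])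
  define F where "F = full_sub E (upper_sub d E U)"
  have F: "F = E.upC" using E.upper_sub_eq[of "d - 1"] d(2) by (simp add: F_def)
  interpret F: bilifting F U "d - 1"
    unfolding F using E.lifting_upC E.lifting_opp_upC E.up_upC by (intro bilifting.intro bilifting_axioms.intro)
  define C where "C = full_sub E (lower_sub d F U)"
  have L: "lower_sub d F U = F.loS" using F.lower_sub_eq[of "d - 1"] d(2) by simp
  \<comment> \<open>The theorem takes the last full subcategory inside \<open>E\<close>, the locale
    takes it inside \<open>F\<close>; the induced conflations are the same.\<close>
  have "F.loS \<subseteq> Ob F" using F.ext_closed_loS by (simp add: ext_closed_def)
  then have "F.loS \<subseteq> upper_sub d E U" by (simp add: F_def)
  from full_sub_full_sub[OF this, of E] have "F.loC = full_sub E F.loS" by (simp only: F_def[symmetric])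
  then have C: "C = F.loC" by (simp only: C_def L)
  interpret C: two_sided C U "d - 1" unfolding C by (rule F.two_sided_loC)
  have "closed_under_additive_complements C U" if "closed_under_additive_complements E U"
  proof -
    have "direct_sum E A B S" if "direct_sum C A B S" for A B S
      using that by (auto simp: C_def direct_sum_def biproduct_def Hom_full_sub)
    then show ?thesis using that unfolding closed_under_additive_complements_def by blast
  qed
  then show ?thesis
    using C.weakly_maximal C.cluster_tilting unfolding d(2) by (simp add: Let_def C_def F_def)
qed

end
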